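(* Let $G=(V,E)$ be a finite simple graph with no four pairwise adjacent vertices ($K_4$-free), and let $T$ be its set of triangles. Then the deformation cone $\mathrm{DC}(\mathsf{Z}_G)$ of the graphical zonotope of $G$ has dimension $|E|+|T|$ and is triangulated by the $2^{|T|}$ simplicial cones $\mathsf{S}_\varepsilon$, $\varepsilon\in\{-1,+1\}^T$: we have $\mathrm{DC}(\mathsf{Z}_G)=\bigcup_{\varepsilon\in\{-1,1\}^T}\mathsf{S}_\varepsilon$, and the interiors of $\mathsf{S}_\varepsilon$ and $\mathsf{S}_{\varepsilon'}$ are disjoint for $\varepsilon\neq\varepsilon'$. In particular, $\mathrm{DC}(\mathsf{Z}_G)$ has exactly $|E|+2|T|$ rays, namely the rays spanned by the segments $\Delta_e$ for $e\in E$ and by the triangles $\Delta_t$ and $-\Delta_t$ for $t\in T$.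
   Context: For $X\subseteq V$, $\Delta_X=\mathrm{conv}(\mathbf{e}_i:i\in X)\subset\mathbb{R}^V$ where $(\mathbf{e}_i)$ is the standard basis; edges and triangles (sets of three pairwise adjacent vertices) are viewed as vertex subsets. For $\lambda\in\mathbb{R}$, $\lambda\mathsf{P}=\{\lambda\mathbf{x}:\mathbf{x}\in\mathsf{P}\}$, and sums of polytopes are Minkowski sums. The graphical zonotope is $\mathsf{Z}_G=\sum_{\{i,j\}\in E}[\mathbf{e}_i,\mathbf{e}_j]\subset\mathbb{R}^V$. For a polytope $\mathsf{P}$, its normal fan consists of the outer normal cones $\{\mathbf{c}: \mathsf{P}^{\mathbf{c}}=\mathsf{F}\}$ of its faces $\mathsf{F}$, where $\mathsf{P}^{\mathbf{c}}$ is the face maximizing $\langle\cdot,\mathbf{c}\rangle$; a deformation of $\mathsf{P}$ is a polytope whose normal fan coarsens (every cone of the finer fan lies in a cone of the coarser one) that of $\mathsf{P}$. The deformation cone $\mathrm{DC}(\mathsf{P})$ is the set of deformations of $\mathsf{P}$ up to translation, closed under Minkowski sum and nonnegative dilation and linearly isomorphic to a polyhedral cone (the cone of nonnegative edge-length vectors $\boldsymbol{\ell}\in\mathbb{R}_{\ge0}^{E(\mathsf{P})}$ satisfying $\sum_{e\in E(\mathsf{F})}\ell_e\mathbf{n}^{\mathsf{F}}_e=\mathbf{0}$ for every 2-face $\mathsf{F}$ of $\mathsf{P}$, with $\mathbf{n}^{\mathsf{F}}_e$ the outer unit normal of the edge $e$ within the plane of $\mathsf{F}$); dimension, rays and faces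 refer to this polyhedral structure, and a ray spanned by a polytope is the set of its nonnegative dilates up to translation. For $\varepsilon\in\{-1,+1\}^T$, $\mathsf{S}_\varepsilon$ is the cone generated by $\Delta_e$ ($e\in E$) and $\varepsilon_t\Delta_t$ ($t\in T$), i.e. the set of polytopes, up to translation, of the form $\sum_{e}\lambda_e\Delta_e+\sum_t\lambda_t\varepsilon_t\Delta_t$ with $\lambda\ge0$; its interior is given by all coefficients strictly positive. *)

theory Defs
  imports "HOL-Analysis.Analysis" "HOL-Analysis.Finite_Function_Topology" "HOL-Library.Set_Algebras"
begin

section \<open>Normal fans and deformations of polytopes\<close>

definition max_face :: "'a::euclidean_space set \<Rightarrow> 'a \<Rightarrow> 'a set"
  where "max_face P c = {x \<in> P. \<forall>y\<in>P. y \<bullet> c \<le> x \<bullet> c}"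

definition normal_cone :: "'a::euclidean_space set \<Rightarrow> 'a set \<Rightarrow> 'a set"
  where "normal_cone P F = {c. max_face P c = F}"

definition normal_fan :: "'a::euclidean_space set \<Rightarrow> 'a set set"
  where "normal_fan P = {normal_cone P F | F. F face_of P \<and> F \<noteq> {}}"

definition coarsens :: "'a set set \<Rightarrow> 'a set set \<Rightarrow> bool"
  where "coarsens M N \<longleftrightarrow> (\<forall>C\<in>N. \<exists>D\<in>M. C \<subseteq> D)"

text \<open>The library predicate \<^const>\<open>polytope\<close> also holds of the empty set.\<close>

definition deformation_of :: "'a::euclidean_space set \<Rightarrow> 'a set \<Rightarrow> bool"
  where "deformation_of Q P \<longleftrightarrow>
    polytope Q \<and> Q \<noteq> {} \<and> coarsens (normal_fan Q) (normal_fan P)"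

text \<open>A polytope up to translation is the set of all its translates.\<close>

definition translation_class :: "'a::real_vector set \<Rightarrow> 'a set set"
  where "translation_class Q = {(+) a ` Q | a. True}"

definition deformation_cone :: "'a::euclidean_space set \<Rightarrow> 'a set set set"
  where "deformation_cone P = translation_class ` {Q. deformation_of Q P}"

definition dilate :: "real \<Rightarrow> 'a::real_vector set \<Rightarrow> 'a set"
  where "dilate c P = (*\<^sub>R) c ` P"

definition spanned_ray :: "'a::real_vector set \<Rightarrow> 'a set set set"
  where "spanned_ray P = {translation_class (dilate c P) | c. 0 \<le> c}"

section \<open>The polyhedral structure on the deformation cone\<close>

text \<open>
  Vectors indexed by the edges of \<open>P\<close> are finitely supported functions on
  sets whose support consists of edges of \<open>P\<close>.
\<close>

definition edge_normal :: "'a::euclidean_space set \<Rightarrow> 'a set \<Rightarrow> 'a"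
  where "edge_normal F e =
    (THE n. norm n = 1 \<and> n \<in> span {x - y | x y. x \<in> F \<and> y \<in> F} \<and> max_face F n = e)"

definition edge_length_cone :: "'a::euclidean_space set \<Rightarrow> ('a set \<Rightarrow>\<^sub>0 real) set"
  where "edge_length_cone P = {l.
    Poly_Mapping.keys l \<subseteq> {e. e edge_of P} \<and>
    (\<forall>e. e edge_of P \<longrightarrow> 0 \<le> Poly_Mapping.lookup l e) \<and>
    (\<forall>F. F face_of P \<and> aff_dim F = 2 \<longrightarrow>
      (\<Sum>e | e edge_of F. Poly_Mapping.lookup l e *\<^sub>R edge_normal F e) = 0)}"

text \<open>
  The isomorphism from the deformation cone to the edge length cone. If \<open>Q\<close> is a
  deformation of \<open>P\<close>, the edge \<open>e\<close> of \<open>P\<close> corresponds to the face of \<open>Q\<close> that is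
  maximal in any direction \<open>c\<close> for which \<open>e\<close> is the maximal face of \<open>P\<close>; this face is a
  segment parallel to \<open>e\<close>, possibly a point, and its diameter is its length. It depends neither
  on \<open>c\<close> nor, up to translation, on the representative \<open>Q\<close>.
\<close>

definition edge_lengths_of :: "'a::euclidean_space set \<Rightarrow> 'a set \<Rightarrow> 'a set \<Rightarrow>\<^sub>0 real"
  where "edge_lengths_of P Q = Poly_Mapping.Abs_poly_mapping
    (\<lambda>e. if e edge_of P then diameter (max_face Q (SOME c. max_face P c = e)) else 0)"

definition edge_lengths :: "'a::euclidean_space set \<Rightarrow> 'a set set \<Rightarrow> 'a set \<Rightarrow>\<^sub>0 real"
  where "edge_lengths P D = the_elem (edge_lengths_of P ` D)"

definition deformation_cone_dim :: "'a::euclidean_space set \<Rightarrow> nat"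
  where "deformation_cone_dim P = dim (edge_length_cone P)"

definition deformation_cone_rays :: "'a::euclidean_space set \<Rightarrow> 'a set set set set"
  where "deformation_cone_rays P =
    {{D \<in> deformation_cone P. edge_lengths P D \<in> R} | R.
      R face_of edge_length_cone P \<and> dim R = 1}"

definition simplicial_cone :: "nat \<Rightarrow> 'a::real_vector set \<Rightarrow> bool"
  where "simplicial_cone n C \<longleftrightarrow>
    (\<exists>B. finite B \<and> card B = n \<and> independent B \<and> C = convex_cone hull B)"

section \<open>Graphical zonotopes\<close>

text \<open>
  The vertex set of a graph is a finite type \<open>'v\<close>, and a simple graph is given by its set \<open>E\<close>
  of edges, which are two-element sets of vertices.
\<close>

definition clique :: "'v set set \<Rightarrow> 'v set \<Rightarrow> bool"
  where "clique E K \<longleftrightarrow> (\<forall>i\<in>K. \<forall>j\<in>K. i \<noteq> j \<longrightarrow> {i, j} \<in> E)"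

definition triangles :: "'v set set \<Rightarrow> 'v set set"
  where "triangles E = {t. card t = 3 \<and> clique E t}"

definition simplex_on :: "'v::finite set \<Rightarrow> (real ^ 'v) set"
  where "simplex_on X = convex hull ((\<lambda>i. axis i 1) ` X)"

text \<open>For an edge \<open>e = {i, j}\<close>, the set \<open>simplex_on e\<close> is the segment joining the basis vectors
  of \<open>i\<close> and \<open>j\<close>. Sums of sets are Minkowski sums.\<close>

definition graphical_zonotope :: "'v::finite set set \<Rightarrow> (real ^ 'v) set"
  where "graphical_zonotope E = (\<Sum>e\<in>E. simplex_on e)"

definition sign_sum ::
    "'v::finite set set \<Rightarrow> ('v set \<Rightarrow> real) \<Rightarrow> ('v set \<Rightarrow> real) \<Rightarrow> (real ^ 'v) set"
  where "sign_sum E \<epsilon> \<mu> =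
    (\<Sum>e\<in>E. dilate (\<mu> e) (simplex_on e)) +
    (\<Sum>t\<in>triangles E. dilate (\<mu> t) (dilate (\<epsilon> t) (simplex_on t)))"

definition sign_cone :: "'v::finite set set \<Rightarrow> ('v set \<Rightarrow> real) \<Rightarrow> (real ^ 'v) set set set"
  where "sign_cone E \<epsilon> =
    {translation_class (sign_sum E \<epsilon> \<mu>) | \<mu>. \<forall>s \<in> E \<union> triangles E. 0 \<le> \<mu> s}"

definition sign_cone_interior ::
    "'v::finite set set \<Rightarrow> ('v set \<Rightarrow> real) \<Rightarrow> (real ^ 'v) set set set"
  where "sign_cone_interior E \<epsilon> =
    {translation_class (sign_sum E \<epsilon> \<mu>) | \<mu>. \<forall>s \<in> E \<union> triangles E. 0 < \<mu> s}"

definition sign_vectors :: "'v set set \<Rightarrow> ('v set \<Rightarrow> real) set"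
  where "sign_vectors E = triangles E \<rightarrow>\<^sub>E {-1, 1}"

end

theory Submission
  imports Defs "HOL-Library.Multiset"
begin

text \<open>
  The maximal face of the zonotope in direction \<open>c\<close> only depends on the signs of \<open>c i - c j\<close> over
  the edges \<open>{i, j}\<close>; it is an edge iff exactly one of these differences vanishes, and the
  two-dimensional faces are parallelograms and, one for each position of a triangle relative to the
  other vertices, hexagons. Hence both a deformation and an element of the edge length cone amount
  to nonnegative lengths \<open>L c\<close> on the walls \<open>c i = c j\<close> that do not change across a parallelogram,
  while crossing a hexagon over the triangle \<open>{i, j, k}\<close> changes the three pairs of opposite edges
  by the same amount. As there is no \<open>K\<^sub>4\<close>, every further vertex \<open>l\<close> misses a vertex \<open>q\<close> of the
  triangle; moving \<open>l\<close> across the triangle while watching an edge at \<open>q\<close> only crosses parallelograms,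
  so this amount depends on the triangle alone. Therefore \<open>L\<close> on the walls of \<open>{i, j}\<close> is a constant
  plus one term for each vertex \<open>k\<close> above the edge with \<open>{i, j, k}\<close> a triangle. The position of each
  \<open>k\<close> being arbitrary, nonnegativity says exactly that \<open>L\<close> is the length function of
  \<open>\<Sum> w\<^sub>e \<Delta>\<^sub>e + \<Sum> w\<^sub>t \<Delta>\<^sub>t\<close> with \<open>w\<^sub>e \<ge> 0\<close> and \<open>w\<^sub>t\<close> of any sign. These weights are unique, which
  reduces all claims to the cone of weights.
\<close>

section \<open>Connecting linear orders by adjacent transpositions\<close>

text \<open>A segment between two directions on one wall may meet several hyperplanes at a single
  point. Walls are therefore encoded by linear orders of the vertices in which \<open>i\<close> and
  \<open>j\<close> are merged, since any two orders are joined by swaps of neighbours. A swap with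
  the merged point may still cross two or three hyperplanes at once. For a contracted triangle it is
  resolved into single flips by letting the moving vertex stop between the measured edge and the
  third vertex of the triangle; no hexagon is met because the measured edge contains the vertex to
  which the moving one is not adjacent.

  The passage to weights has a twist: edge lengths are not linear in the weights, as the lengths of
  \<Delta>_t and -\<Delta>_t add up to those of the three edges of t. Adding to w_e the negative
  parts of the weights of all triangles over e (\<open>coord\<close>) makes them linear. On a fixed
  sign pattern this correction is itself linear, which gives the simplicial cones; strict convexity
  of the negative part at 0 makes \<Delta>_t and -\<Delta>_t separate rays.\<close>

lemma adjacent_swaps_connect:
  fixes \<Psi> :: "'w list \<Rightarrow> 'b"
  assumes swap: "\<And>us u v ws. distinct (us @ u # v # ws) \<Longrightarrow> set (us @ u # v # ws) = W
      \<Longrightarrow> \<Psi> (us @ u # v # ws) = \<Psi> (us @ v # u # ws)"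
    and xs: "distinct xs" "set xs = W" and ys: "distinct ys" "set ys = W"
  shows "\<Psi> xs = \<Psi> ys"
proof -
  \<comment> \<open>Bubbling: \<open>y\<close> is swapped with the last element of \<open>as\<close>
    and then, by induction, moves past the others.\<close>
  have move: "\<Psi> (p @ as @ y # bs) = \<Psi> (p @ y # as @ bs)"
    if "distinct (p @ as @ y # bs)" "set (p @ as @ y # bs) = W" for p as y bs
    using that
  proof (induction as arbitrary: bs rule: rev_induct)
    case (snoc a as)
    have "\<Psi> ((p @ as) @ a # y # bs) = \<Psi> ((p @ as) @ y # a # bs)"
      using snoc.prems by (intro swap) auto
    moreover have "\<Psi> (p @ as @ y # a # bs) = \<Psi> (p @ y # as @ a # bs)"
      using snoc.prems by (intro snoc.IH) auto
    ultimately show ?case by simp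
  qed simp
  \<comment> \<open>The prefix \<open>p\<close> is already in its final order; each step brings the
    next element of \<open>ys\<close> to the place right behind it.\<close>
  have "\<Psi> (p @ xs) = \<Psi> (p @ ys)"
    if "mset xs = mset ys" "distinct (p @ xs)" "set (p @ xs) = W" for p xs ys
    using that
  proof (induction ys arbitrary: p xs)
    case (Cons y ys)
    then obtain as bs where xs: "xs = as @ y # bs"
      by (metis list.set_intros(1) set_mset_mset split_list)
    have "\<Psi> (p @ xs) = \<Psi> (p @ y # as @ bs)"
      unfolding xs using Cons.prems(2,3) xs by (intro move) auto
    also have "\<dots> = \<Psi> ((p @ [y]) @ ys)"
      using Cons.IH[of "as @ bs" "p @ [y]"] Cons.prems xs by auto
    finally show ?case by simp
  qed simp
  from this[of xs ys "[]"] show ?thesis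
    using xs ys by (simp add: set_eq_iff_mset_eq_distinct[symmetric])
qed

text \<open>The rank of \<open>x\<close> in a list, real-valued so that it can serve as a height
  function on vertices.\<close>

definition pos :: "'w list \<Rightarrow> 'w \<Rightarrow> real" where
  "pos xs x = real (length (takeWhile (\<lambda>y. y \<noteq> x) xs))"

lemma pos_append: "pos (xs @ ys) x = (if x \<in> set xs then pos xs x else real (length xs) + pos ys x)"
proof (cases "x \<in> set xs")
  case False
  then have "takeWhile (\<lambda>y. y \<noteq> x) (xs @ ys) = xs @ takeWhile (\<lambda>y. y \<noteq> x) ys"
    by (intro takeWhile_append2) auto
  then show ?thesis using False by (simp add: pos_def)
qed (auto simp: pos_def)

lemma pos_Cons: "pos (y # ys) x = (if x = y then 0 else 1 + pos ys x)"
  by (simp add: pos_def)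

lemma pos_nonneg: "0 \<le> pos xs x"
  by (simp add: pos_def)

lemma pos_less_length: "x \<in> set xs \<Longrightarrow> pos xs x \<le> real (length xs) - 1"
  by (induction xs) (auto simp: pos_Cons)

lemma pos_eq_iff: "x \<in> set xs \<Longrightarrow> y \<in> set xs \<Longrightarrow> pos xs x = pos xs y \<longleftrightarrow> x = y"
proof (induction xs)
  case (Cons a xs)
  then show ?case using pos_nonneg[of xs x] pos_nonneg[of xs y] by (auto simp: pos_Cons)
qed simp

lemma pos_sorted:
  "sorted (map f xs) \<Longrightarrow> x \<in> set xs \<Longrightarrow> y \<in> set xs \<Longrightarrow> f x < f y \<Longrightarrow> pos xs x < pos xs y"
proof (induction xs)
  case (Cons a xs)
  have "y \<noteq> a" using Cons.prems by auto
  with Cons show ?case using pos_nonneg[of xs y] by (auto simp: pos_Cons)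
qed simp

text \<open>Ranks after sorting by \<open>c\<close> break the ties of \<open>c\<close> and keep its
  strict inequalities: a generic function whose chamber has \<open>c\<close> in its closure.\<close>

lemma injective_perturbation:
  fixes c :: "'w \<Rightarrow> real"
  assumes "finite W"
  obtains f :: "'w \<Rightarrow> real" where "inj_on f W" "\<And>x y. x \<in> W \<Longrightarrow> y \<in> W \<Longrightarrow> c x < c y \<Longrightarrow> f x < f y"
proof -
  obtain ws where ws: "set ws = W" "distinct ws"
    using finite_distinct_list[OF assms] by blast
  let ?f = "pos (sort_key c ws)"
  have "inj_on ?f W" using ws by (auto simp: inj_on_def pos_eq_iff)
  moreover have "?f x < ?f y" if "x \<in> W" "y \<in> W" "c x < c y" for x y
    using that ws by (intro pos_sorted[where f = c]) auto
  ultimately show ?thesis using that by blast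
qed

text \<open>The bridge from lists to functions. By \<open>order\<close> only the induced order
  counts; \<open>swap\<close> treats two chambers with a common wall on which \<open>h\<close> lies,
  tying exactly \<open>u\<close> and \<open>v\<close> and refined by both \<open>f\<close> and
  \<open>g\<close>.\<close>

lemma swaps_connect:
  fixes \<Phi> :: "('w \<Rightarrow> real) \<Rightarrow> 'b"
  assumes W: "finite W"
    and order: "\<And>f g. inj_on f W \<Longrightarrow> inj_on g W \<Longrightarrow> (\<forall>x\<in>W. \<forall>y\<in>W. f x < f y \<longleftrightarrow> g x < g y) \<Longrightarrow> \<Phi> f = \<Phi> g"
    and swap: "\<And>f g (h :: 'w \<Rightarrow> real) u v. inj_on f W \<Longrightarrow> inj_on g W \<Longrightarrow> u \<in> W \<Longrightarrow> v \<in> W \<Longrightarrow> u \<noteq> v \<Longrightarrow> h u = h v \<Longrightarrow>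
      (\<forall>x\<in>W. \<forall>y\<in>W. h x = h y \<longrightarrow> x = y \<or> {x, y} = {u, v}) \<Longrightarrow>
      (\<forall>x\<in>W. \<forall>y\<in>W. h x < h y \<longrightarrow> f x < f y \<and> g x < g y) \<Longrightarrow> g u < g v \<Longrightarrow> f v < f u \<Longrightarrow> \<Phi> f = \<Phi> g"
    and f: "inj_on f W" and g: "inj_on g W"
  shows "\<Phi> f = \<Phi> g"
proof -
  have *: "\<Phi> (pos (us @ u # v # ws)) = \<Phi> (pos (us @ v # u # ws))"
    if d: "distinct (us @ u # v # ws)" and s: "set (us @ u # v # ws) = W" for us u v ws
  proof -
    let ?xs = "us @ u # v # ws" and ?ys = "us @ v # u # ws"
    \<comment> \<open>The ranks \<open>length us\<close> and \<open>length us + 1\<close> are merged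
      at their midpoint. By \<open>out\<close> all other ranks are at distance at least 3/2 from it,
      so no further tie arises.\<close>
    let ?h = "\<lambda>x. if x = u \<or> x = v then real (length us) + 1/2 else pos ?xs x"
    have sy: "set ?ys = W" using s by auto
    have eq: "pos ?xs x = pos ?ys x" if "x \<noteq> u" "x \<noteq> v" for x
      using that by (simp add: pos_append pos_Cons)
    have out: "pos ?xs x \<le> real (length us) - 1 \<or> real (length us) + 2 \<le> pos ?xs x"
      if "x \<in> W" "x \<noteq> u" "x \<noteq> v" for x
      using that d s pos_less_length[of x us] pos_nonneg[of ws x]
      by (auto simp: pos_append pos_Cons)
    have uv: "pos ?xs u = length us" "pos ?xs v = length us + 1"
       "pos ?ys v = length us" "pos ?ys u = length us + 1"
      using d by (auto simp: pos_append pos_Cons)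
    have "\<Phi> (pos ?ys) = \<Phi> (pos ?xs)"
    proof (rule swap[of _ _ u v ?h])
      show "inj_on (pos ?xs) W" "inj_on (pos ?ys) W"
        using s sy by (metis inj_onI pos_eq_iff)+
      show "u \<in> W" "v \<in> W" "u \<noteq> v" using d s by auto
      show "?h u = ?h v" by simp
      show "pos ?xs u < pos ?xs v" "pos ?ys v < pos ?ys u" using uv by auto
      show "\<forall>x\<in>W. \<forall>y\<in>W. ?h x = ?h y \<longrightarrow> x = y \<or> {x, y} = {u, v}"
      proof (intro ballI impI)
        fix x y assume xy: "x \<in> W" "y \<in> W" "?h x = ?h y"
        show "x = y \<or> {x, y} = {u, v}"
        proof (cases "x \<in> {u, v} \<or> y \<in> {u, v}")
          case True
          then show ?thesis using xy out[of x] out[of y] by (auto split: if_splits)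
        next
          case False
          then show ?thesis using xy s by (auto simp: pos_eq_iff)
        qed
      qed
      show "\<forall>x\<in>W. \<forall>y\<in>W. ?h x < ?h y \<longrightarrow> pos ?ys x < pos ?ys y \<and> pos ?xs x < pos ?xs y"
      proof (intro ballI impI)
        fix x y assume xy: "x \<in> W" "y \<in> W" "?h x < ?h y"
        then show "pos ?ys x < pos ?ys y \<and> pos ?xs x < pos ?xs y"
          using out[of x] out[of y] uv eq[of x] eq[of y]
          by (cases "x = u \<or> x = v"; cases "y = u \<or> y = v") auto
      qed
    qed
    then show ?thesis by simp
  qed
  have reduce: "\<exists>xs. distinct xs \<and> set xs = W \<and> \<Phi> f = \<Phi> (pos xs)" if f: "inj_on f W" for f
  proof -
    obtain ws where ws: "set ws = W" "distinct ws"
      using finite_distinct_list[OF W] by blast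
    let ?xs = "sort_key f ws"
    have lt: "pos ?xs x < pos ?xs y" if "x \<in> W" "y \<in> W" "f x < f y" for x y
      using that ws by (intro pos_sorted[where f = f]) auto
    have "\<Phi> f = \<Phi> (pos ?xs)"
    proof (rule order[OF f])
      show "inj_on (pos ?xs) W" using ws by (auto simp: inj_on_def pos_eq_iff)
      show "\<forall>x\<in>W. \<forall>y\<in>W. f x < f y \<longleftrightarrow> pos ?xs x < pos ?xs y"
        using lt f by (metis inj_onD less_irrefl not_less_iff_gr_or_eq order_less_trans)
    qed
    then show ?thesis using ws by (intro exI[of _ ?xs]) auto
  qed
  from reduce[OF f] reduce[OF g] adjacent_swaps_connect[of W "\<lambda>xs. \<Phi> (pos xs)"] * show ?thesis
    by metis
qed

section \<open>Sign patterns\<close>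

definition tight :: "'v set set \<Rightarrow> real ^ 'v \<Rightarrow> 'v set set" where
  "tight E c = {e \<in> E. \<forall>i\<in>e. \<forall>j\<in>e. c $ i = c $ j}"

definition same_sides :: "'v set set \<Rightarrow> real ^ 'v \<Rightarrow> real ^ 'v \<Rightarrow> bool" where
  "same_sides E c c' \<longleftrightarrow> (\<forall>i j. {i, j} \<in> E \<longrightarrow> (c $ i < c $ j \<longleftrightarrow> c' $ i < c' $ j))"

text \<open>The cell of \<open>m\<close> in the graphical arrangement lies in the closure of the cell of \<open>c\<close>.\<close>

definition near :: "'v set set \<Rightarrow> real ^ 'v \<Rightarrow> real ^ 'v \<Rightarrow> bool" where
  "near E m c \<longleftrightarrow> (\<forall>i j. {i, j} \<in> E \<longrightarrow> m $ i < m $ j \<longrightarrow> c $ i < c $ j)"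

lemma tight_pair: "{i, j} \<in> tight E c \<longleftrightarrow> {i, j} \<in> E \<and> c $ i = c $ j"
  by (auto simp: tight_def)

lemma tight_subset: "tight E c \<subseteq> E"
  by (auto simp: tight_def)

lemma near_refl: "near E m m"
  by (simp add: near_def)

lemma nearD: "near E m c \<Longrightarrow> {i, j} \<in> E \<Longrightarrow> m $ i < m $ j \<Longrightarrow> c $ i < c $ j"
  by (simp add: near_def)

lemma near_trans: "near E m n \<Longrightarrow> near E n c \<Longrightarrow> near E m c"
  by (simp add: near_def)

lemma same_sidesD: "same_sides E c c' \<Longrightarrow> {i, j} \<in> E \<Longrightarrow> c $ i < c $ j \<longleftrightarrow> c' $ i < c' $ j"
  by (simp add: same_sides_def)

lemma same_sides_eq_iff: "same_sides E c c' \<Longrightarrow> {i, j} \<in> E \<Longrightarrow> c $ i = c $ j \<longleftrightarrow> c' $ i = c' $ j"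
  using same_sidesD[of E c c' i j] same_sidesD[of E c c' j i]
  by (cases rule: linorder_cases[of "c $ i" "c $ j"]) (auto simp: insert_commute)

lemma near_same_sides: "same_sides E m m' \<Longrightarrow> near E m c \<longleftrightarrow> near E m' c"
  by (simp add: same_sides_def near_def)

lemma eventually_near: "\<forall>\<^sub>F \<eta> in at_right 0. near E m (m + \<eta> *\<^sub>R d)"
proof -
  have "\<forall>\<^sub>F \<eta> in at_right 0. m $ i < m $ j \<longrightarrow> (m + \<eta> *\<^sub>R d) $ i < (m + \<eta> *\<^sub>R d) $ j" for i j
  proof (cases "m $ i < m $ j")
    case True
    have "((\<lambda>\<eta>. (m + \<eta> *\<^sub>R d) $ j - (m + \<eta> *\<^sub>R d) $ i) \<longlongrightarrow> (m + 0 *\<^sub>R d) $ j - (m + 0 *\<^sub>R d) $ i) (at_right 0)"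
      by (intro tendsto_intros)
    then have "\<forall>\<^sub>F \<eta> in at_right 0. 0 < (m + \<eta> *\<^sub>R d) $ j - (m + \<eta> *\<^sub>R d) $ i"
      using True by (intro order_tendstoD(1)) auto
    then show ?thesis by (rule eventually_mono) simp
  qed simp
  then have "\<forall>\<^sub>F \<eta> in at_right 0. \<forall>i j. m $ i < m $ j \<longrightarrow> (m + \<eta> *\<^sub>R d) $ i < (m + \<eta> *\<^sub>R d) $ j"
    by (intro eventually_all_finite) auto
  then show ?thesis
    by (rule eventually_mono) (auto simp: near_def)
qed

text \<open>The strict inequalities of \<open>m\<close> survive a small step, while its ties are
  broken by \<open>d\<close> alone; prescribed neighbours of a cell are produced in this
  way.\<close>

lemma near_pushE:
  fixes m d :: "real ^ 'v"
  obtains \<eta> where "\<eta> > 0" "near E m (m + \<eta> *\<^sub>R d)"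
    "\<And>i j. m $ i = m $ j \<Longrightarrow> (m + \<eta> *\<^sub>R d) $ i < (m + \<eta> *\<^sub>R d) $ j \<longleftrightarrow> d $ i < d $ j"
proof -
  have "\<forall>\<^sub>F \<eta> in at_right 0. near E m (m + \<eta> *\<^sub>R d) \<and> (0::real) < \<eta>"
    by (intro eventually_conj eventually_near eventually_at_right_less)
  then obtain \<eta> :: real where "\<eta> > 0" "near E m (m + \<eta> *\<^sub>R d)"
    using eventually_happens[of _ "at_right (0::real)"] by force
  then show ?thesis using that[of \<eta>] by simp
qed

locale simple_graph =
  fixes E :: "'v::finite set set"
  assumes simple: "\<forall>e\<in>E. card e = 2"
begin

lemma edgeE:
  assumes "e \<in> E" obtains i j where "e = {i, j}" "i \<noteq> j"
  using assms simple by (meson card_2_iff)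

lemma edge_neq: "{i, j} \<in> E \<Longrightarrow> i \<noteq> j"
  using simple by force

lemma tight_eqI:
  assumes "\<And>i j. {i, j} \<in> E \<Longrightarrow> c $ i = c $ j \<longleftrightarrow> {i, j} \<in> A" "A \<subseteq> E"
  shows "tight E c = A"
proof (intro set_eqI)
  fix e show "e \<in> tight E c \<longleftrightarrow> e \<in> A"
  proof (cases "e \<in> E")
    case True
    then obtain i j where "e = {i, j}" by (elim edgeE)
    then show ?thesis using True assms(1)[of i j] by (auto simp: tight_pair)
  next
    case False
    then show ?thesis using assms(2) by (auto simp: tight_def)
  qed
qed

lemma tight_same_sides: "same_sides E c c' \<Longrightarrow> tight E c = tight E c'"
  by (rule tight_eqI) (simp_all add: tight_pair same_sides_eq_iff[of E c c'] tight_subset)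

lemma tight_near: "near E m c \<Longrightarrow> tight E c \<subseteq> tight E m"
proof
  fix e assume n: "near E m c" and e: "e \<in> tight E c"
  then have "e \<in> E" by (auto simp: tight_def)
  then obtain i j where ij: "e = {i, j}" by (elim edgeE)
  have "\<not> m $ i < m $ j" "\<not> m $ j < m $ i"
    using nearD[OF n, of i j] nearD[OF n, of j i] e unfolding ij tight_pair by (auto simp: insert_commute)
  then show "e \<in> tight E m"
    using e unfolding ij tight_pair by auto
qed

lemma same_sidesI_near:
  assumes "near E m c" "near E m c'"
    and "\<And>x y. {x, y} \<in> E \<Longrightarrow> m $ x = m $ y \<Longrightarrow> c $ x < c $ y \<longleftrightarrow> c' $ x < c' $ y"
  shows "same_sides E c c'"
  unfolding same_sides_def
proof (intro allI impI)
  fix x y assume xy: "{x, y} \<in> E"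
  then have "{y, x} \<in> E" by (simp add: insert_commute)
  then show "c $ x < c $ y \<longleftrightarrow> c' $ x < c' $ y"
    using assms xy nearD[OF assms(1)] nearD[OF assms(2)]
    by (metis less_asym linorder_less_linear)
qed

lemma triangles_pairs: "{i, j, k} \<in> triangles E \<longleftrightarrow>
    i \<noteq> j \<and> i \<noteq> k \<and> j \<noteq> k \<and> {i, j} \<in> E \<and> {i, k} \<in> E \<and> {j, k} \<in> E"
proof -
  have "card {i, j, k} = 3 \<longleftrightarrow> i \<noteq> j \<and> i \<noteq> k \<and> j \<noteq> k"
    by (auto simp: card_insert_if)
  then show ?thesis
    by (auto simp: triangles_def clique_def insert_commute)
qed

lemma triangleE:
  assumes "t \<in> triangles E"
  obtains i j k where "t = {i, j, k}" "i \<noteq> j" "i \<noteq> k" "j \<noteq> k" "{i, j} \<in> E" "{i, k} \<in> E" "{j, k} \<in> E"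
proof -
  from assms have "card t = 3" by (simp add: triangles_def)
  then obtain i j k where "t = {i, j, k}" by (auto simp: card_3_iff)
  then show ?thesis using that assms triangles_pairs by metis
qed

lemma edges_triangles_disjoint: "E \<inter> triangles E = {}"
  using simple by (force simp: triangles_def)

lemma finite_edges: "finite E"
  by simp

end

section \<open>Length systems\<close>

text \<open>
  The lengths \<open>L c\<close> are indexed by the directions \<open>c\<close> whose maximal face is an edge. The
  parallelogram and the hexagon condition are the closing conditions of the two kinds of
  two-dimensional faces of a graphical zonotope.
\<close>

locale length_system = simple_graph E for E :: "'v::finite set set" +
  fixes L :: "real ^ 'v \<Rightarrow> real"
  assumes K4_free: "\<not> (\<exists>K. card K = 4 \<and> clique E K)"
    and L_same_sides: "tight E c = {a} \<Longrightarrow> same_sides E c c' \<Longrightarrow> L c = L c'"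
    and L_nonneg: "tight E c = {a} \<Longrightarrow> 0 \<le> L c"
    and parallelogram: "a \<noteq> b \<Longrightarrow> tight E m = {a, b} \<Longrightarrow> near E m c \<Longrightarrow> near E m c' \<Longrightarrow>
      tight E c = {a} \<Longrightarrow> tight E c' = {a} \<Longrightarrow> L c = L c'"
    and hexagon: "{i, j, k} \<in> triangles E \<Longrightarrow> tight E m = {{i, j}, {i, k}, {j, k}} \<Longrightarrow>
      near E m c \<Longrightarrow> near E m c' \<Longrightarrow> near E m d \<Longrightarrow> near E m d' \<Longrightarrow>
      c $ i = c $ j \<Longrightarrow> c $ i < c $ k \<Longrightarrow> c' $ i = c' $ j \<Longrightarrow> c' $ k < c' $ i \<Longrightarrow>
      d $ j = d $ k \<Longrightarrow> d $ j < d $ i \<Longrightarrow> d' $ j = d' $ k \<Longrightarrow> d' $ i < d' $ j \<Longrightarrow>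
      L c - L c' = L d - L d'"
begin

section \<open>Directions on one wall that differ on one edge\<close>

lemma single_flip:
  assumes c: "tight E c = {a}" and c': "tight E c' = {a}"
    and flip: "\<And>x y. {x, y} \<in> E \<Longrightarrow> {x, y} \<noteq> b \<Longrightarrow> c $ x < c $ y \<longleftrightarrow> c' $ x < c' $ y"
  shows "L c = L c'"
proof (cases "same_sides E c c'")
  case True
  then show ?thesis using L_same_sides c by blast
next
  case False
  have eqa: "c $ x = c $ y \<longleftrightarrow> {x, y} = a" "c' $ x = c' $ y \<longleftrightarrow> {x, y} = a" if "{x, y} \<in> E" for x y
    using c c' that tight_pair[of x y E c] tight_pair[of x y E c'] by auto
  from False obtain x y where xy: "{x, y} \<in> E" "\<not> (c $ x < c $ y \<longleftrightarrow> c' $ x < c' $ y)"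
    by (auto simp: same_sides_def)
  then have b: "b = {x, y}" using flip by blast
  have ab: "a \<noteq> b" using eqa[OF xy(1)] xy(2) b by auto
  have "c $ x \<noteq> c $ y" "c' $ x \<noteq> c' $ y" using eqa[OF xy(1)] ab b by auto
  then consider "c $ x < c $ y" "c' $ y < c' $ x" | "c $ y < c $ x" "c' $ x < c' $ y"
    using xy(2) by linarith
  then obtain p q where pq: "b = {p, q}" "{p, q} \<in> E" "c $ p < c $ q" "c' $ q < c' $ p"
  proof cases
    case 1 then show ?thesis using that[of x y] xy(1) b by blast
  next
    case 2 then show ?thesis using that[of y x] xy(1) b by (simp add: insert_commute)
  qed
  \<comment> \<open>Apart from the hyperplane of \<open>a\<close>, which contains it, the segment
    from \<open>c\<close> to \<open>c'\<close> meets only the hyperplane of \<open>b\<close> among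
    those of the edges; \<open>s\<close> is the parameter of that point. Exactly \<open>a\<close>
    and \<open>b\<close> are tied there, as over a parallelogram.\<close>
  define s where "s = (c $ q - c $ p) / ((c $ q - c $ p) + (c' $ p - c' $ q))"
  define m where "m = (1 - s) *\<^sub>R c + s *\<^sub>R c'"
  have s: "0 < s" "s < 1" using pq by (auto simp: s_def field_simps)
  have m: "m $ x = (1 - s) * c $ x + s * c' $ x" for x by (simp add: m_def)
  have mpq: "m $ p = m $ q"
  proof -
    have "s * ((c $ q - c $ p) + (c' $ p - c' $ q)) = c $ q - c $ p"
      using pq by (simp add: s_def)
    then show ?thesis unfolding m by (simp add: algebra_simps)
  qed
  have lt: "m $ x < m $ y" if "{x, y} \<in> E" "{x, y} \<noteq> b" "c $ x < c $ y" for x y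
    using that flip[of x y] s unfolding m by (intro add_strict_mono mult_strict_left_mono) auto
  have meq: "m $ x = m $ y \<longleftrightarrow> {x, y} \<in> {a, b}" if xy: "{x, y} \<in> E" for x y
  proof (cases "{x, y} \<in> {a, b}")
    case True
    then show ?thesis using mpq eqa[OF xy] pq by (auto simp: m doubleton_eq_iff)
  next
    case False
    then have "c $ x < c $ y \<or> c $ y < c $ x" using eqa[OF xy] by auto
    then have "m $ x < m $ y \<or> m $ y < m $ x"
      using lt[of x y] lt[of y x] False xy by (auto simp: insert_commute)
    then show ?thesis using False by auto
  qed
  have "tight E m = {a, b}"
    using meq c tight_subset[of E c] pq by (intro tight_eqI) auto
  moreover have "near E m c" "near E m c'"
  proof -
    have *: "c $ x < c $ y \<and> c' $ x < c' $ y" if xy: "{x, y} \<in> E" "m $ x < m $ y" for x y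
    proof -
      have nb: "{x, y} \<noteq> a" "{x, y} \<noteq> b" using meq[OF xy(1)] xy by auto
      then have "c $ x \<noteq> c $ y" using eqa xy by auto
      moreover have "\<not> c $ y < c $ x" using lt[of y x] xy nb by (auto simp: insert_commute)
      ultimately show ?thesis using flip[of x y] xy nb by auto
    qed
    then show "near E m c" "near E m c'" by (auto simp: near_def)
  qed
  ultimately show ?thesis using parallelogram[OF ab _ _ _ c c', of m] by simp
qed

text \<open>For two neighbours of one cell only the ties of \<open>m\<close> are left to
  compare.\<close>

lemma single_flip_near:
  assumes c: "tight E c = {a}" and c': "tight E c' = {a}" and "near E m c" "near E m c'"
    and flip: "\<And>x y. {x, y} \<in> E \<Longrightarrow> m $ x = m $ y \<Longrightarrow> {x, y} \<noteq> b \<Longrightarrow> c $ x < c $ y \<longleftrightarrow> c' $ x < c' $ y"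
  shows "L c = L c'"
proof (rule single_flip[OF c c', of b])
  fix x y assume xy: "{x, y} \<in> E" "{x, y} \<noteq> b"
  then have "{y, x} \<in> E" by (simp add: insert_commute)
  then show "c $ x < c $ y \<longleftrightarrow> c' $ x < c' $ y"
    using assms xy nearD[of E m c] nearD[of E m c'] by (metis less_asym linorder_less_linear)
qed

section \<open>The jump of the lengths across a hexagon\<close>

definition above :: "real ^ 'v \<Rightarrow> 'v \<Rightarrow> 'v \<Rightarrow> 'v \<Rightarrow> real ^ 'v \<Rightarrow> bool" where
  "above m i j k c \<longleftrightarrow> near E m c \<and> c $ i = c $ j \<and> c $ i < c $ k"

definition below :: "real ^ 'v \<Rightarrow> 'v \<Rightarrow> 'v \<Rightarrow> 'v \<Rightarrow> real ^ 'v \<Rightarrow> bool" where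
  "below m i j k c \<longleftrightarrow> near E m c \<and> c $ i = c $ j \<and> c $ k < c $ i"

text \<open>The chosen witnesses are meaningful only under \<open>on_triangle m i j k\<close>; there
  \<open>jump_eq\<close> shows that the choice does not matter.\<close>

definition jump :: "real ^ 'v \<Rightarrow> 'v \<Rightarrow> 'v \<Rightarrow> 'v \<Rightarrow> real" where
  "jump m i j k = L (SOME c. above m i j k c) - L (SOME c. below m i j k c)"

definition on_triangle :: "real ^ 'v \<Rightarrow> 'v \<Rightarrow> 'v \<Rightarrow> 'v \<Rightarrow> bool" where
  "on_triangle m i j k \<longleftrightarrow> {i, j, k} \<in> triangles E \<and> tight E m = {{i, j}, {i, k}, {j, k}}"

lemma on_triangle_perm: "on_triangle m i j k \<Longrightarrow> on_triangle m j k i" "on_triangle m i j k \<Longrightarrow> on_triangle m j i k"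
  unfolding on_triangle_def by (simp_all add: insert_commute)

lemma on_triangleD:
  assumes "on_triangle m i j k" "{x, y} \<in> E" "m $ x = m $ y"
  shows "x \<in> {i, j, k} \<and> y \<in> {i, j, k}"
proof -
  have "{x, y} \<in> tight E m" using assms by (simp add: tight_pair)
  then show ?thesis using assms(1) by (auto simp: on_triangle_def doubleton_eq_iff)
qed

lemma above_exists: "on_triangle m i j k \<Longrightarrow> \<exists>c. above m i j k c"
  and below_exists: "on_triangle m i j k \<Longrightarrow> \<exists>c. below m i j k c"
proof -
  assume t: "on_triangle m i j k"
  then have m: "m $ i = m $ j" "m $ i = m $ k" "i \<noteq> k" "j \<noteq> k"
    using tight_pair[of i j E m] tight_pair[of i k E m] by (auto simp: on_triangle_def triangles_pairs)
  obtain \<eta> where "\<eta> > 0" "near E m (m + \<eta> *\<^sub>R axis k 1)" by (rule near_pushE)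
  then have "above m i j k (m + \<eta> *\<^sub>R axis k 1)"
    using m by (simp add: above_def axis_def)
  then show "\<exists>c. above m i j k c" ..
  obtain \<eta> where "\<eta> > 0" "near E m (m + \<eta> *\<^sub>R axis k (-1))" by (rule near_pushE)
  then have "below m i j k (m + \<eta> *\<^sub>R axis k (-1))"
    using m by (simp add: below_def axis_def)
  then show "\<exists>c. below m i j k c" ..
qed

lemma tight_above:
  assumes t: "on_triangle m i j k" and c: "above m i j k c \<or> below m i j k c"
  shows "tight E c = {{i, j}}"
proof -
  have "near E m c" using c by (auto simp: above_def below_def)
  then have "tight E c \<subseteq> {{i, j}, {i, k}, {j, k}}"
    using tight_near[of m c] t by (simp add: on_triangle_def)
  moreover have "{i, k} \<notin> tight E c" "{j, k} \<notin> tight E c" "{i, j} \<in> tight E c"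
    using c t by (auto simp: tight_pair above_def below_def on_triangle_def triangles_pairs)
  ultimately show ?thesis by auto
qed

lemma jump_eq:
  assumes t: "on_triangle m i j k" and c: "above m i j k c" and c': "below m i j k c'"
  shows "jump m i j k = L c - L c'"
proof -
  have "L (SOME c. above m i j k c) = L c"
  proof (rule L_same_sides[of _ "{i, j}"])
    have s: "above m i j k (SOME c. above m i j k c)" using c by (rule someI)
    then show "tight E (SOME c. above m i j k c) = {{i, j}}" using tight_above t by blast
    show "same_sides E (SOME c. above m i j k c) c"
      using s c on_triangleD[OF t]
      by (intro same_sidesI_near[of m]) (auto simp: above_def dest!: on_triangleD[OF t])
  qed
  moreover have "L (SOME c. below m i j k c) = L c'"
  proof (rule L_same_sides[of _ "{i, j}"])
    have s: "below m i j k (SOME c. below m i j k c)" using c' by (rule someI)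
    then show "tight E (SOME c. below m i j k c) = {{i, j}}" using tight_above t by blast
    show "same_sides E (SOME c. below m i j k c) c'"
      using s c' on_triangleD[OF t]
      by (intro same_sidesI_near[of m]) (auto simp: below_def dest!: on_triangleD[OF t])
  qed
  ultimately show ?thesis by (simp add: jump_def)
qed

text \<open>The hexagon condition in terms of jumps. Together with \<open>jump_swap\<close> it makes
  the jump invariant under all permutations of the triangle.\<close>

lemma jump_rotate: "on_triangle m i j k \<Longrightarrow> jump m i j k = jump m j k i"
proof -
  assume t: "on_triangle m i j k"
  then obtain c c' d d' where *: "above m i j k c" "below m i j k c'" "above m j k i d" "below m j k i d'"
    using above_exists below_exists on_triangle_perm by meson
  have "L c - L c' = L d - L d'"
    using t * by (intro hexagon[of i j k m]) (auto simp: on_triangle_def above_def below_def)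
  then show ?thesis using jump_eq t * on_triangle_perm by metis
qed

lemma jump_swap: "jump m i j k = jump m j i k"
proof -
  have "above m i j k = above m j i k" "below m i j k = below m j i k"
    by (auto simp: above_def below_def fun_eq_iff)
  then show ?thesis by (simp add: jump_def)
qed

lemma jump_same_sides: "same_sides E m m' \<Longrightarrow> jump m i j k = jump m' i j k"
proof -
  assume "same_sides E m m'"
  then have "above m i j k = above m' i j k" "below m i j k = below m' i j k"
    by (simp_all add: above_def below_def fun_eq_iff near_same_sides)
  then show ?thesis by (simp add: jump_def)
qed

text \<open>The vertex \<open>l\<close> passes the triangle, above it in \<open>f\<close> and below
  it in \<open>g\<close>. The jump is read off on \<open>{p, q}\<close>, with \<open>r\<close> as
  the vertex that crosses this edge. As \<open>{q, l}\<close> is not an edge, \<open>l\<close>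
  passes the tied pair \<open>p\<close>, \<open>q\<close> by flipping at most \<open>{p, l}\<close>,
  and it passes \<open>r\<close> by flipping at most \<open>{r, l}\<close>.\<close>

lemma jump_crossing:
  assumes f: "on_triangle f p q r" and g: "on_triangle g p q r" and mf: "near E m f" and mg: "near E m g"
    and ties: "\<And>x y. {x, y} \<in> E \<Longrightarrow> m $ x = m $ y \<Longrightarrow> x \<in> {p, q, r, l} \<and> y \<in> {p, q, r, l}"
    and m: "m $ q = m $ p" "m $ r = m $ p" "m $ l = m $ p"
    and l: "l \<notin> {p, q, r}" and fl: "f $ p < f $ l" and gl: "g $ l < g $ p" and ql: "{q, l} \<notin> E"
  shows "jump f p q r = jump g p q r"
proof -
  have ql': "{l, q} \<notin> E" using ql by (simp add: insert_commute)
  have t: "p \<noteq> q" "p \<noteq> r" "q \<noteq> r" "{p, q} \<in> E" "{p, r} \<in> E" "{q, r} \<in> E"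
    using f by (auto simp: on_triangle_def triangles_pairs)
  have feq: "f $ q = f $ p" "f $ r = f $ p" and geq: "g $ q = g $ p" "g $ r = g $ p"
    using f g t tight_pair[of p q E f] tight_pair[of p r E f] tight_pair[of p q E g] tight_pair[of p r E g]
    by (auto simp: on_triangle_def)
  have fnear: "near E f c \<Longrightarrow> {p, l} \<in> E \<Longrightarrow> c $ p < c $ l" "near E f c \<Longrightarrow> {r, l} \<in> E \<Longrightarrow> c $ r < c $ l" for c
    using nearD[of E f c] fl feq by auto
  have gnear: "near E g c \<Longrightarrow> {p, l} \<in> E \<Longrightarrow> c $ l < c $ p" "near E g c \<Longrightarrow> {r, l} \<in> E \<Longrightarrow> c $ l < c $ r" for c
    using nearD[of E g c l p] nearD[of E g c l r] gl geq by (auto simp: insert_commute)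
  \<comment> \<open>If \<open>d\<close> separates the heights of the pair p = q, of r and of l, then
    \<open>{p, q}\<close> is the only edge left tied.\<close>
  have tight2: "tight E c = {{p, q}}"
    if c: "near E m c" "\<And>x y. m $ x = m $ y \<Longrightarrow> c $ x < c $ y \<longleftrightarrow> d x < d y"
      and d: "d p = d q" "d p \<noteq> d r" "d p \<noteq> d l" "d r \<noteq> d l" for c and d :: "'v \<Rightarrow> real"
  proof (rule tight_eqI)
    fix x y assume xy: "{x, y} \<in> E"
    show "c $ x = c $ y \<longleftrightarrow> {x, y} \<in> {{p, q}}"
    proof (cases "m $ x = m $ y")
      case True
      then have "c $ x = c $ y \<longleftrightarrow> d x = d y" using c(2)[of x y] c(2)[of y x]
        by (cases rule: linorder_cases[of "d x" "d y"]) auto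
      moreover have "d x = d y \<longleftrightarrow> {x, y} = {p, q}"
        using ties[OF xy True] d edge_neq[OF xy] l t by (auto simp: doubleton_eq_iff)
      ultimately show ?thesis by simp
    next
      case False
      then have "{x, y} \<notin> tight E c" using tight_near[OF c(1)] tight_pair[of x y E m] by blast
      then show ?thesis using False xy m by (auto simp: tight_pair doubleton_eq_iff)
    qed
  qed (use t in auto)
  obtain c c' where c: "above f p q r c" and c': "above g p q r c'" using above_exists f g by blast
  obtain b b' where b: "below f p q r b" and b': "below g p q r b'" using below_exists f g by blast
  have nc: "near E m c" "near E m c'" "near E m b" "near E m b'"
    using c c' b b' mf mg near_trans by (auto simp: above_def below_def)
  have tc: "tight E c = {{p, q}}" "tight E c' = {{p, q}}" "tight E b = {{p, q}}" "tight E b' = {{p, q}}"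
    using tight_above f g c c' b b' by blast+
  have "L c = L c'"
  proof -
    \<comment> \<open>An intermediate direction with p = q < l < r: coming from \<open>c\<close>,
      with l above r, only \<open>{r, l}\<close> can flip, and going to \<open>c'\<close>, with l
      below p, only \<open>{p, l}\<close>.\<close>
    let ?d = "axis r 2 + axis l 1 :: real ^ 'v"
    obtain \<eta> where \<eta>: "near E m (m + \<eta> *\<^sub>R ?d)"
      "\<And>x y. m $ x = m $ y \<Longrightarrow> (m + \<eta> *\<^sub>R ?d) $ x < (m + \<eta> *\<^sub>R ?d) $ y \<longleftrightarrow> ?d $ x < ?d $ y"
      by (rule near_pushE) blast
    define e where "e = m + \<eta> *\<^sub>R ?d"
    have e: "near E m e" "\<And>x y. m $ x = m $ y \<Longrightarrow> e $ x < e $ y \<longleftrightarrow> ?d $ x < ?d $ y"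
      using \<eta> by (simp_all add: e_def)
    have te: "tight E e = {{p, q}}"
      by (rule tight2[OF e]) (use l t in \<open>auto simp: axis_def\<close>)
    have "L c = L e"
    proof (rule single_flip_near[OF tc(1) te nc(1) e(1), of "{r, l}"])
      fix x y assume xy: "{x, y} \<in> E" "m $ x = m $ y" "{x, y} \<noteq> {r, l}"
      show "c $ x < c $ y \<longleftrightarrow> e $ x < e $ y"
        unfolding e(2)[OF xy(2)]
        using ties[OF xy(1,2)] xy(1,3) ql ql' l t c fnear(1)[of c] edge_neq[OF xy(1)]
        by (auto simp: above_def axis_def insert_commute)
    qed
    also have "L e = L c'"
    proof (rule single_flip_near[OF te tc(2) e(1) nc(2), of "{p, l}"])
      fix x y assume xy: "{x, y} \<in> E" "m $ x = m $ y" "{x, y} \<noteq> {p, l}"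
      show "e $ x < e $ y \<longleftrightarrow> c' $ x < c' $ y"
        unfolding e(2)[OF xy(2)]
        using ties[OF xy(1,2)] xy(1,3) ql ql' l t c' gnear(2)[of c'] edge_neq[OF xy(1)]
        by (auto simp: above_def axis_def insert_commute)
    qed
    finally show ?thesis .
  qed
  moreover have "L b = L b'"
  proof -
    \<comment> \<open>With \<open>r\<close> below the tied pair the two flips occur in the opposite
      order, through r < l < p = q.\<close>
    let ?d = "axis p 2 + axis q 2 + axis l 1 :: real ^ 'v"
    obtain \<eta> where \<eta>: "near E m (m + \<eta> *\<^sub>R ?d)"
      "\<And>x y. m $ x = m $ y \<Longrightarrow> (m + \<eta> *\<^sub>R ?d) $ x < (m + \<eta> *\<^sub>R ?d) $ y \<longleftrightarrow> ?d $ x < ?d $ y"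
      by (rule near_pushE) blast
    define e where "e = m + \<eta> *\<^sub>R ?d"
    have e: "near E m e" "\<And>x y. m $ x = m $ y \<Longrightarrow> e $ x < e $ y \<longleftrightarrow> ?d $ x < ?d $ y"
      using \<eta> by (simp_all add: e_def)
    have te: "tight E e = {{p, q}}"
      by (rule tight2[OF e]) (use l t in \<open>auto simp: axis_def\<close>)
    have "L b = L e"
    proof (rule single_flip_near[OF tc(3) te nc(3) e(1), of "{p, l}"])
      fix x y assume xy: "{x, y} \<in> E" "m $ x = m $ y" "{x, y} \<noteq> {p, l}"
      show "b $ x < b $ y \<longleftrightarrow> e $ x < e $ y"
        unfolding e(2)[OF xy(2)]
        using ties[OF xy(1,2)] xy(1,3) ql ql' l t b fnear(2)[of b] edge_neq[OF xy(1)]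
        by (auto simp: below_def axis_def insert_commute)
    qed
    also have "L e = L b'"
    proof (rule single_flip_near[OF te tc(4) e(1) nc(4), of "{r, l}"])
      fix x y assume xy: "{x, y} \<in> E" "m $ x = m $ y" "{x, y} \<noteq> {r, l}"
      show "e $ x < e $ y \<longleftrightarrow> b' $ x < b' $ y"
        unfolding e(2)[OF xy(2)]
        using ties[OF xy(1,2)] xy(1,3) ql ql' l t b' gnear(1)[of b'] edge_neq[OF xy(1)]
        by (auto simp: below_def axis_def insert_commute)
    qed
    finally show ?thesis .
  qed
  ultimately show ?thesis using jump_eq[OF f c b] jump_eq[OF g c' b'] by simp
qed

end

text \<open>The vertices of \<open>J\<close> are placed at the height of \<open>i\<close>. For
  injective \<open>f\<close> outside \<open>J\<close>, the choice \<open>J = {j}\<close> turns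
  orders of the remaining vertices into walls of \<open>{i, j}\<close>, and
  \<open>J = {j, k}\<close> into hexagon directions of \<open>{i, j, k}\<close>.\<close>

definition collapse :: "'v \<Rightarrow> 'v set \<Rightarrow> ('v \<Rightarrow> real) \<Rightarrow> real ^ 'v" where
  "collapse i J f = (\<chi> v. f (if v \<in> J then i else v))"

lemma collapse_nth: "collapse i J f $ v = f (if v \<in> J then i else v)"
  by (simp add: collapse_def)

lemma near_collapse:
  assumes "i \<notin> J" "\<forall>x\<in>- J. \<forall>y\<in>- J. h x < h y \<longrightarrow> f x < f y"
  shows "near E (collapse i J h) (collapse i J f)"
  unfolding near_def collapse_nth using assms by auto

lemma same_sides_collapse:
  assumes "i \<notin> J" "\<forall>x\<in>- J. \<forall>y\<in>- J. h x < h y \<longleftrightarrow> f x < f y"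
  shows "same_sides E (collapse i J h) (collapse i J f)"
  unfolding same_sides_def collapse_nth using assms by auto

section \<open>Constancy of the jump over a triangle, and lengths along the walls of an edge\<close>

context length_system
begin

lemma on_triangle_collapse:
  assumes t: "{i, j, k} \<in> triangles E" and f: "inj_on f (- {j, k})"
  shows "on_triangle (collapse i {j, k} f) i j k"
proof -
  have *: "i \<noteq> j" "i \<noteq> k" "j \<noteq> k" "{i, j} \<in> E" "{i, k} \<in> E" "{j, k} \<in> E"
    using t by (auto simp: triangles_pairs)
  have "tight E (collapse i {j, k} f) = {{i, j}, {i, k}, {j, k}}"
  proof (rule tight_eqI)
    fix x y assume xy: "{x, y} \<in> E"
    have "collapse i {j, k} f $ x = collapse i {j, k} f $ y \<longleftrightarrow>
        (if x \<in> {j, k} then i else x) = (if y \<in> {j, k} then i else y)"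
      unfolding collapse_nth using * by (intro inj_on_eq_iff[OF f]) auto
    also have "\<dots> \<longleftrightarrow> {x, y} \<in> {{i, j}, {i, k}, {j, k}}"
      using * edge_neq[OF xy] by (auto simp: doubleton_eq_iff)
    finally show "collapse i {j, k} f $ x = collapse i {j, k} f $ y \<longleftrightarrow> {x, y} \<in> {{i, j}, {i, k}, {j, k}}" .
  qed (use * in auto)
  then show ?thesis using t by (simp add: on_triangle_def)
qed

text \<open>Ties of \<open>m\<close> between non-adjacent vertices do not affect its cell, so they
  may be broken until an injective order is reached.\<close>

lemma same_sides_collapse_triangle:
  assumes "on_triangle m i j k"
  obtains f where "inj_on f (- {j, k})" "same_sides E m (collapse i {j, k} f)"
proof -
  obtain f :: "'v \<Rightarrow> real" where f: "inj_on f (- {j, k})" "\<And>x y. x \<in> - {j, k} \<Longrightarrow> y \<in> - {j, k} \<Longrightarrow> m $ x < m $ y \<Longrightarrow> f x < f y"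
    using injective_perturbation[of "- {j, k}" "\<lambda>v. m $ v"] by auto
  have t: "i \<noteq> j" "i \<noteq> k" "{i, j, k} \<in> triangles E" "m $ j = m $ i" "m $ k = m $ i"
    using assms tight_pair[of i j E m] tight_pair[of i k E m] by (auto simp: on_triangle_def triangles_pairs)
  have "near E m (collapse i {j, k} f)"
    unfolding near_def collapse_nth using f(2) t by auto
  then have "same_sides E m (collapse i {j, k} f)"
  proof (intro same_sidesI_near[of m])
    fix x y assume "{x, y} \<in> E" "m $ x = m $ y"
    then show "m $ x < m $ y \<longleftrightarrow> collapse i {j, k} f $ x < collapse i {j, k} f $ y"
      using on_triangleD[OF assms] by (auto simp: collapse_nth)
  qed (auto simp: near_refl)
  then show ?thesis using that f by blast
qed

lemma nonadjacent_triangle_vertex: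
  assumes t: "{i, j, k} \<in> triangles E" and l: "l \<notin> {i, j, k}"
  obtains q where "q \<in> {i, j, k}" "{q, l} \<notin> E"
proof -
  have "card {i, j, k, l} = 4" using assms by (auto simp: triangles_pairs)
  then have "\<not> clique E {i, j, k, l}" using K4_free by blast
  then have "\<exists>q\<in>{i, j, k}. {q, l} \<notin> E"
    using t by (auto simp: clique_def triangles_pairs insert_commute)
  then show ?thesis using that by blast
qed

text \<open>Two orders of the vertices outside \<open>{j, k}\<close> are joined by swaps. A swap
  with \<open>i\<close> moves a vertex across the contracted triangle and is treated in
  \<open>cross\<close>; any other swap flips at most one edge and so preserves both lengths whose
  difference is the jump.\<close>

lemma jump_const:
  assumes m: "on_triangle m i j k" and m': "on_triangle m' i j k"
  shows "jump m i j k = jump m' i j k"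
proof -
  let ?W = "- {j, k}" and ?v = "collapse i {j, k}"
  have t: "{i, j, k} \<in> triangles E" using m by (simp add: on_triangle_def)
  then have ij: "i \<noteq> j" "i \<noteq> k" by (auto simp: triangles_pairs)
  have cross: "jump (?v f) i j k = jump (?v g) i j k"
    if fg: "inj_on f ?W" "inj_on g ?W" and l: "l \<in> ?W" "l \<noteq> i" and h: "h l = h i"
      and h1: "\<forall>x\<in>?W. \<forall>y\<in>?W. h x = h y \<longrightarrow> x = y \<or> {x, y} = {i, l}"
      and h2: "\<forall>x\<in>?W. \<forall>y\<in>?W. h x < h y \<longrightarrow> f x < f y \<and> g x < g y"
      and lt: "f i < f l" "g l < g i" for f g h :: "'v \<Rightarrow> real" and l
  proof -
    have tf: "on_triangle (?v f) i j k" "on_triangle (?v g) i j k"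
      using on_triangle_collapse t fg by auto
    have n: "near E (?v h) (?v f)" "near E (?v h) (?v g)"
      using h2 ij by (auto intro!: near_collapse)
    have ties: "x \<in> {i, j, k, l} \<and> y \<in> {i, j, k, l}" if xy: "{x, y} \<in> E" "?v h $ x = ?v h $ y" for x y
    proof -
      let ?x = "if x \<in> {j, k} then i else x" and ?y = "if y \<in> {j, k} then i else y"
      have "h ?x = h ?y" using xy by (simp add: collapse_nth)
      moreover have "?x \<in> ?W" "?y \<in> ?W" using ij by auto
      ultimately have "?x = ?y \<or> {?x, ?y} = {i, l}" using h1 by blast
      then show ?thesis using edge_neq[OF xy(1)] by (auto simp: doubleton_eq_iff split: if_splits)
    qed
    \<comment> \<open>Stated for any labelling, since the vertex not adjacent to \<open>l\<close>
      must take the second place; permutation invariance of the jump leads back to \<open>i\<close>,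
      \<open>j\<close>, \<open>k\<close>.\<close>
    have *: "jump (?v f) p q r = jump (?v g) p q r"
      if "on_triangle (?v f) p q r" "on_triangle (?v g) p q r" "{p, q, r} = {i, j, k}" "{q, l} \<notin> E" for p q r
    proof (rule jump_crossing[where m = "?v h" and l = l])
      have mem: "p \<in> {i, j, k}" "q \<in> {i, j, k}" "r \<in> {i, j, k}" using that(3) by auto
      show "x \<in> {p, q, r, l} \<and> y \<in> {p, q, r, l}" if "{x, y} \<in> E" "?v h $ x = ?v h $ y" for x y
        using ties[OF that] \<open>{p, q, r} = {i, j, k}\<close> by blast
      show "?v h $ q = ?v h $ p" "?v h $ r = ?v h $ p" "?v h $ l = ?v h $ p" "?v f $ p < ?v f $ l" "?v g $ l < ?v g $ p"
        using mem h l lt by (auto simp: collapse_nth)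
      show "l \<notin> {p, q, r}" using that(3) l by auto
    qed (use that n in auto)
    obtain q where q: "q \<in> {i, j, k}" "{q, l} \<notin> E"
      using nonadjacent_triangle_vertex[OF t] l by blast
    then consider "q = i" | "q = j" | "q = k" by blast
    then show ?thesis
    proof cases
      case 1
      have "jump (?v f) j i k = jump (?v g) j i k"
        by (rule *) (use 1 q on_triangle_perm[OF tf(1)] on_triangle_perm[OF tf(2)] in auto)
      then show ?thesis by (simp only: jump_swap[of _ j i])
    next
      case 2
      show ?thesis by (rule *) (use 2 q tf in auto)
    next
      case 3
      have "jump (?v f) j k i = jump (?v g) j k i"
        by (rule *) (use 3 q on_triangle_perm[OF tf(1)] on_triangle_perm[OF tf(2)] in auto)
      then show ?thesis by (simp only: jump_rotate[OF tf(1)] jump_rotate[OF tf(2)])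
    qed
  qed
  have const: "jump (?v f) i j k = jump (?v g) i j k" if "inj_on f ?W" "inj_on g ?W" for f g
  proof (rule swaps_connect[of ?W "\<lambda>f. jump (?v f) i j k"])
    fix f g :: "'v \<Rightarrow> real" assume "inj_on f ?W" "inj_on g ?W" "\<forall>x\<in>?W. \<forall>y\<in>?W. f x < f y \<longleftrightarrow> g x < g y"
    then show "jump (?v f) i j k = jump (?v g) i j k"
      using ij by (intro jump_same_sides same_sides_collapse) auto
  next
    fix f g h :: "'v \<Rightarrow> real" and u v
    assume fg: "inj_on f ?W" "inj_on g ?W" and uv: "u \<in> ?W" "v \<in> ?W" "u \<noteq> v" "h u = h v"
      and h1: "\<forall>x\<in>?W. \<forall>y\<in>?W. h x = h y \<longrightarrow> x = y \<or> {x, y} = {u, v}"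
      and h2: "\<forall>x\<in>?W. \<forall>y\<in>?W. h x < h y \<longrightarrow> f x < f y \<and> g x < g y"
      and lt: "g u < g v" "f v < f u"
    consider "u = i" | "v = i" | "u \<noteq> i" "v \<noteq> i" by blast
    then show "jump (?v f) i j k = jump (?v g) i j k"
    proof cases
      case 1
      have "jump (?v g) i j k = jump (?v f) i j k"
        by (rule cross[of g f v h]) (use 1 fg uv h1 h2 lt in auto)
      then show ?thesis by simp
    next
      case 2
      show ?thesis
        by (rule cross[of f g u h]) (use 2 fg uv h1 h2 lt in \<open>auto simp: insert_commute\<close>)
    next
      case 3
      have tf: "on_triangle (?v f) i j k" "on_triangle (?v g) i j k"
        using on_triangle_collapse t fg by auto
      have n: "near E (?v h) (?v f)" "near E (?v h) (?v g)"
        using h2 ij by (auto intro!: near_collapse)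
      have ties: "x \<in> {i, j, k} \<and> y \<in> {i, j, k}"
        if xy: "{x, y} \<in> E" "?v h $ x = ?v h $ y" "{x, y} \<noteq> {u, v}" for x y
      proof -
        let ?x = "if x \<in> {j, k} then i else x" and ?y = "if y \<in> {j, k} then i else y"
        have "h ?x = h ?y" using xy by (simp add: collapse_nth)
        moreover have "?x \<in> ?W" "?y \<in> ?W" using ij by auto
        ultimately have "?x = ?y \<or> {?x, ?y} = {u, v}" using h1 by blast
        then show ?thesis using edge_neq[OF xy(1)] xy(3) 3 by (auto simp: doubleton_eq_iff split: if_splits)
      qed
      obtain c c' b b' where ab: "above (?v f) i j k c" "above (?v g) i j k c'"
        "below (?v f) i j k b" "below (?v g) i j k b'" using above_exists[OF tf(1)] above_exists[OF tf(2)] below_exists[OF tf(1)] below_exists[OF tf(2)] by metis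
      have "L c = L c'"
      proof (rule single_flip_near[where m = "?v h" and b = "{u, v}"])
        show "tight E c = {{i, j}}" "tight E c' = {{i, j}}" using tight_above tf ab by blast+
        show "near E (?v h) c" "near E (?v h) c'" using n ab near_trans by (auto simp: above_def)
        show "c $ x < c $ y \<longleftrightarrow> c' $ x < c' $ y"
          if xy: "{x, y} \<in> E" "?v h $ x = ?v h $ y" "{x, y} \<noteq> {u, v}" for x y
          using ties[OF that] ab by (auto simp: above_def)
      qed
      moreover have "L b = L b'"
      proof (rule single_flip_near[where m = "?v h" and b = "{u, v}"])
        show "tight E b = {{i, j}}" "tight E b' = {{i, j}}" using tight_above tf ab by blast+
        show "near E (?v h) b" "near E (?v h) b'" using n ab near_trans by (auto simp: below_def)
        show "b $ x < b $ y \<longleftrightarrow> b' $ x < b' $ y"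
          if xy: "{x, y} \<in> E" "?v h $ x = ?v h $ y" "{x, y} \<noteq> {u, v}" for x y
          using ties[OF that] ab by (auto simp: below_def)
      qed
      ultimately show ?thesis using jump_eq tf ab by metis
    qed
  qed (simp_all add: that)
  obtain f where f: "inj_on f ?W" "same_sides E m (?v f)"
    using same_sides_collapse_triangle[OF m] by blast
  obtain g where g: "inj_on g ?W" "same_sides E m' (?v g)"
    using same_sides_collapse_triangle[OF m'] by blast
  show ?thesis using const[OF f(1) g(1)] jump_same_sides[OF f(2)] jump_same_sides[OF g(2)] by simp
qed

definition triangle_jump :: "'v set \<Rightarrow> real" where
  "triangle_jump t = (SOME d. \<exists>m i j k. t = {i, j, k} \<and> on_triangle m i j k \<and> d = jump m i j k)"

lemma jump_eq_triangle_jump: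
  assumes m: "on_triangle m i j k"
  shows "jump m i j k = triangle_jump {i, j, k}"
proof -
  have "\<exists>d m' i' j' k'. {i, j, k} = {i', j', k'} \<and> on_triangle m' i' j' k' \<and> d = jump m' i' j' k'"
    using m by blast
  from someI_ex[OF this] obtain m' i' j' k' where *: "{i, j, k} = {i', j', k'}" "on_triangle m' i' j' k'"
    "triangle_jump {i, j, k} = jump m' i' j' k'"
    unfolding triangle_jump_def by blast
  have d: "i \<noteq> j" "i \<noteq> k" "j \<noteq> k" "i' \<noteq> j'" "i' \<noteq> k'" "j' \<noteq> k'"
    using m *(2) by (auto simp: on_triangle_def triangles_pairs)
  have p: "on_triangle m j k i" "on_triangle m k i j" "on_triangle m j i k" "on_triangle m i k j" "on_triangle m k j i"
    using m on_triangle_perm by blast+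
  have e: "jump m j k i = jump m i j k" "jump m k i j = jump m i j k" "jump m j i k = jump m i j k"
    "jump m i k j = jump m i j k" "jump m k j i = jump m i j k"
    using jump_rotate[OF m] jump_rotate[OF p(1)] jump_swap[of m i j k] jump_rotate[OF p(3)] jump_rotate[OF p(4)]
    by simp_all
  consider "i' = i" "j' = j" "k' = k" | "i' = j" "j' = k" "k' = i" | "i' = k" "j' = i" "k' = j"
    | "i' = j" "j' = i" "k' = k" | "i' = i" "j' = k" "k' = j" | "i' = k" "j' = j" "k' = i"
    using *(1) d by (smt (verit) insertE insertI1 insert_commute singletonD)
  then have "jump m i j k = jump m' i' j' k'"
    using e m p *(2) jump_const[of m i' j' k' m'] by cases auto
  then show ?thesis using * by simp
qed

lemma tight_collapse:
  assumes e: "{i, j} \<in> E" and f: "inj_on f (- {j})"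
  shows "tight E (collapse i {j} f) = {{i, j}}"
proof (rule tight_eqI)
  fix x y assume xy: "{x, y} \<in> E"
  have "i \<noteq> j" using e edge_neq by blast
  have "collapse i {j} f $ x = collapse i {j} f $ y \<longleftrightarrow>
      (if x \<in> {j} then i else x) = (if y \<in> {j} then i else y)"
    unfolding collapse_nth using \<open>i \<noteq> j\<close> by (intro inj_on_eq_iff[OF f]) auto
  also have "\<dots> \<longleftrightarrow> {x, y} \<in> {{i, j}}"
    using \<open>i \<noteq> j\<close> edge_neq[OF xy] by (auto simp: doubleton_eq_iff)
  finally show "collapse i {j} f $ x = collapse i {j} f $ y \<longleftrightarrow> {x, y} \<in> {{i, j}}" .
qed (use e in auto)

lemma same_sides_collapse_edge:
  assumes c: "tight E c = {{i, j}}"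
  obtains f where "inj_on f (- {j})" "same_sides E c (collapse i {j} f)"
    "\<And>k. k \<noteq> j \<Longrightarrow> c $ i \<noteq> c $ k \<Longrightarrow> c $ i < c $ k \<longleftrightarrow> f i < f k"
proof -
  obtain f :: "'v \<Rightarrow> real" where f: "inj_on f (- {j})" "\<And>x y. x \<in> - {j} \<Longrightarrow> y \<in> - {j} \<Longrightarrow> c $ x < c $ y \<Longrightarrow> f x < f y"
    using injective_perturbation[of "- {j}" "\<lambda>v. c $ v"] by auto
  have e: "{i, j} \<in> E" "c $ j = c $ i"
    using c tight_pair[of i j E c] by auto
  then have ij: "i \<noteq> j" using edge_neq by blast
  have "near E c (collapse i {j} f)"
    unfolding near_def collapse_nth using f(2) e ij by auto
  then have "same_sides E c (collapse i {j} f)"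
  proof (intro same_sidesI_near[of c])
    fix x y assume "{x, y} \<in> E" "c $ x = c $ y"
    then have "{x, y} = {i, j}" using c tight_pair[of x y E c] by auto
    then show "c $ x < c $ y \<longleftrightarrow> collapse i {j} f $ x < collapse i {j} f $ y"
      using e by (auto simp: collapse_nth doubleton_eq_iff)
  qed (auto simp: near_refl)
  moreover have "c $ i < c $ k \<longleftrightarrow> f i < f k" if "k \<noteq> j" "c $ i \<noteq> c $ k" for k
    using f(2)[of i k] f(2)[of k i] that ij by (cases rule: linorder_cases[of "c $ i" "c $ k"]) auto
  ultimately show ?thesis using that f by blast
qed

text \<open>The sum is built to have the same jumps as \<open>L\<close>. Their difference
  \<open>?\<Phi>\<close>, as a function of the order, is changed by no swap and is the constant
  \<open>C\<close>.\<close>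

lemma wall_formula:
  assumes e: "{i, j} \<in> E"
  shows "\<exists>C. \<forall>c. tight E c = {{i, j}} \<longrightarrow>
    L c = C + (\<Sum>k | {i, j, k} \<in> triangles E \<and> c $ i < c $ k. triangle_jump {i, j, k})"
proof -
  let ?W = "- {j}" and ?v = "collapse i {j}"
  let ?S = "\<lambda>f. {k. {i, j, k} \<in> triangles E \<and> f i < f k}"
  let ?\<Phi> = "\<lambda>f. L (?v f) - (\<Sum>k \<in> ?S f. triangle_jump {i, j, k})"
  have ij: "i \<noteq> j" using e edge_neq by blast
  have cross: "?\<Phi> f = ?\<Phi> g"
    if fg: "inj_on f ?W" "inj_on g ?W" and l: "l \<in> ?W" "l \<noteq> i" and h: "h l = h i"
      and h1: "\<forall>x\<in>?W. \<forall>y\<in>?W. h x = h y \<longrightarrow> x = y \<or> {x, y} = {i, l}"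
      and h2: "\<forall>x\<in>?W. \<forall>y\<in>?W. h x < h y \<longrightarrow> f x < f y \<and> g x < g y"
      and lt: "f i < f l" "g l < g i" for f g h :: "'v \<Rightarrow> real" and l
  proof -
    have tf: "tight E (?v f) = {{i, j}}" "tight E (?v g) = {{i, j}}"
      using tight_collapse e fg by auto
    have n: "near E (?v h) (?v f)" "near E (?v h) (?v g)"
      using h2 ij by (auto intro!: near_collapse)
    have ties: "?v h $ x = ?v h $ y \<longleftrightarrow> x \<in> {i, j, l} \<and> y \<in> {i, j, l}" if xy: "{x, y} \<in> E" for x y
    proof
      assume eq: "?v h $ x = ?v h $ y"
      let ?x = "if x \<in> {j} then i else x" and ?y = "if y \<in> {j} then i else y"
      have "h ?x = h ?y" using eq by (simp add: collapse_nth)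
      moreover have "?x \<in> ?W" "?y \<in> ?W" using ij by auto
      ultimately have "?x = ?y \<or> {?x, ?y} = {i, l}" using h1 by blast
      then show "x \<in> {i, j, l} \<and> y \<in> {i, j, l}"
        using edge_neq[OF xy] by (auto simp: doubleton_eq_iff split: if_splits)
    qed (use h l in \<open>auto simp: collapse_nth\<close>)
    \<comment> \<open>As \<open>h\<close> ties \<open>i\<close> with \<open>l\<close> only, every
      other triangle vertex stays on its side of \<open>i\<close>.\<close>
    have other: "f i < f k \<longleftrightarrow> g i < g k" if "k \<noteq> l" "{i, j, k} \<in> triangles E" for k
    proof -
      have k: "k \<in> ?W" "i \<in> ?W" "k \<noteq> i" using that ij by (auto simp: triangles_pairs)
      then have "h i \<noteq> h k" using h1 that by (metis doubleton_eq_iff)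
      then show ?thesis using h2 k by (metis less_asym linorder_less_linear)
    qed
    show ?thesis
    proof (cases "{i, j, l} \<in> triangles E")
      case True
      have "tight E (?v h) = {{i, j}, {i, l}, {j, l}}"
      proof (rule tight_eqI)
        fix x y assume xy: "{x, y} \<in> E"
        show "?v h $ x = ?v h $ y \<longleftrightarrow> {x, y} \<in> {{i, j}, {i, l}, {j, l}}"
          unfolding ties[OF xy] using edge_neq[OF xy] by (auto simp: doubleton_eq_iff)
      qed (use True in \<open>auto simp: triangles_pairs\<close>)
      then have t: "on_triangle (?v h) i j l" using True by (simp add: on_triangle_def)
      have "above (?v h) i j l (?v f)" "below (?v h) i j l (?v g)"
        using n ij l lt by (auto simp: above_def below_def collapse_nth)
      then have "L (?v f) - L (?v g) = triangle_jump {i, j, l}"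
        using jump_eq[OF t] jump_eq_triangle_jump[OF t] by simp
      moreover have "f i < f k \<longleftrightarrow> k = l \<or> g i < g k" if "{i, j, k} \<in> triangles E" for k
        using other[of k] that lt by (cases "k = l") auto
      then have "?S f = insert l (?S g)" "l \<notin> ?S g" using True lt by auto
      ultimately show ?thesis by simp
    next
      case False
      then have "\<not> ({i, l} \<in> E \<and> {j, l} \<in> E)" using e ij l by (auto simp: triangles_pairs)
      \<comment> \<open>At most one of \<open>{i, l}\<close> and \<open>{j, l}\<close> is an edge;
        \<open>b\<close> is that one, so the passage of \<open>l\<close> is a single flip.\<close>
      then obtain b where b: "\<And>x y. {x, y} \<in> E \<Longrightarrow> {x, y} \<noteq> b \<Longrightarrow> {x, y} \<noteq> {i, l} \<and> {x, y} \<noteq> {j, l}"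
        by metis
      have "L (?v f) = L (?v g)"
      proof (rule single_flip_near[OF tf n])
        fix x y assume xy: "{x, y} \<in> E" "?v h $ x = ?v h $ y" "{x, y} \<noteq> b"
        have "x \<in> {i, j, l}" "y \<in> {i, j, l}" using ties[OF xy(1)] xy(2) by auto
        then have "{x, y} = {i, j}" using b[OF xy(1,3)] edge_neq[OF xy(1)] by (auto simp: doubleton_eq_iff)
        then show "?v f $ x < ?v f $ y \<longleftrightarrow> ?v g $ x < ?v g $ y" by (auto simp: collapse_nth doubleton_eq_iff)
      qed
      moreover have "f i < f k \<longleftrightarrow> g i < g k" if "{i, j, k} \<in> triangles E" for k
        using other[of k] that False by (cases "k = l") auto
      then have "?S f = ?S g" by auto
      ultimately show ?thesis by simp
    qed
  qed
  have const: "?\<Phi> f = ?\<Phi> g" if "inj_on f ?W" "inj_on g ?W" for f g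
  proof (rule swaps_connect[of ?W ?\<Phi>])
    fix f g :: "'v \<Rightarrow> real" assume fg: "inj_on f ?W" "inj_on g ?W" and eq: "\<forall>x\<in>?W. \<forall>y\<in>?W. f x < f y \<longleftrightarrow> g x < g y"
    then have "L (?v f) = L (?v g)"
      using ij by (intro L_same_sides[OF tight_collapse[OF e]] same_sides_collapse) auto
    moreover have "?S f = ?S g" using eq ij by (auto simp: triangles_pairs)
    ultimately show "?\<Phi> f = ?\<Phi> g" by simp
  next
    fix f g h :: "'v \<Rightarrow> real" and u v
    assume fg: "inj_on f ?W" "inj_on g ?W" and uv: "u \<in> ?W" "v \<in> ?W" "u \<noteq> v" "h u = h v"
      and h1: "\<forall>x\<in>?W. \<forall>y\<in>?W. h x = h y \<longrightarrow> x = y \<or> {x, y} = {u, v}"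
      and h2: "\<forall>x\<in>?W. \<forall>y\<in>?W. h x < h y \<longrightarrow> f x < f y \<and> g x < g y"
      and lt: "g u < g v" "f v < f u"
    consider "u = i" | "v = i" | "u \<noteq> i" "v \<noteq> i" by blast
    then show "?\<Phi> f = ?\<Phi> g"
    proof cases
      case 1
      have "?\<Phi> g = ?\<Phi> f"
        by (rule cross[of g f v h]) (use 1 fg uv h1 h2 lt in auto)
      then show ?thesis by simp
    next
      case 2
      show ?thesis
        by (rule cross[of f g u h]) (use 2 fg uv h1 h2 lt in \<open>auto simp: insert_commute\<close>)
    next
      case 3
      have tf: "tight E (?v f) = {{i, j}}" "tight E (?v g) = {{i, j}}"
        using tight_collapse e fg by auto
      have n: "near E (?v h) (?v f)" "near E (?v h) (?v g)"
        using h2 ij by (auto intro!: near_collapse)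
      have "L (?v f) = L (?v g)"
      proof (rule single_flip_near[OF tf n, of "{u, v}"])
        fix x y assume xy: "{x, y} \<in> E" "?v h $ x = ?v h $ y" "{x, y} \<noteq> {u, v}"
        let ?x = "if x \<in> {j} then i else x" and ?y = "if y \<in> {j} then i else y"
        have "h ?x = h ?y" using xy by (simp add: collapse_nth)
        moreover have "?x \<in> ?W" "?y \<in> ?W" using ij by auto
        ultimately have "?x = ?y \<or> {?x, ?y} = {u, v}" using h1 by blast
        then have "x \<in> {i, j} \<and> y \<in> {i, j}"
          using edge_neq[OF xy(1)] xy(3) 3 by (auto simp: doubleton_eq_iff split: if_splits)
        then show "?v f $ x < ?v f $ y \<longleftrightarrow> ?v g $ x < ?v g $ y" by (auto simp: collapse_nth)
      qed
      moreover have "?S f = ?S g"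
      proof -
        have "f i < f k \<longleftrightarrow> g i < g k" if "{i, j, k} \<in> triangles E" for k
        proof -
          have k: "k \<in> ?W" "i \<in> ?W" "k \<noteq> i" using that ij by (auto simp: triangles_pairs)
          then have "h i \<noteq> h k" using h1 3 by (metis doubleton_eq_iff)
          then show ?thesis using h2 k by (metis less_asym linorder_less_linear)
        qed
        then show ?thesis by auto
      qed
      ultimately show ?thesis by simp
    qed
  qed (simp_all add: that)
  obtain f0 :: "'v \<Rightarrow> real" where f0: "inj_on f0 ?W"
    using injective_perturbation[of ?W "\<lambda>_. 0"] by auto
  have "L c = ?\<Phi> f0 + (\<Sum>k \<in> ?S (\<lambda>x. c $ x). triangle_jump {i, j, k})" if c: "tight E c = {{i, j}}" for c
  proof -
    obtain f where f: "inj_on f ?W" "same_sides E c (?v f)"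
      "\<And>k. k \<noteq> j \<Longrightarrow> c $ i \<noteq> c $ k \<Longrightarrow> c $ i < c $ k \<longleftrightarrow> f i < f k"
      using same_sides_collapse_edge[OF c] by blast
    \<comment> \<open>A triangle vertex is adjacent to \<open>i\<close>, hence not tied with it on
      this wall, and its side survives the breaking of ties.\<close>
    have "c $ i < c $ k \<longleftrightarrow> f i < f k" if "{i, j, k} \<in> triangles E" for k
    proof -
      have k: "k \<noteq> j" "{i, k} \<in> E" "{i, k} \<noteq> {i, j}" using that by (auto simp: triangles_pairs doubleton_eq_iff)
      then have "c $ i \<noteq> c $ k" using c tight_pair[of i k E c] by auto
      then show ?thesis using f k by blast
    qed
    then have "?S (\<lambda>x. c $ x) = ?S f" by auto
    moreover have "L c = L (?v f)" using L_same_sides c f by blast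
    ultimately show ?thesis using const[OF f0 f(1)] by simp
  qed
  then show ?thesis by (intro exI[of _ "?\<Phi> f0"]) simp
qed

end

section \<open>From length systems to weights\<close>

context simple_graph
begin

text \<open>The distinct offsets \<open>n v\<close> prevent unwanted ties. Both the nonnegativity
  and the uniqueness of the weights rest on this free choice of positions.\<close>

lemma wall_exists:
  assumes e: "{i, j} \<in> E"
  obtains c where "tight E c = {{i, j}}" "\<And>k. k \<noteq> i \<Longrightarrow> k \<noteq> j \<Longrightarrow> c $ i < c $ k \<longleftrightarrow> k \<in> S"
proof -
  obtain n :: "'v \<Rightarrow> nat" where n: "inj n"
    using finite_imp_inj_to_nat_seg[of "UNIV :: 'v set"] by auto
  define c :: "real ^ 'v" where
    "c = (\<chi> v. if v \<in> {i, j} then 0 else if v \<in> S then 1 + real (n v) else - 1 - real (n v))"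
  have c: "c $ v = (if v \<in> {i, j} then 0 else if v \<in> S then 1 + real (n v) else - 1 - real (n v))" for v
    by (simp add: c_def)
  have "tight E c = {{i, j}}"
  proof (rule tight_eqI)
    fix x y assume xy: "{x, y} \<in> E"
    show "c $ x = c $ y \<longleftrightarrow> {x, y} \<in> {{i, j}}"
      using edge_neq[OF xy] n edge_neq[OF e] unfolding c
      by (auto simp: doubleton_eq_iff inj_eq split: if_splits)
  qed (use e in auto)
  moreover have "c $ i < c $ k \<longleftrightarrow> k \<in> S" if "k \<noteq> i" "k \<noteq> j" for k
    using that unfolding c by auto
  ultimately show ?thesis using that by blast
qed

text \<open>On a wall of \<open>{i, j}\<close> the face of \<Delta>_t is that edge if
  \<open>k\<close> lies below it and a vertex if \<open>k\<close> lies above; for -\<Delta>_t it is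
  the other way round. Hence the positive and the negative part of w_t. The factor
  \<open>sqrt 2\<close> is the length of e_i - e_j.\<close>

definition edge_length :: "('v set \<Rightarrow> real) \<Rightarrow> 'v \<Rightarrow> 'v \<Rightarrow> real ^ 'v \<Rightarrow> real" where
  "edge_length w i j c = sqrt 2 * (w {i, j} + (\<Sum>k | {i, j, k} \<in> triangles E.
     if c $ i < c $ k then max 0 (- w {i, j, k}) else max 0 (w {i, j, k})))"

end

theorem (in length_system) length_system_eq_edge_length:
  obtains w where "\<forall>e\<in>E. 0 \<le> w e" "\<And>i j c. tight E c = {{i, j}} \<Longrightarrow> L c = edge_length w i j c"
proof -
  let ?D = triangle_jump
  let ?K = "\<lambda>i j. {k. {i, j, k} \<in> triangles E}"
  have "\<exists>C. \<forall>c. tight E c = {a} \<longrightarrow> (\<forall>i j. a = {i, j} \<longrightarrow>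
    L c = C + (\<Sum>k | {i, j, k} \<in> triangles E \<and> c $ i < c $ k. ?D {i, j, k}))" for a
  proof (cases "a \<in> E")
    case True
    then obtain i j where a: "a = {i, j}" by (elim edgeE)
    obtain C where C: "\<And>c. tight E c = {{i, j}} \<Longrightarrow>
        L c = C + (\<Sum>k | {i, j, k} \<in> triangles E \<and> c $ i < c $ k. ?D {i, j, k})"
      using wall_formula True a by blast
    \<comment> \<open>The endpoints are tied on the wall, so the formula is symmetric in them and
      \<open>C\<close> can be indexed by the unordered edge.\<close>
    have "L c = C + (\<Sum>k | {i', j', k} \<in> triangles E \<and> c $ i' < c $ k. ?D {i', j', k})"
      if c: "tight E c = {a}" and ij: "a = {i', j'}" for c i' j'
    proof -
      have "c $ i = c $ j" using c a tight_pair[of i j E c] by auto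
      moreover have "i' = i \<and> j' = j \<or> i' = j \<and> j' = i" using a ij by (auto simp: doubleton_eq_iff)
      ultimately show ?thesis using C[of c] c a by (auto simp: insert_commute)
    qed
    then show ?thesis by blast
  next
    case False
    then have "tight E c \<noteq> {a}" for c using tight_subset[of E c] by blast
    then show ?thesis by simp
  qed
  then have "\<forall>a. \<exists>C. \<forall>c. tight E c = {a} \<longrightarrow> (\<forall>i j. a = {i, j} \<longrightarrow>
    L c = C + (\<Sum>k | {i, j, k} \<in> triangles E \<and> c $ i < c $ k. ?D {i, j, k}))" ..
  from choice[OF this] obtain C where C: "\<And>a c i j. tight E c = {a} \<Longrightarrow> a = {i, j} \<Longrightarrow>
    L c = C a + (\<Sum>k | {i, j, k} \<in> triangles E \<and> c $ i < c $ k. ?D {i, j, k})" by auto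
  \<comment> \<open>Raising \<open>k\<close> above the edge changes \<open>edge_length\<close> by -
    sqrt 2 * w_t, which has to be the jump. The constant \<open>C\<close> is the length with all
    \<open>k\<close> below and thus contains the positive parts of the triangle weights; as sqrt 2 *
    max 0 w_t = - min 0 D_t, removing them adds the minima.\<close>
  define w where "w s = (if card s = 3 then - ?D s / sqrt 2 else
      (C s + (\<Sum>k | insert k s \<in> triangles E. min 0 (?D (insert k s)))) / sqrt 2)" for s
  have wE: "sqrt 2 * w {i, j} = C {i, j} + (\<Sum>k\<in>?K i j. min 0 (?D {i, j, k}))" if "{i, j} \<in> E" for i j
  proof -
    have "card {i, j} = 2" using that simple by blast
    moreover have "insert k {i, j} = {i, j, k}" for k by auto
    ultimately show ?thesis by (simp add: w_def)
  qed
  have wT: "?D {i, j, k} = - sqrt 2 * w {i, j, k}" if "{i, j, k} \<in> triangles E" for i j k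
    using that by (simp add: w_def triangles_def)
  have eq: "L c = edge_length w i j c" if c: "tight E c = {{i, j}}" for i j c
  proof -
    have e: "{i, j} \<in> E" using c tight_subset[of E c] by auto
    have "L c = C {i, j} + (\<Sum>k | {i, j, k} \<in> triangles E \<and> c $ i < c $ k. ?D {i, j, k})"
      using C c by blast
    also have "(\<Sum>k | {i, j, k} \<in> triangles E \<and> c $ i < c $ k. ?D {i, j, k}) =
        (\<Sum>k\<in>?K i j. if c $ i < c $ k then ?D {i, j, k} else 0)"
      by (rule sum.mono_neutral_cong_left) auto
    also have "C {i, j} = sqrt 2 * w {i, j} - (\<Sum>k\<in>?K i j. min 0 (?D {i, j, k}))"
      using wE[OF e] by simp
    also have "sqrt 2 * w {i, j} - (\<Sum>k\<in>?K i j. min 0 (?D {i, j, k})) + (\<Sum>k\<in>?K i j. if c $ i < c $ k then ?D {i, j, k} else 0)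
       = sqrt 2 * w {i, j} + (\<Sum>k\<in>?K i j. (if c $ i < c $ k then ?D {i, j, k} else 0) - min 0 (?D {i, j, k}))"
      by (simp add: sum_subtractf)
    also have "(\<Sum>k\<in>?K i j. (if c $ i < c $ k then ?D {i, j, k} else 0) - min 0 (?D {i, j, k})) =
       (\<Sum>k\<in>?K i j. sqrt 2 * (if c $ i < c $ k then max 0 (- w {i, j, k}) else max 0 (w {i, j, k})))"
    proof (rule sum.cong)
      fix k assume "k \<in> ?K i j"
      then show "(if c $ i < c $ k then ?D {i, j, k} else 0) - min 0 (?D {i, j, k}) =
        sqrt 2 * (if c $ i < c $ k then max 0 (- w {i, j, k}) else max 0 (w {i, j, k}))"
        using wT[of i j k] by (auto simp: max_def min_def mult_le_0_iff zero_le_mult_iff)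
    qed simp
    finally show ?thesis by (simp add: edge_length_def distrib_left sum_distrib_left)
  qed
  moreover have "0 \<le> w e" if e: "e \<in> E" for e
  proof -
    obtain i j where ij: "e = {i, j}" "i \<noteq> j" using e by (elim edgeE)
    \<comment> \<open>Triangles of positive weight get their vertex above the edge, all others
      below: every triangle term vanishes and w_e alone remains.\<close>
    obtain c where c: "tight E c = {{i, j}}" "\<And>k. k \<noteq> i \<Longrightarrow> k \<noteq> j \<Longrightarrow> c $ i < c $ k \<longleftrightarrow> k \<in> {k. 0 < w {i, j, k}}"
      using wall_exists e ij by metis
    have "(\<Sum>k\<in>?K i j. if c $ i < c $ k then max 0 (- w {i, j, k}) else max 0 (w {i, j, k})) = 0"
    proof (rule sum.neutral, rule ballI)
      fix k assume "k \<in> ?K i j"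
      then have "k \<noteq> i" "k \<noteq> j" by (auto simp: triangles_pairs)
      then show "(if c $ i < c $ k then max 0 (- w {i, j, k}) else max 0 (w {i, j, k})) = 0"
        using c(2)[of k] by (auto simp: max_def)
    qed
    then have "L c = sqrt 2 * w e" using eq[OF c(1)] ij by (simp add: edge_length_def)
    then show ?thesis using L_nonneg[OF c(1)] by (simp add: zero_le_mult_iff)
  qed
  ultimately show ?thesis using that by blast
qed

section \<open>Maximal faces\<close>

lemma max_face_subset: "max_face A c \<subseteq> A"
  by (auto simp: max_face_def)

lemma max_face_0: "max_face A 0 = A"
  by (auto simp: max_face_def)

lemma max_face_singleton: "max_face {x} c = {x}"
  by (auto simp: max_face_def)

lemma max_face_inner: "x \<in> max_face A c \<Longrightarrow> y \<in> max_face A c \<Longrightarrow> x \<bullet> c = y \<bullet> c"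
  by (force simp: max_face_def)

lemma max_face_plus: "max_face (A + B) c = max_face A c + max_face B c"
proof
  show "max_face (A + B) c \<subseteq> max_face A c + max_face B c"
  proof
    fix x assume x: "x \<in> max_face (A + B) c"
    then obtain a b where ab: "x = a + b" "a \<in> A" "b \<in> B" by (auto simp: max_face_def elim: set_plus_elim)
    have "(y + z) \<bullet> c \<le> x \<bullet> c" if "y \<in> A" "z \<in> B" for y z
      using x that by (auto simp: max_face_def)
    from this[OF _ ab(3)] this[OF ab(2)] have "a \<in> max_face A c" "b \<in> max_face B c"
      using ab by (auto simp: max_face_def inner_add_left)
    then show "x \<in> max_face A c + max_face B c" using ab by auto
  qed
  show "max_face A c + max_face B c \<subseteq> max_face (A + B) c"
    by (auto simp: max_face_def inner_add_left elim!: set_plus_elim intro!: add_mono)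
qed

lemma max_face_sum:
  "finite I \<Longrightarrow> max_face (\<Sum>i\<in>I. A i) c = (\<Sum>i\<in>I. max_face (A i) c)"
  by (induction I rule: finite_induct) (simp_all add: max_face_plus max_face_singleton)

text \<open>No sign of \<open>r\<close> is assumed: a negative factor reverses the direction, which
  covers -\<Delta>_t, and for \<open>r = 0\<close> the direction 0 selects all of
  \<open>A\<close>.\<close>

lemma max_face_dilate: "max_face (dilate r A) c = dilate r (max_face A (r *\<^sub>R c))"
  by (auto simp: max_face_def dilate_def)

lemma max_face_scaleR: "0 < r \<Longrightarrow> max_face A (r *\<^sub>R c) = max_face A c"
  by (auto simp: max_face_def)

lemma max_face_translation: "max_face ((+) a ` A) c = (+) a ` max_face A c"
  by (auto simp: max_face_def inner_add_left)

lemma max_face_nonempty: "compact A \<Longrightarrow> A \<noteq> {} \<Longrightarrow> max_face A c \<noteq> {}"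
  using continuous_attains_sup[of A "\<lambda>x. x \<bullet> c"] by (force simp: max_face_def intro: continuous_intros)

lemma max_face_eq_Int:
  assumes "x \<in> max_face A c" shows "max_face A c = A \<inter> {y. c \<bullet> y = c \<bullet> x}"
  using assms by (force simp: max_face_def inner_commute)

lemma max_face_face_of:
  assumes "convex A" shows "max_face A c face_of A"
proof (cases "max_face A c = {}")
  case False
  then obtain x where x: "x \<in> max_face A c" by blast
  show ?thesis
    unfolding max_face_eq_Int[OF x]
    using assms x by (intro face_of_Int_supporting_hyperplane_le) (auto simp: max_face_def inner_commute)
qed simp

text \<open>Faces of polytopes are exposed; statements about faces become statements about
  directions.\<close>

lemma face_of_eq_max_face:
  assumes "polytope P" "F face_of P" "F \<noteq> {}"
  obtains c where "F = max_face P c"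
proof -
  have "F exposed_face_of P"
    using assms exposed_face_of_polyhedron polytope_imp_polyhedron by blast
  then obtain a b where ab: "P \<subseteq> {x. a \<bullet> x \<le> b}" "F = P \<inter> {x. a \<bullet> x = b}"
    by (auto simp: exposed_face_of_def)
  then have "F = max_face P a"
    using assms(3) by (fastforce simp: max_face_def inner_commute)
  then show ?thesis using that by blast
qed

text \<open>Exchanging the \<open>i\<close>-th summand for a competitor \<open>y\<close> stays
  within the Minkowski sum.\<close>

lemma sum_in_max_faceD:
  assumes "finite I" "\<And>i. i \<in> I \<Longrightarrow> s i \<in> A i" "(\<Sum>i\<in>I. s i) \<in> max_face (\<Sum>i\<in>I. A i) c" "i \<in> I"
  shows "s i \<in> max_face (A i) c"
  unfolding max_face_def
proof (intro CollectI conjI ballI)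
  show "s i \<in> A i" using assms by blast
  fix y assume y: "y \<in> A i"
  have "(\<Sum>k\<in>I. (s(i := y)) k) \<in> (\<Sum>i\<in>I. A i)"
    unfolding set_sum_alt[OF assms(1)] using assms(2) y by (intro CollectI exI[of _ "s(i := y)"]) auto
  then have "(\<Sum>k\<in>I. (s(i := y)) k) \<bullet> c \<le> (\<Sum>i\<in>I. s i) \<bullet> c"
    using assms(3) by (simp add: max_face_def)
  then show "y \<bullet> c \<le> s i \<bullet> c"
    using assms(1,4) by (simp add: sum.remove[of I i] inner_add_left)
qed

lemma polytope_plus: "polytope A \<Longrightarrow> polytope B \<Longrightarrow> polytope (A + B)"
  unfolding set_plus_image
  by (intro polytope_linear_image polytope_Times)
    (auto simp: linear_iff algebra_simps split_beta)

lemma polytope_sum: "finite I \<Longrightarrow> (\<And>i. i \<in> I \<Longrightarrow> polytope (A i)) \<Longrightarrow> polytope (\<Sum>i\<in>I. A i)"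
  by (induction I rule: finite_induct) (simp_all add: polytope_plus polytope_sing)

lemma sum_set_nonempty:
  fixes A :: "'i \<Rightarrow> 'a::comm_monoid_add set"
  assumes "finite I" "\<And>i. i \<in> I \<Longrightarrow> A i \<noteq> {}" shows "(\<Sum>i\<in>I. A i) \<noteq> {}"
  using assms
proof (induction I rule: finite_induct)
  case (insert i I)
  then have "A i \<noteq> {}" "(\<Sum>i\<in>I. A i) \<noteq> {}" by auto
  then show ?case using insert.hyps by (auto simp: set_plus_def)
qed simp

lemma polytope_dilate: "polytope A \<Longrightarrow> polytope (dilate r A)"
  unfolding dilate_def by (intro polytope_linear_image) auto

section \<open>Faces of simplices\<close>

definition argmax :: "'v set \<Rightarrow> real ^ 'v \<Rightarrow> 'v set" where
  "argmax X c = {i \<in> X. \<forall>j\<in>X. c $ j \<le> c $ i}"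

lemma mem_simplex_on:
  fixes x :: "real ^ 'v::finite"
  shows "x \<in> simplex_on X \<longleftrightarrow> (\<forall>i. 0 \<le> x $ i) \<and> (\<forall>i. i \<notin> X \<longrightarrow> x $ i = 0) \<and> (\<Sum>i\<in>UNIV. x $ i) = 1"
    (is "_ \<longleftrightarrow> ?P x")
proof
  have "(\<lambda>i. axis i 1) ` X \<subseteq> {x. ?P x}"
    by (auto simp: axis_def)
  moreover have "convex {x. ?P x}"
    unfolding convex_def by (auto simp: sum.distrib sum_distrib_left[symmetric])
  ultimately have "simplex_on X \<subseteq> {x. ?P x}"
    unfolding simplex_on_def by (intro hull_minimal)
  then show "x \<in> simplex_on X \<Longrightarrow> ?P x" by blast
next
  assume x: "?P x"
  have "(\<Sum>i\<in>X. x $ i) = (\<Sum>i\<in>UNIV. x $ i)"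
    using x by (intro sum.mono_neutral_left) auto
  then have "(\<Sum>i\<in>X. x $ i *\<^sub>R axis i (1::real)) \<in> simplex_on X"
    unfolding simplex_on_def using x
    by (intro convex_sum) (auto intro: hull_inc)
  also have "(\<Sum>i\<in>X. x $ i *\<^sub>R axis i (1::real)) = (\<Sum>i\<in>UNIV. x $ i *\<^sub>R axis i (1::real))"
    using x by (intro sum.mono_neutral_left) auto
  also have "\<dots> = x"
    by (simp add: vec_eq_iff axis_def if_distrib[of "\<lambda>y. _ * y"] cong: if_cong)
  finally show "x \<in> simplex_on X" .
qed

lemma axis_mem_simplex_on: "axis i 1 \<in> simplex_on X \<longleftrightarrow> i \<in> X"
  by (auto simp: mem_simplex_on axis_def)

lemma simplex_on_singleton: "simplex_on {i} = {axis i 1}"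
  by (simp add: simplex_on_def)

lemma polytope_simplex_on: "polytope (simplex_on X)"
  unfolding simplex_on_def by (intro polytope_convex_hull) simp

lemma simplex_on_nonempty: "X \<noteq> {} \<Longrightarrow> simplex_on X \<noteq> {}"
  using axis_mem_simplex_on by blast

lemma max_face_simplex_on: "max_face (simplex_on X) c = simplex_on (argmax X c)"
proof (cases "X = {}")
  case True
  then show ?thesis by (simp add: simplex_on_def max_face_def argmax_def)
next
  case False
  define M where "M = Max ((\<lambda>i. c $ i) ` X)"
  have le: "c $ i \<le> M" if "i \<in> X" for i using that by (simp add: M_def)
  obtain i0 where i0: "i0 \<in> X" "c $ i0 = M"
    using Max_in[of "(\<lambda>i. c $ i) ` X"] False unfolding M_def by (metis (mono_tags, lifting) finite finite_imageI image_iff image_is_empty)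
  have argmax: "i \<in> argmax X c \<longleftrightarrow> i \<in> X \<and> c $ i = M" for i
    unfolding argmax_def using le i0 by fastforce
  \<comment> \<open>The defect of \<open>x\<close> is a sum of nonnegative terms; it is 0 exactly if
    \<open>x\<close> is supported on the vertices of maximal height.\<close>
  have eq: "M - x \<bullet> c = (\<Sum>i\<in>UNIV. x $ i * (M - c $ i))" if "x \<in> simplex_on X" for x
  proof -
    have "(\<Sum>i\<in>UNIV. x $ i * (M - c $ i)) = (\<Sum>i\<in>UNIV. x $ i) * M - x \<bullet> c"
      by (simp add: inner_vec_def algebra_simps sum_subtractf sum_distrib_left)
    then show ?thesis using that by (simp add: mem_simplex_on)
  qed
  have nonneg: "0 \<le> x $ i * (M - c $ i)" if "x \<in> simplex_on X" for x i
    using that le[of i] by (cases "i \<in> X") (auto simp: mem_simplex_on)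
  have maxM: "x \<in> max_face (simplex_on X) c \<longleftrightarrow> x \<in> simplex_on X \<and> x \<bullet> c = M" for x
  proof -
    have "y \<bullet> c \<le> M" if "y \<in> simplex_on X" for y
      using eq[OF that] nonneg[OF that] sum_nonneg[of UNIV "\<lambda>i. y $ i * (M - c $ i)"] by simp
    moreover have "axis i0 1 \<in> simplex_on X" "axis i0 1 \<bullet> c = M"
      using i0 by (simp_all add: axis_mem_simplex_on inner_axis' )
    ultimately show ?thesis unfolding max_face_def
      by (smt (verit) mem_Collect_eq)
  qed
  show ?thesis
  proof (intro set_eqI)
    fix x
    show "x \<in> max_face (simplex_on X) c \<longleftrightarrow> x \<in> simplex_on (argmax X c)"
    proof (cases "x \<in> simplex_on X")
      case True
      have "x \<bullet> c = M \<longleftrightarrow> (\<forall>i. x $ i * (M - c $ i) = 0)"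
        using eq[OF True] sum_nonneg_eq_0_iff[of UNIV "\<lambda>i. x $ i * (M - c $ i)"] nonneg[OF True] by auto
      then show ?thesis
        using True by (auto simp: maxM mem_simplex_on argmax)
    next
      case False
      then show ?thesis by (auto simp: maxM mem_simplex_on argmax)
    qed
  qed
qed

lemma argmax_nonempty:
  fixes X :: "'v::finite set"
  assumes "X \<noteq> {}" shows "argmax X c \<noteq> {}"
proof -
  have "max_face (simplex_on X) c \<noteq> {}"
    using assms by (intro max_face_nonempty polytope_imp_compact polytope_simplex_on simplex_on_nonempty)
  then show ?thesis unfolding max_face_simplex_on by (auto simp: simplex_on_def)
qed

text \<open>Within a clique all comparisons run along edges. This is why \<Delta>_t and -\<Delta>_t
  are deformations of the zonotope.\<close>

lemma argmax_clique_same_sides: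
  assumes "clique E X" "same_sides E c c'" shows "argmax X c = argmax X c'"
proof -
  have "c $ j \<le> c $ i \<longleftrightarrow> c' $ j \<le> c' $ i" if "i \<in> X" "j \<in> X" for i j
  proof (cases "i = j")
    case False
    then have "{i, j} \<in> E" using assms(1) that by (simp add: clique_def)
    then show ?thesis using same_sidesD[OF assms(2), of i j] by auto
  qed simp
  then show ?thesis by (auto simp: argmax_def)
qed

lemma same_sides_scaleR: "same_sides E c c' \<Longrightarrow> same_sides E (r *\<^sub>R c) (r *\<^sub>R c')"
  unfolding same_sides_def by (auto simp: mult_less_cancel_left insert_commute)

lemma argmax_pair: "argmax {i, j} c = (if c $ i < c $ j then {j} else if c $ j < c $ i then {i} else {i, j})"
  by (auto simp: argmax_def)

lemma simplex_on_pair_diff: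
  assumes x: "x \<in> simplex_on {i, j}" and y: "y \<in> simplex_on {i, j}" and "i \<noteq> j"
  shows "x - y = (x $ i - y $ i) *\<^sub>R (axis i 1 - axis j 1)"
proof -
  have two: "z $ i + z $ j = 1" if "z \<in> simplex_on {i, j}" for z
  proof -
    have "(\<Sum>k\<in>{i, j}. z $ k) = (\<Sum>k\<in>UNIV. z $ k)"
      using that by (intro sum.mono_neutral_left) (auto simp: mem_simplex_on)
    then show ?thesis using that assms(3) by (simp add: mem_simplex_on)
  qed
  show ?thesis
    using two[OF x] two[OF y] x y \<open>i \<noteq> j\<close> unfolding mem_simplex_on
    by (auto simp: vec_eq_iff axis_def)
qed

section \<open>The faces of the graphical zonotope\<close>

context simple_graph
begin

abbreviation "Z \<equiv> graphical_zonotope E"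

text \<open>A negative weight means the dilate of a reflected simplex, not a Minkowski
  difference.\<close>

definition weighted_sum :: "('v set \<Rightarrow> real) \<Rightarrow> (real ^ 'v) set" where
  "weighted_sum w = (\<Sum>s\<in>E \<union> triangles E. dilate (w s) (simplex_on s))"

lemma clique_edge: "e \<in> E \<Longrightarrow> clique E e"
proof -
  assume e: "e \<in> E"
  then obtain i j where ij: "e = {i, j}" by (elim edgeE)
  then have "{j, i} \<in> E" using e by (simp add: insert_commute)
  then show ?thesis using e ij by (auto simp: clique_def)
qed

lemma clique_cells: "s \<in> E \<union> triangles E \<Longrightarrow> clique E s"
  using clique_edge by (auto simp: triangles_def)

lemma cells_nonempty: "s \<in> E \<union> triangles E \<Longrightarrow> s \<noteq> {}"
  using simple by (auto simp: triangles_def)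

lemma polytope_zonotope: "polytope Z"
  unfolding graphical_zonotope_def by (intro polytope_sum polytope_simplex_on) simp

lemma polytope_weighted_sum: "polytope (weighted_sum w)"
  unfolding weighted_sum_def by (intro polytope_sum polytope_dilate polytope_simplex_on) simp

lemma weighted_sum_nonempty: "weighted_sum w \<noteq> {}"
  unfolding weighted_sum_def dilate_def
  using simplex_on_nonempty[OF cells_nonempty] by (intro sum_set_nonempty) auto

lemma max_face_zonotope: "max_face Z c = (\<Sum>e\<in>E. simplex_on (argmax e c))"
  unfolding graphical_zonotope_def by (simp add: max_face_sum max_face_simplex_on)

lemma zonotope_nonempty: "Z \<noteq> {}"
  unfolding graphical_zonotope_def
  using simplex_on_nonempty[OF cells_nonempty] by (intro sum_set_nonempty) auto

lemma max_face_zonotope_nonempty: "max_face Z c \<noteq> {}"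
  using max_face_nonempty polytope_imp_compact polytope_zonotope zonotope_nonempty by blast

lemma max_face_weighted_sum:
  "max_face (weighted_sum w) c =
    (\<Sum>s\<in>E \<union> triangles E. dilate (w s) (simplex_on (argmax s (w s *\<^sub>R c))))"
  unfolding weighted_sum_def by (simp add: max_face_sum max_face_simplex_on max_face_dilate)

text \<open>A point of the face can be chosen with summand \<open>axis i 1\<close> at
  \<open>e\<close>, and the summands of a maximal point are maximal.\<close>

lemma max_face_zonotope_subset:
  assumes "max_face Z c \<subseteq> max_face Z c'" "e \<in> E"
  shows "argmax e c \<subseteq> argmax e c'"
proof
  fix i assume i: "i \<in> argmax e c"
  define s where "s f = (if f = e then axis i 1 else SOME x. x \<in> simplex_on (argmax f c))" for f
  have s: "s f \<in> simplex_on (argmax f c)" if "f \<in> E" for f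
    using i that simplex_on_nonempty[OF argmax_nonempty, of f c] cells_nonempty[of f]
    by (auto simp: s_def axis_mem_simplex_on some_in_eq)
  then have "(\<Sum>f\<in>E. s f) \<in> max_face Z c"
    unfolding max_face_zonotope set_sum_alt[OF finite_edges] by blast
  then have "(\<Sum>f\<in>E. s f) \<in> max_face (\<Sum>f\<in>E. simplex_on f) c'"
    using assms by (auto simp: graphical_zonotope_def)
  moreover have "s f \<in> simplex_on f" if "f \<in> E" for f
    using s[OF that] max_face_subset[of "simplex_on f" c] by (auto simp: max_face_simplex_on)
  ultimately have "s e \<in> max_face (simplex_on e) c'"
    using assms(2) by (intro sum_in_max_faceD[of E s]) auto
  then show "i \<in> argmax e c'" by (simp add: s_def max_face_simplex_on axis_mem_simplex_on)
qed

text \<open>In other words, the normal cones are the cells of the graphical arrangement.\<close>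

lemma max_face_zonotope_eq_iff: "max_face Z c = max_face Z c' \<longleftrightarrow> same_sides E c c'"
proof
  assume eq: "max_face Z c = max_face Z c'"
  show "same_sides E c c'"
    unfolding same_sides_def
  proof (intro allI impI)
    fix i j assume e: "{i, j} \<in> E"
    then have "argmax {i, j} c = argmax {i, j} c'"
      using eq max_face_zonotope_subset by blast
    then show "c $ i < c $ j \<longleftrightarrow> c' $ i < c' $ j"
      using edge_neq[OF e] by (auto simp: argmax_pair split: if_splits)
  qed
next
  assume "same_sides E c c'"
  then show "max_face Z c = max_face Z c'"
    unfolding max_face_zonotope by (intro sum.cong refl) (simp add: argmax_clique_same_sides[OF clique_edge])
qed

lemma max_face_weighted_sum_same_sides:
  assumes "same_sides E c c'"
  shows "max_face (weighted_sum w) c = max_face (weighted_sum w) c'"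
  unfolding max_face_weighted_sum
  using argmax_clique_same_sides[OF clique_cells same_sides_scaleR[OF assms]]
  by (intro sum.cong refl) simp

text \<open>As the normal cones of the zonotope are cells, coarsening its fan means that maximal
  faces are constant on cells. Normal fans no longer occur after this.\<close>

lemma deformation_of_zonotope_iff:
  "deformation_of Q Z \<longleftrightarrow> polytope Q \<and> Q \<noteq> {} \<and>
    (\<forall>c c'. same_sides E c c' \<longrightarrow> max_face Q c = max_face Q c')"
proof (cases "polytope Q \<and> Q \<noteq> {}")
  case True
  have "coarsens (normal_fan Q) (normal_fan Z) \<longleftrightarrow> (\<forall>c c'. same_sides E c c' \<longrightarrow> max_face Q c = max_face Q c')"
  proof
    assume co: "coarsens (normal_fan Q) (normal_fan Z)"
    show "\<forall>c c'. same_sides E c c' \<longrightarrow> max_face Q c = max_face Q c'"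
    proof (intro allI impI)
      fix c c' assume "same_sides E c c'"
      then have eq: "max_face Z c' = max_face Z c" by (simp only: max_face_zonotope_eq_iff[symmetric])
      have "normal_cone Z (max_face Z c) \<in> normal_fan Z"
        unfolding normal_fan_def
        using max_face_face_of[OF polytope_imp_convex[OF polytope_zonotope]] max_face_zonotope_nonempty by blast
      then obtain D where "D \<in> normal_fan Q" "normal_cone Z (max_face Z c) \<subseteq> D"
        using co by (auto simp: coarsens_def)
      then obtain F where "normal_cone Z (max_face Z c) \<subseteq> normal_cone Q F"
        by (auto simp: normal_fan_def)
      then show "max_face Q c = max_face Q c'" using eq by (auto simp: normal_cone_def)
    qed
  next
    assume eq: "\<forall>c c'. same_sides E c c' \<longrightarrow> max_face Q c = max_face Q c'"
    show "coarsens (normal_fan Q) (normal_fan Z)"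
      unfolding coarsens_def
    proof
      fix C assume "C \<in> normal_fan Z"
      then obtain F where F: "C = normal_cone Z F" "F face_of Z" "F \<noteq> {}" by (auto simp: normal_fan_def)
      then obtain c where c: "F = max_face Z c" using face_of_eq_max_face polytope_zonotope by metis
      have "C \<subseteq> normal_cone Q (max_face Q c)"
        using eq F c by (auto simp: normal_cone_def max_face_zonotope_eq_iff)
      moreover have "normal_cone Q (max_face Q c) \<in> normal_fan Q"
        unfolding normal_fan_def
        using True max_face_face_of[of Q c] max_face_nonempty[of Q c] polytope_imp_convex polytope_imp_compact by blast
      ultimately show "\<exists>D\<in>normal_fan Q. C \<subseteq> D" by blast
    qed
  qed
  then show ?thesis using True by (simp add: deformation_of_def)
qed (auto simp: deformation_of_def)

lemma deformation_weighted_sum: "deformation_of (weighted_sum w) Z"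
  by (simp add: deformation_of_zonotope_iff polytope_weighted_sum weighted_sum_nonempty max_face_weighted_sum_same_sides)

section \<open>Dimensions of the faces of the zonotope\<close>

definition dirs :: "real ^ 'v \<Rightarrow> (real ^ 'v) set" where
  "dirs c = {axis i 1 - axis j 1 | i j. {i, j} \<in> tight E c}"

lemma argmax_tight:
  assumes "e \<in> E" shows "argmax e c = e \<longleftrightarrow> e \<in> tight E c" "e \<notin> tight E c \<Longrightarrow> \<exists>i. argmax e c = {i}"
proof -
  obtain i j where e: "e = {i, j}" "i \<noteq> j" using assms by (elim edgeE)
  show "argmax e c = e \<longleftrightarrow> e \<in> tight E c" "e \<notin> tight E c \<Longrightarrow> \<exists>i. argmax e c = {i}"
    using assms e by (auto simp: argmax_pair tight_pair split: if_splits)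
qed

text \<open>The maximal face is the sum of the full segments over the tied edges and of single
  points over the others.\<close>

lemma span_max_face_zonotope:
  "span {x - y | x y. x \<in> max_face Z c \<and> y \<in> max_face Z c} = span (dirs c)"
proof (rule span_eq[THEN iffD2, OF conjI])
  have diff: "x - y \<in> span (dirs c)" if "e \<in> E" "x \<in> simplex_on (argmax e c)" "y \<in> simplex_on (argmax e c)" for e x y
  proof (cases "e \<in> tight E c")
    case True
    obtain i j where e: "e = {i, j}" "i \<noteq> j" using \<open>e \<in> E\<close> by (elim edgeE)
    have "axis i 1 - axis j 1 \<in> dirs c" using True e by (auto simp: dirs_def)
    moreover have "x - y = (x $ i - y $ i) *\<^sub>R (axis i 1 - axis j 1)"
      using that True e argmax_tight(1)[of e c] by (intro simplex_on_pair_diff) auto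
    ultimately show ?thesis by (simp add: span_base span_scale)
  next
    case False
    then obtain i where "argmax e c = {i}" using argmax_tight(2) \<open>e \<in> E\<close> by blast
    then show ?thesis using that by (simp add: simplex_on_singleton span_zero)
  qed
  show "{x - y | x y. x \<in> max_face Z c \<and> y \<in> max_face Z c} \<subseteq> span (dirs c)"
  proof clarify
    fix x y assume "x \<in> max_face Z c" "y \<in> max_face Z c"
    then obtain s r where "x = sum s E" "\<forall>e\<in>E. s e \<in> simplex_on (argmax e c)"
      "y = sum r E" "\<forall>e\<in>E. r e \<in> simplex_on (argmax e c)"
      unfolding max_face_zonotope set_sum_alt[OF finite_edges] by blast
    then show "x - y \<in> span (dirs c)"
      using diff by (auto simp: sum_subtractf[symmetric] intro!: span_sum)
  qed
  show "dirs c \<subseteq> span {x - y | x y. x \<in> max_face Z c \<and> y \<in> max_face Z c}"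
  proof
    fix d assume "d \<in> dirs c"
    then obtain i j where d: "d = axis i 1 - axis j 1" and e: "{i, j} \<in> tight E c" by (auto simp: dirs_def)
    then have E: "{i, j} \<in> E" by (simp add: tight_pair)
    have tp: "argmax {i, j} c = {i, j}" using argmax_tight(1)[OF E] e by blast
    define s where "s k f = (if f = {i, j} then axis k 1 else SOME x. x \<in> simplex_on (argmax f c))" for k f
    have s: "s k f \<in> simplex_on (argmax f c)" if "f \<in> E" "k \<in> {i, j}" for f k
    proof (cases "f = {i, j}")
      case True
      then show ?thesis using that(2) tp by (simp only: s_def axis_mem_simplex_on if_True simp_thms)
    next
      case False
      then show ?thesis
        using that simplex_on_nonempty[OF argmax_nonempty, of f c] cells_nonempty[of f]
        by (simp add: s_def some_in_eq)
    qed
    have "sum (s k) E \<in> max_face Z c" if "k \<in> {i, j}" for k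
      unfolding max_face_zonotope set_sum_alt[OF finite_edges] using s that by blast
    moreover have "sum (s i) E - sum (s j) E = d"
    proof -
      have "sum (s i) E - sum (s j) E = (\<Sum>f\<in>E. if f = {i, j} then d else 0)"
        unfolding sum_subtractf[symmetric] by (intro sum.cong) (auto simp: s_def d)
      then show ?thesis using E by simp
    qed
    ultimately show "d \<in> span {x - y | x y. x \<in> max_face Z c \<and> y \<in> max_face Z c}"
      by (intro span_base) (metis (mono_tags, lifting) insertI1 insertI2 mem_Collect_eq)
  qed
qed

lemma aff_dim_max_face_zonotope: "aff_dim (max_face Z c) = int (dim (dirs c))"
proof -
  obtain a where a: "a \<in> max_face Z c" using max_face_zonotope_nonempty by blast
  let ?D = "{x - y | x y. x \<in> max_face Z c \<and> y \<in> max_face Z c}"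
  have "span ((\<lambda>x. x - a) ` max_face Z c) = span ?D"
  proof (rule span_eq[THEN iffD2, OF conjI])
    show "(\<lambda>x. x - a) ` max_face Z c \<subseteq> span ?D" using a by (auto intro!: span_base)
    show "?D \<subseteq> span ((\<lambda>x. x - a) ` max_face Z c)"
    proof clarify
      fix x y assume "x \<in> max_face Z c" "y \<in> max_face Z c"
      then have "(x - a) - (y - a) \<in> span ((\<lambda>x. x - a) ` max_face Z c)"
        by (intro span_diff span_base) auto
      then show "x - y \<in> span ((\<lambda>x. x - a) ` max_face Z c)" by simp
    qed
  qed
  then have "dim ((\<lambda>x. x - a) ` max_face Z c) = dim (dirs c)"
    unfolding span_max_face_zonotope by (metis dim_span)
  then show ?thesis using aff_dim_eq_dim_subtract[OF hull_inc[OF a]] by simp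
qed

text \<open>Each of two distinct edges has an endpoint outside the other one; the coordinates there
  give the coefficients.\<close>

lemma edge_dirs_independent:
  assumes ij: "{i, j} \<in> E" and kl: "{k, l} \<in> E" and ne: "{i, j} \<noteq> {k, l}"
    and z: "a *\<^sub>R (axis i 1 - axis j 1) + b *\<^sub>R (axis k 1 - axis l 1) = (0 :: real ^ 'v)"
  shows "a = 0 \<and> b = 0"
proof -
  have n: "i \<noteq> j" "k \<noteq> l" using ij kl edge_neq by auto
  have "(a *\<^sub>R (axis i 1 - axis j 1) + b *\<^sub>R (axis k 1 - axis l 1) :: real ^ 'v) $ x = 0" for x
    using z by simp
  from this[of i] this[of j] this[of k] this[of l] show ?thesis
    using n ne by (auto simp: axis_def doubleton_eq_iff split: if_splits)
qed

lemma independent_edge_dirs: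
  assumes ij: "{i, j} \<in> E" and kl: "{k, l} \<in> E" and ne: "{i, j} \<noteq> {k, l}"
  shows "axis i 1 - axis j 1 \<noteq> (axis k 1 - axis l 1 :: real ^ 'v)"
    and "independent {axis i 1 - axis j 1, axis k 1 - axis l 1 :: real ^ 'v}"
proof -
  let ?u = "axis i 1 - axis j 1 :: real ^ 'v" and ?v = "axis k 1 - axis l 1 :: real ^ 'v"
  have ind: "x = 0 \<and> y = 0" if "x *\<^sub>R ?u + y *\<^sub>R ?v = 0" for x y
    using edge_dirs_independent[OF ij kl ne that] .
  show "?u \<noteq> ?v" using ind[of 1 "-1"] by auto
  show "independent {?u, ?v}"
  proof (rule independent_insertI)
    show "?u \<notin> span {?v}"
    proof
      assume "?u \<in> span {?v}"
      then obtain t where "?u = t *\<^sub>R ?v" by (auto simp: span_singleton)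
      then show False using ind[of 1 "- t"] by simp
    qed
    show "independent {?v}" using ind[of 0 1] by auto
  qed
qed

lemma dim_dirs_ge_2:
  assumes "a \<in> tight E c" "b \<in> tight E c" "a \<noteq> b"
  shows "2 \<le> dim (dirs c)"
proof -
  have E: "a \<in> E" "b \<in> E" using assms by (auto simp: tight_def)
  obtain i j k l where ij: "a = {i, j}" "b = {k, l}" using E edgeE by metis
  let ?u = "axis i 1 - axis j 1 :: real ^ 'v" and ?v = "axis k 1 - axis l 1 :: real ^ 'v"
  have "?u \<noteq> ?v" "independent {?u, ?v}" using independent_edge_dirs[of i j k l] E ij assms by auto
  moreover have "{?u, ?v} \<subseteq> dirs c" using assms ij by (auto simp: dirs_def)
  ultimately show ?thesis using independent_card_le_dim[of "{?u, ?v}" "dirs c"] by simp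
qed

lemma dim_dirs_single:
  assumes "tight E c = {a}" shows "dim (dirs c) = 1"
proof -
  have "a \<in> E" using assms tight_subset by blast
  then obtain i j where a: "a = {i, j}" "i \<noteq> j" by (elim edgeE)
  let ?v = "axis i 1 - axis j 1 :: real ^ 'v"
  have "dirs c = {?v, - ?v}" using assms a by (auto simp: dirs_def doubleton_eq_iff)
  moreover have "- ?v \<in> span {?v}" by (intro span_neg span_base) simp
  then have "span {?v, - ?v} = span {?v}" by (simp add: span_eq span_base)
  moreover have "?v \<noteq> 0" using a by (auto simp: vec_eq_iff axis_def split: if_splits)
  ultimately show ?thesis by (metis dim_singleton dim_span)
qed

lemma dim_dirs_1_iff: "dim (dirs c) = 1 \<longleftrightarrow> (\<exists>a. tight E c = {a})"
proof
  assume d: "dim (dirs c) = 1"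
  then have "tight E c \<noteq> {}" by (auto simp: dirs_def)
  then obtain a where "a \<in> tight E c" by blast
  moreover have "b = a" if "b \<in> tight E c" for b
    using dim_dirs_ge_2[OF that \<open>a \<in> tight E c\<close>] d by auto
  ultimately show "\<exists>a. tight E c = {a}" by auto
qed (use dim_dirs_single in blast)

lemma edge_of_zonotope_iff: "e edge_of Z \<longleftrightarrow> (\<exists>c a. tight E c = {a} \<and> e = max_face Z c)"
proof
  assume e: "e edge_of Z"
  then have "e \<noteq> {}" by (auto simp: edge_of_def)
  then obtain c where "e = max_face Z c"
    using e face_of_eq_max_face polytope_zonotope by (metis edge_of_def)
  then show "\<exists>c a. tight E c = {a} \<and> e = max_face Z c"
    using e by (auto simp: edge_of_def aff_dim_max_face_zonotope simp flip: dim_dirs_1_iff)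
next
  assume "\<exists>c a. tight E c = {a} \<and> e = max_face Z c"
  then show "e edge_of Z"
    using max_face_face_of[OF polytope_imp_convex[OF polytope_zonotope]]
    by (auto simp: edge_of_def aff_dim_max_face_zonotope dim_dirs_single)
qed

end

section \<open>Small perturbations\<close>

text \<open>A fixed small perturbation of \<open>m\<close>. Its cell depends only on
  \<open>m\<close> and on the order that \<open>d\<close> induces on the ties of \<open>m\<close>,
  whichever step is chosen.\<close>

definition push :: "'v set set \<Rightarrow> real ^ 'v \<Rightarrow> real ^ 'v \<Rightarrow> real ^ 'v" where
  "push E m d = m + (SOME \<eta>. 0 < \<eta> \<and> near E m (m + \<eta> *\<^sub>R d)) *\<^sub>R d"

lemma push:
  shows near_push: "near E m (push E m d)"
    and push_less_iff: "m $ i = m $ j \<Longrightarrow> push E m d $ i < push E m d $ j \<longleftrightarrow> d $ i < d $ j"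
proof -
  have "\<exists>\<eta>. 0 < \<eta> \<and> near E m (m + \<eta> *\<^sub>R d)" by (rule near_pushE) blast
  from someI_ex[OF this] show "near E m (push E m d)"
    "m $ i = m $ j \<Longrightarrow> push E m d $ i < push E m d $ j \<longleftrightarrow> d $ i < d $ j"
    by (auto simp: push_def)
qed

lemma push_eq_iff: "m $ i = m $ j \<Longrightarrow> push E m d $ i = push E m d $ j \<longleftrightarrow> d $ i = d $ j"
  using push_less_iff[of m i j E d] push_less_iff[of m j i E d]
  by (cases rule: linorder_cases[of "d $ i" "d $ j"]) auto

context simple_graph
begin

lemma tight_push_iff: "{i, j} \<in> tight E (push E m d) \<longleftrightarrow> {i, j} \<in> tight E m \<and> d $ i = d $ j"
proof -
  have "{i, j} \<in> tight E (push E m d) \<Longrightarrow> {i, j} \<in> tight E m" using tight_near[OF near_push] by blast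
  then show ?thesis using push_eq_iff[of m i j E d] by (auto simp: tight_pair)
qed

lemma tight_pushI:
  assumes "A \<subseteq> tight E m" "\<And>i j. {i, j} \<in> tight E m \<Longrightarrow> d $ i = d $ j \<longleftrightarrow> {i, j} \<in> A"
  shows "tight E (push E m d) = A"
proof (rule set_eqI)
  fix e show "e \<in> tight E (push E m d) \<longleftrightarrow> e \<in> A"
  proof (cases "e \<in> E")
    case True
    then obtain i j where "e = {i, j}" by (elim edgeE)
    then show ?thesis using assms tight_push_iff[of i j m d] by auto
  next
    case False
    then show ?thesis using assms(1) tight_subset[of E m] tight_subset[of E "push E m d"] by blast
  qed
qed

lemma near_near:
  assumes "near E m c" "near E m c'" "\<And>i j. {i, j} \<in> tight E m \<Longrightarrow> c $ i < c $ j \<Longrightarrow> c' $ i < c' $ j"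
  shows "near E c c'"
  unfolding near_def
proof (intro allI impI)
  fix i j assume e: "{i, j} \<in> E" and lt: "c $ i < c $ j"
  then have e': "{j, i} \<in> E" by (simp add: insert_commute)
  show "c' $ i < c' $ j"
  proof (cases rule: linorder_cases[of "m $ i" "m $ j"])
    case less then show ?thesis using nearD[OF assms(2) e] by blast
  next
    case equal then show ?thesis using assms(3)[of i j] lt e by (simp add: tight_pair)
  next
    case greater then show ?thesis using nearD[OF assms(1) e'] lt by simp
  qed
qed

lemma near_push_push:
  assumes "\<And>i j. {i, j} \<in> tight E m \<Longrightarrow> d $ i < d $ j \<Longrightarrow> d' $ i < d' $ j"
  shows "near E (push E m d) (push E m d')"
  by (rule near_near[OF near_push near_push]) (use assms in \<open>auto simp: tight_pair push_less_iff\<close>)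

lemma same_sides_push:
  assumes "near E m c" "\<And>i j. {i, j} \<in> tight E m \<Longrightarrow> d $ i < d $ j \<longleftrightarrow> c $ i < c $ j"
  shows "same_sides E (push E m d) c"
  by (rule same_sidesI_near[OF near_push assms(1)]) (use assms(2) in \<open>auto simp: tight_pair push_less_iff\<close>)

text \<open>The segment from \<open>m\<close> to \<open>c\<close> without \<open>m\<close> stays in
  the cell of \<open>c\<close>, so \<open>m\<close> is a limit of directions of that cell.\<close>

lemma near_same_sides_segment:
  assumes n: "near E m c" and \<eta>: "0 < \<eta>" "\<eta> \<le> 1"
  shows "same_sides E c (m + \<eta> *\<^sub>R (c - m))"
proof (rule same_sidesI_near[OF n])
  let ?c = "m + \<eta> *\<^sub>R (c - m)"
  have c: "?c $ k = (1 - \<eta>) * m $ k + \<eta> * c $ k" for k by (simp add: algebra_simps)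
  show "near E m ?c"
    unfolding near_def
  proof (intro allI impI)
    fix i j assume e: "{i, j} \<in> E" and lt: "m $ i < m $ j"
    have "(1 - \<eta>) * m $ i \<le> (1 - \<eta>) * m $ j" using \<eta> lt by (intro mult_left_mono) auto
    moreover have "\<eta> * c $ i < \<eta> * c $ j" using \<eta> nearD[OF n e lt] by simp
    ultimately show "?c $ i < ?c $ j" unfolding c by linarith
  qed
  fix i j assume "m $ i = m $ j"
  then show "c $ i < c $ j \<longleftrightarrow> ?c $ i < ?c $ j" using \<eta> by simp
qed

end

lemma norm_edge_dir: "i \<noteq> j \<Longrightarrow> norm (axis i 1 - axis j 1 :: real ^ 'v::finite) = sqrt 2"
  by (simp add: norm_eq_sqrt_inner inner_diff_left inner_diff_right inner_axis_axis)

section \<open>Deformations of the graphical zonotope\<close>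

locale zonotope_deformation = simple_graph E for E :: "'v::finite set set" +
  fixes Q :: "(real ^ 'v) set"
  assumes deformation: "deformation_of Q (graphical_zonotope E)"
begin

lemma polytope_Q: "polytope Q" and Q_nonempty: "Q \<noteq> {}"
  and max_face_Q_cong: "same_sides E c c' \<Longrightarrow> max_face Q c = max_face Q c'"
  using deformation unfolding deformation_of_zonotope_iff by blast+

lemma max_face_Q_nonempty: "max_face Q c \<noteq> {}"
  using max_face_nonempty polytope_imp_compact polytope_Q Q_nonempty by blast

text \<open>A maximizer for \<open>c\<close> is one for all directions m + \<eta>(c - m) with 0 <
  \<eta> \<le> 1, and \<eta> may tend to 0.\<close>

lemma max_face_near_subset:
  assumes n: "near E m c" shows "max_face Q c \<subseteq> max_face Q m"
proof
  fix x assume x: "x \<in> max_face Q c"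
  have "y \<bullet> m \<le> x \<bullet> m" if y: "y \<in> Q" for y
  proof (rule ccontr)
    assume "\<not> y \<bullet> m \<le> x \<bullet> m"
    define A where "A = (y - x) \<bullet> m"
    define B where "B = (y - x) \<bullet> (c - m)"
    \<comment> \<open>\<open>A\<close> is the supposed gain of \<open>y\<close> over
      \<open>x\<close> in direction \<open>m\<close>; the step is so short that A + \<eta>B stays
      positive.\<close>
    define \<eta> where "\<eta> = A / (A + \<bar>B\<bar> + 1)"
    have A: "A > 0" using \<open>\<not> y \<bullet> m \<le> x \<bullet> m\<close> by (simp add: A_def inner_diff_left)
    then have \<eta>: "0 < \<eta>" "\<eta> \<le> 1" by (auto simp: \<eta>_def field_simps)
    have "x \<in> max_face Q (m + \<eta> *\<^sub>R (c - m))"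
      using x max_face_Q_cong[OF near_same_sides_segment[OF n \<eta>]] by simp
    then have "y \<bullet> (m + \<eta> *\<^sub>R (c - m)) \<le> x \<bullet> (m + \<eta> *\<^sub>R (c - m))"
      using y by (simp add: max_face_def)
    then have "A + \<eta> * B \<le> 0" by (simp add: A_def B_def inner_add_right inner_diff_left algebra_simps)
    moreover have "\<eta> * \<bar>B\<bar> < A"
    proof -
      have "A * \<bar>B\<bar> < A * (A + \<bar>B\<bar> + 1)" using A by (intro mult_strict_left_mono) auto
      then show ?thesis using A by (simp add: \<eta>_def field_simps)
    qed
    moreover have "- (\<eta> * \<bar>B\<bar>) \<le> \<eta> * B" using \<eta> by (metis abs_ge_minus_self abs_mult abs_of_pos minus_le_iff)
    ultimately show False by linarith
  qed
  then show "x \<in> max_face Q m" using x by (auto simp: max_face_def)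
qed

text \<open>A small move along \<open>d\<close> stays in the cell of \<open>c\<close>, so both
  functionals are constant on the face.\<close>

lemma max_face_diff_orthogonal:
  assumes x: "x \<in> max_face Q c" and y: "y \<in> max_face Q c"
    and d: "\<And>i j. {i, j} \<in> tight E c \<Longrightarrow> d $ i = d $ j"
  shows "(x - y) \<bullet> d = 0"
proof -
  obtain \<eta> where \<eta>: "\<eta> > 0" "near E c (c + \<eta> *\<^sub>R d)" by (rule near_pushE)
  have "same_sides E c (c + \<eta> *\<^sub>R d)"
    using d \<eta> by (intro same_sidesI_near[of c] near_refl) (auto simp: tight_pair)
  then have "x \<bullet> (c + \<eta> *\<^sub>R d) = y \<bullet> (c + \<eta> *\<^sub>R d)"
    using max_face_inner x y max_face_Q_cong by metis
  moreover have "x \<bullet> c = y \<bullet> c" using max_face_inner x y by metis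
  ultimately show ?thesis using \<eta> by (simp add: inner_add_right inner_diff_left)
qed

section \<open>Vertices of a deformation and the segments between neighbouring ones\<close>

definition vertex :: "real ^ 'v \<Rightarrow> real ^ 'v" where
  "vertex c = (SOME x. x \<in> max_face Q c)"

lemma vertex_mem: "vertex c \<in> max_face Q c"
  unfolding vertex_def using max_face_Q_nonempty by (simp add: some_in_eq)

lemma max_face_wall_diff:
  assumes c: "tight E c = {{i, j}}" and x: "x \<in> max_face Q c" and y: "y \<in> max_face Q c"
  shows "x - y = (x $ i - y $ i) *\<^sub>R (axis i 1 - axis j 1)"
proof -
  have ij: "i \<noteq> j" using c tight_subset[of E c] edge_neq by blast
  have "x $ k = y $ k" if "k \<noteq> i" "k \<noteq> j" for k
  proof -
    have "(x - y) \<bullet> axis k 1 = 0"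
      using x y by (rule max_face_diff_orthogonal) (use that c in \<open>auto simp: axis_def doubleton_eq_iff\<close>)
    then show ?thesis by (simp add: inner_axis)
  qed
  moreover have "(x - y) \<bullet> (axis i 1 + axis j 1) = 0"
    using x y by (rule max_face_diff_orthogonal) (use ij c in \<open>auto simp: axis_def doubleton_eq_iff\<close>)
  then have "x $ i + x $ j = y $ i + y $ j" by (simp add: inner_add_right inner_axis)
  ultimately show ?thesis using ij by (auto simp: vec_eq_iff axis_def)
qed

lemma vertex_cong:
  assumes "same_sides E c c'" shows "vertex c = vertex c'"
  using max_face_Q_cong[OF assms] by (simp add: vertex_def)

text \<open>No edge is tied at \<open>c\<close> or \<open>c'\<close>, and the two chosen points are
  the ends of the segment over the wall: their maximality bounds coordinate \<open>i\<close> on the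
  segment from above and from below.\<close>

lemma vertex_jump:
  assumes m: "tight E m = {{i, j}}" and c: "near E m c" "c $ j < c $ i" and c': "near E m c'" "c' $ i < c' $ j"
  shows "vertex c - vertex c' = (diameter (max_face Q m) / sqrt 2) *\<^sub>R (axis i 1 - axis j 1)"
proof -
  let ?u = "axis i 1 - axis j 1 :: real ^ 'v" and ?F = "max_face Q m"
  have ij: "i \<noteq> j" using m tight_subset[of E m] edge_neq by blast
  define v v' where "v = vertex c" and "v' = vertex c'"
  have v: "v \<in> max_face Q c" "v' \<in> max_face Q c'" using vertex_mem by (auto simp: v_def v'_def)
  have vF: "v \<in> ?F" "v' \<in> ?F"
    using v max_face_near_subset c(1) c'(1) by blast+
  have diff: "x - y = (x $ i - y $ i) *\<^sub>R ?u" if "x \<in> ?F" "y \<in> ?F" for x y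
    using max_face_wall_diff[OF m] that by blast
  have u: "?u \<bullet> d = d $ i - d $ j" for d by (simp add: inner_diff_left inner_axis')
  have bounds: "v' $ i \<le> x $ i \<and> x $ i \<le> v $ i" if x: "x \<in> ?F" for x
  proof -
    have xQ: "x \<in> Q" using x max_face_subset by blast
    have "(x - v) \<bullet> c \<le> 0" using v(1) xQ by (simp add: max_face_def inner_diff_left)
    then have "(x $ i - v $ i) * (c $ i - c $ j) \<le> 0" unfolding diff[OF x vF(1)] by (simp add: u)
    then have "x $ i \<le> v $ i" using c(2) by (simp add: mult_le_0_iff)
    moreover have "(x - v') \<bullet> c' \<le> 0" using v(2) xQ by (simp add: max_face_def inner_diff_left)
    then have "(x $ i - v' $ i) * (c' $ i - c' $ j) \<le> 0" unfolding diff[OF x vF(2)] by (simp add: u)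
    then have "v' $ i \<le> x $ i" using c'(2) by (simp add: mult_le_0_iff)
    ultimately show ?thesis by simp
  qed
  have nd: "norm (x - y) = \<bar>x $ i - y $ i\<bar> * sqrt 2" if "x \<in> ?F" "y \<in> ?F" for x y
    using diff[OF that] norm_edge_dir[OF ij] by (metis norm_scaleR)
  have "diameter ?F = (v $ i - v' $ i) * sqrt 2"
  proof (rule antisym)
    show "diameter ?F \<le> (v $ i - v' $ i) * sqrt 2"
    proof (rule diameter_le)
      show "?F \<noteq> {} \<or> 0 \<le> (v $ i - v' $ i) * sqrt 2" using vF by blast
      fix x y assume xy: "x \<in> ?F" "y \<in> ?F"
      have "\<bar>x $ i - y $ i\<bar> \<le> v $ i - v' $ i" using bounds[OF xy(1)] bounds[OF xy(2)] by linarith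
      then show "norm (x - y) \<le> (v $ i - v' $ i) * sqrt 2" unfolding nd[OF xy] by simp
    qed
    have "bounded ?F" using bounded_subset[OF polytope_imp_bounded[OF polytope_Q] max_face_subset] .
    then have "dist v v' \<le> diameter ?F" using vF by (intro diameter_bounded_bound)
    then show "(v $ i - v' $ i) * sqrt 2 \<le> diameter ?F"
      using nd[OF vF] bounds[OF vF(1)] by (simp add: dist_norm)
  qed
  then show ?thesis using diff[OF vF] by (simp add: v_def v'_def)
qed

lemma vertex_jump_push:
  assumes ij: "{i, j} \<in> tight E m" "d $ i = d $ j"
    and d: "\<And>x y. {x, y} \<in> tight E m \<Longrightarrow> d $ x = d $ y \<Longrightarrow> {x, y} = {i, j}"
    and d1: "\<And>x y. {x, y} \<in> tight E m \<Longrightarrow> d $ x < d $ y \<Longrightarrow> d1 $ x < d1 $ y"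
    and d2: "\<And>x y. {x, y} \<in> tight E m \<Longrightarrow> d $ x < d $ y \<Longrightarrow> d2 $ x < d2 $ y"
    and lt: "d1 $ j < d1 $ i" "d2 $ i < d2 $ j"
  shows "vertex (push E m d1) - vertex (push E m d2) =
    (diameter (max_face Q (push E m d)) / sqrt 2) *\<^sub>R (axis i 1 - axis j 1)"
proof (rule vertex_jump)
  show "tight E (push E m d) = {{i, j}}"
    using ij d by (intro tight_pushI) (auto simp: doubleton_eq_iff)
  show "near E (push E m d) (push E m d1)" "near E (push E m d) (push E m d2)"
    using d1 d2 by (auto intro: near_push_push)
  show "push E m d1 $ j < push E m d1 $ i" "push E m d2 $ i < push E m d2 $ j"
    using ij lt by (auto simp: tight_pair push_less_iff)
qed

lemma parallelogram_Q:
  assumes ab: "a \<noteq> b" and m: "tight E m = {a, b}" and c: "near E m c" "tight E c = {a}"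
    and c': "near E m c'" "tight E c' = {a}"
  shows "diameter (max_face Q c) = diameter (max_face Q c')"
proof -
  have E: "a \<in> E" "b \<in> E" using m tight_subset[of E m] by auto
  have "\<not> a \<subseteq> b" "\<not> b \<subseteq> a" using ab E simple by (metis card_subset_eq finite)+
  then obtain i p where ip: "i \<in> a" "i \<notin> b" "p \<in> b" "p \<notin> a" by blast
  obtain j where a: "a = {i, j}" "i \<noteq> j" using edgeE[OF E(1)] ip by (metis insertE insert_commute singletonD)
  obtain q where b: "b = {p, q}" "p \<noteq> q" using edgeE[OF E(2)] ip by (metis insertE insert_commute singletonD)
  have ne: "i \<noteq> p" "i \<noteq> q" "p \<noteq> j" using ip a b by auto
  let ?d = "\<lambda>s t. axis i s + axis p t :: real ^ 'v"
  let ?V = "\<lambda>s t. vertex (push E m (?d s t))"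
  let ?L = "\<lambda>s t. diameter (max_face Q (push E m (?d s t)))"
  have mt: "{x, y} \<in> tight E m \<longleftrightarrow> {x, y} = {i, j} \<or> {x, y} = {p, q}" for x y using m a b by auto
  note simps = axis_def mt doubleton_eq_iff
  have jumps: "?V 1 t - ?V (-1) t = (?L 0 t / sqrt 2) *\<^sub>R (axis i 1 - axis j 1)" if "t = 1 \<or> t = -1" for t
    using that by (intro vertex_jump_push) (use a b ne in \<open>auto simp: simps\<close>)
  have jumps': "?V s 1 - ?V s (-1) = (?L s 0 / sqrt 2) *\<^sub>R (axis p 1 - axis q 1)" if "s = 1 \<or> s = -1" for s
    using that by (intro vertex_jump_push) (use a b ne in \<open>auto simp: simps\<close>)
  \<comment> \<open>The walk around the four vertices closes, and its two edge directions are
    independent.\<close>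
  have "((?L 0 1 - ?L 0 (-1)) / sqrt 2) *\<^sub>R (axis i 1 - axis j 1) +
      (- (?L 1 0 - ?L (-1) 0) / sqrt 2) *\<^sub>R (axis p 1 - axis q 1) = (0 :: real ^ 'v)"
  proof -
    have "(?V 1 1 - ?V (-1) 1) - (?V 1 (-1) - ?V (-1) (-1)) - ((?V 1 1 - ?V 1 (-1)) - (?V (-1) 1 - ?V (-1) (-1))) = 0"
      by simp
    then have "((?L 0 1 / sqrt 2) *\<^sub>R (axis i 1 - axis j 1) - (?L 0 (-1) / sqrt 2) *\<^sub>R (axis i 1 - axis j 1)) -
      ((?L 1 0 / sqrt 2) *\<^sub>R (axis p 1 - axis q 1) - (?L (-1) 0 / sqrt 2) *\<^sub>R (axis p 1 - axis q 1)) = (0 :: real ^ 'v)"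
      by (simp only: jumps jumps' simp_thms)
    then show ?thesis by (simp add: scaleR_diff_left diff_divide_distrib)
  qed
  then have "(?L 0 1 - ?L 0 (-1)) / sqrt 2 = 0"
    using edge_dirs_independent[of i j p q] E a b ab by blast
  then have eq: "?L 0 1 = ?L 0 (-1)" by simp
  have L: "diameter (max_face Q c) = ?L 0 1" if c: "near E m c" "tight E c = {a}" for c
  proof -
    have cij: "c $ i = c $ j" and cpq: "c $ p \<noteq> c $ q"
      using c a b ab E tight_pair[of i j E c] tight_pair[of p q E c] by auto
    define t :: real where "t = (if c $ q < c $ p then 1 else -1)"
    have "same_sides E (push E m (?d 0 t)) c"
      by (rule same_sides_push[OF c(1)]) (use a b ne cij cpq in \<open>auto simp: t_def simps\<close>)
    then have "max_face Q c = max_face Q (push E m (?d 0 t))" using max_face_Q_cong by metis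
    then show ?thesis using eq by (simp add: t_def split: if_splits)
  qed
  show ?thesis using L c c' by simp
qed

lemma hexagon_Q:
  assumes t: "{i, j, k} \<in> triangles E" and m: "tight E m = {{i, j}, {i, k}, {j, k}}"
    and n: "near E m c" "near E m c'" "near E m d" "near E m d'"
    and c: "c $ i = c $ j" "c $ i < c $ k" "c' $ i = c' $ j" "c' $ k < c' $ i"
    and d: "d $ j = d $ k" "d $ j < d $ i" "d' $ j = d' $ k" "d' $ i < d' $ j"
  shows "diameter (max_face Q c) - diameter (max_face Q c') = diameter (max_face Q d) - diameter (max_face Q d')"
proof -
  have ne: "i \<noteq> j" "i \<noteq> k" "j \<noteq> k" using t by (auto simp: triangles_pairs)
  let ?d = "\<lambda>x y z. axis i x + axis j y + axis k z :: real ^ 'v"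
  let ?V = "\<lambda>x y z. vertex (push E m (?d x y z))"
  let ?L = "\<lambda>x y z. diameter (max_face Q (push E m (?d x y z)))"
  let ?l = "\<lambda>x y z. ?L x y z / sqrt 2"
  have mt: "{x, y} \<in> tight E m \<longleftrightarrow> {x, y} = {i, j} \<or> {x, y} = {i, k} \<or> {x, y} = {j, k}" for x y using m by auto
  note simps = axis_def mt doubleton_eq_iff
  \<comment> \<open>The six orders of \<open>i\<close>, \<open>j\<close>, \<open>k\<close> in cyclic
    sequence; each step crosses the wall on which two neighbours in the order are tied.\<close>
  have "?V 1 0 2 - ?V 0 1 2 = ?l 0 0 1 *\<^sub>R (axis i 1 - axis j 1)"
    by (rule vertex_jump_push) (use ne in \<open>auto simp: simps\<close>)
  moreover have "?V 0 1 2 - ?V 0 2 1 = ?l 0 1 1 *\<^sub>R (axis k 1 - axis j 1)"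
    by (rule vertex_jump_push) (use ne in \<open>auto simp: simps\<close>)
  moreover have "?V 0 2 1 - ?V 1 2 0 = ?l 0 1 0 *\<^sub>R (axis k 1 - axis i 1)"
    by (rule vertex_jump_push) (use ne in \<open>auto simp: simps\<close>)
  moreover have "?V 1 2 0 - ?V 2 1 0 = ?l 1 1 0 *\<^sub>R (axis j 1 - axis i 1)"
    by (rule vertex_jump_push) (use ne in \<open>auto simp: simps\<close>)
  moreover have "?V 2 1 0 - ?V 2 0 1 = ?l 1 0 0 *\<^sub>R (axis j 1 - axis k 1)"
    by (rule vertex_jump_push) (use ne in \<open>auto simp: simps\<close>)
  moreover have "?V 2 0 1 - ?V 1 0 2 = ?l 1 0 1 *\<^sub>R (axis i 1 - axis k 1)"
    by (rule vertex_jump_push) (use ne in \<open>auto simp: simps\<close>)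
  moreover have "(?V 1 0 2 - ?V 0 1 2) + (?V 0 1 2 - ?V 0 2 1) + (?V 0 2 1 - ?V 1 2 0) + (?V 1 2 0 - ?V 2 1 0)
      + (?V 2 1 0 - ?V 2 0 1) + (?V 2 0 1 - ?V 1 0 2) = 0" by simp
  ultimately have "?l 0 0 1 *\<^sub>R (axis i 1 - axis j 1) + ?l 0 1 1 *\<^sub>R (axis k 1 - axis j 1) +
      ?l 0 1 0 *\<^sub>R (axis k 1 - axis i 1) + ?l 1 1 0 *\<^sub>R (axis j 1 - axis i 1) +
      ?l 1 0 0 *\<^sub>R (axis j 1 - axis k 1) + ?l 1 0 1 *\<^sub>R (axis i 1 - axis k 1) = (0 :: real ^ 'v)"
    (is "?sum = 0") by (simp only:)
  \<comment> \<open>Coordinate \<open>j\<close> sees just the two opposite pairs of walls over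
    \<open>{i, j}\<close> and \<open>{j, k}\<close>.\<close>
  then have "?sum $ j = 0" by simp
  then have "- ?l 0 0 1 - ?l 0 1 1 + ?l 1 1 0 + ?l 1 0 0 = 0" using ne by (simp add: axis_def)
  then have eq: "?L 0 0 1 - ?L 1 1 0 = ?L 1 0 0 - ?L 0 1 1"
    by (simp add: field_simps)
  have s1: "same_sides E (push E m (?d 0 0 1)) c"
    by (rule same_sides_push[OF n(1)]) (use ne c in \<open>auto simp: simps\<close>)
  have s2: "same_sides E (push E m (?d 1 1 0)) c'"
    by (rule same_sides_push[OF n(2)]) (use ne c in \<open>auto simp: simps\<close>)
  have s3: "same_sides E (push E m (?d 1 0 0)) d"
    by (rule same_sides_push[OF n(3)]) (use ne d in \<open>auto simp: simps\<close>)
  have s4: "same_sides E (push E m (?d 0 1 1)) d'"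
    by (rule same_sides_push[OF n(4)]) (use ne d in \<open>auto simp: simps\<close>)
  show ?thesis
    using eq by (simp only: s1[THEN max_face_Q_cong] s2[THEN max_face_Q_cong] s3[THEN max_face_Q_cong] s4[THEN max_face_Q_cong])
qed

lemma length_system_Q:
  assumes "\<not> (\<exists>K. card K = 4 \<and> clique E K)"
  shows "length_system E (\<lambda>c. diameter (max_face Q c))"
proof unfold_locales
  show "\<not> (\<exists>K. card K = 4 \<and> clique E K)" by fact
  show "0 \<le> diameter (max_face Q c)" for c
    using bounded_subset[OF polytope_imp_bounded[OF polytope_Q] max_face_subset] by (intro diameter_ge_0)
  show "diameter (max_face Q c) = diameter (max_face Q c')" if "same_sides E c c'" for c c'
    using max_face_Q_cong[OF that] by simp
  show "diameter (max_face Q c) = diameter (max_face Q c')"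
    if "a \<noteq> b" "tight E m = {a, b}" "near E m c" "near E m c'" "tight E c = {a}" "tight E c' = {a}" for a b m c c'
    using that by (intro parallelogram_Q)
  show "diameter (max_face Q c) - diameter (max_face Q c') = diameter (max_face Q d) - diameter (max_face Q d')"
    if "{i, j, k} \<in> triangles E" "tight E m = {{i, j}, {i, k}, {j, k}}"
      "near E m c" "near E m c'" "near E m d" "near E m d'"
      "c $ i = c $ j" "c $ i < c $ k" "c' $ i = c' $ j" "c' $ k < c' $ i"
      "d $ j = d $ k" "d $ j < d $ i" "d' $ j = d' $ k" "d' $ i < d' $ j" for i j k m c c' d d'
    using that by (rule hexagon_Q)
qed

end

text \<open>Each swap moves the vertices of both polytopes by the same vector, so their difference
  is the same for all orders. Matching maximizers in every direction then give both
  inclusions.\<close>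

lemma (in simple_graph) deformation_eq_translate:
  assumes Q: "deformation_of Q Z" and R: "deformation_of R Z"
    and L: "\<And>c a. tight E c = {a} \<Longrightarrow> diameter (max_face Q c) = diameter (max_face R c)"
  shows "\<exists>t. Q = (+) t ` R"
proof -
  interpret Q: zonotope_deformation E Q by unfold_locales (rule Q)
  interpret R: zonotope_deformation E R by unfold_locales (rule R)
  let ?v = "\<lambda>f. (\<chi> i. f i) :: real ^ 'v"
  let ?\<Phi> = "\<lambda>f. Q.vertex (?v f) - R.vertex (?v f)"
  have const: "?\<Phi> f = ?\<Phi> g" if fg: "inj f" "inj g" for f g :: "'v \<Rightarrow> real"
  proof (rule swaps_connect[of UNIV ?\<Phi>])
    fix f g :: "'v \<Rightarrow> real" assume "\<forall>x\<in>UNIV. \<forall>y\<in>UNIV. f x < f y \<longleftrightarrow> g x < g y"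
    then have "same_sides E (?v f) (?v g)" by (simp add: same_sides_def)
    then show "?\<Phi> f = ?\<Phi> g" using Q.vertex_cong R.vertex_cong by metis
  next
    fix f g h :: "'v \<Rightarrow> real" and u v
    assume fg: "inj f" "inj g" and uv: "u \<noteq> v" "h u = h v"
      and h1: "\<forall>x\<in>UNIV. \<forall>y\<in>UNIV. h x = h y \<longrightarrow> x = y \<or> {x, y} = {u, v}"
      and h2: "\<forall>x\<in>UNIV. \<forall>y\<in>UNIV. h x < h y \<longrightarrow> f x < f y \<and> g x < g y"
      and lt: "g u < g v" "f v < f u"
    have n: "near E (?v h) (?v f)" "near E (?v h) (?v g)" using h2 by (auto simp: near_def)
    show "?\<Phi> f = ?\<Phi> g"
    proof (cases "{u, v} \<in> E")
      case True
      have m: "tight E (?v h) = {{u, v}}"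
      proof (rule tight_eqI)
        fix x y assume xy: "{x, y} \<in> E"
        show "?v h $ x = ?v h $ y \<longleftrightarrow> {x, y} \<in> {{u, v}}"
          using h1 uv edge_neq[OF xy] by (auto simp: doubleton_eq_iff)
      qed (use True in auto)
      have "Q.vertex (?v f) - Q.vertex (?v g) = R.vertex (?v f) - R.vertex (?v g)"
        using Q.vertex_jump[OF m n(1) _ n(2)] R.vertex_jump[OF m n(1) _ n(2)] lt L[OF m] by simp
      then show ?thesis by (simp add: algebra_simps)
    next
      case False
      have "same_sides E (?v f) (?v g)"
      proof (rule same_sidesI_near[OF n])
        fix x y assume "{x, y} \<in> E" "?v h $ x = ?v h $ y"
        then show "?v f $ x < ?v f $ y \<longleftrightarrow> ?v g $ x < ?v g $ y"
          using h1 False edge_neq[of x y] by (metis UNIV_I vec_lambda_beta)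
      qed
      then show ?thesis using Q.vertex_cong R.vertex_cong by metis
    qed
  qed (simp_all add: that)
  obtain f0 :: "'v \<Rightarrow> real" where f0: "inj f0"
    using injective_perturbation[of "UNIV :: 'v set" "\<lambda>_. 0"] by auto
  define t where "t = ?\<Phi> f0"
  have vertices: "\<exists>q r. q \<in> max_face Q c \<and> r \<in> max_face R c \<and> q = t + r" for c
  proof -
    obtain f :: "'v \<Rightarrow> real" where f: "inj f" "\<And>x y. c $ x < c $ y \<Longrightarrow> f x < f y"
      using injective_perturbation[of "UNIV :: 'v set" "\<lambda>x. c $ x"] by auto
    have n: "near E c (?v f)" using f(2) by (simp add: near_def)
    have "Q.vertex (?v f) = t + R.vertex (?v f)" using const[OF f0 f(1)] by (simp add: t_def algebra_simps)
    then show ?thesis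
      using Q.max_face_near_subset[OF n] R.max_face_near_subset[OF n] Q.vertex_mem R.vertex_mem by blast
  qed
  \<comment> \<open>A point of \<open>A\<close> outside the translate of \<open>B\<close> can be
    separated from it; in the separating direction the paired maximizers are contradictory.\<close>
  have sub: "A \<subseteq> (+) s ` B"
    if B: "polytope B" and v: "\<And>c. \<exists>q r. q \<in> max_face A c \<and> r \<in> max_face B c \<and> q = s + r" for A B and s :: "real ^ 'v"
  proof
    fix x assume x: "x \<in> A"
    have "x - s \<in> B"
    proof (rule ccontr)
      assume "x - s \<notin> B"
      then obtain a b where ab: "a \<bullet> (x - s) < b" "\<forall>y\<in>B. a \<bullet> y > b"
        using separating_hyperplane_closed_point[of B "x - s"] polytope_imp_convex polytope_imp_closed B by blast
      obtain q r where qr: "q \<in> max_face A (- a)" "r \<in> max_face B (- a)" "q = s + r" using v by blast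
      have "x \<bullet> (- a) \<le> q \<bullet> (- a)" using qr(1) x by (simp add: max_face_def)
      moreover have "b < a \<bullet> r" using ab qr(2) by (auto simp: max_face_def)
      ultimately show False using ab(1) qr(3) by (simp add: inner_diff_right inner_commute inner_add_left inner_add_right)
    qed
    then show "x \<in> (+) s ` B" by (intro image_eqI[of _ _ "x - s"]) auto
  qed
  have "Q \<subseteq> (+) t ` R" by (rule sub[OF R.polytope_Q vertices])
  moreover have "R \<subseteq> (+) (- t) ` Q"
    by (rule sub[OF Q.polytope_Q]) (use vertices in \<open>force simp: algebra_simps\<close>)
  then have "(+) t ` R \<subseteq> Q" by auto
  ultimately show ?thesis by blast
qed

section \<open>Edge lengths of weighted sums\<close>

text \<open>Faces in wall directions are of this form, with common direction \<open>u\<close>;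
  starting points and lengths add under Minkowski sums.\<close>

definition seg :: "'a::real_vector \<Rightarrow> real \<Rightarrow> 'a \<Rightarrow> 'a set" where
  "seg p l u = (\<lambda>s. p + s *\<^sub>R u) ` {0..l}"

lemma seg_0: "seg p 0 u = {p}"
  by (simp add: seg_def)

lemma seg_plus:
  assumes "0 \<le> l" "0 \<le> k" shows "seg p l u + seg q k u = seg (p + q) (l + k) u"
proof
  show "seg p l u + seg q k u \<subseteq> seg (p + q) (l + k) u"
  proof
    fix x assume "x \<in> seg p l u + seg q k u"
    then obtain s t where st: "s \<in> {0..l}" "t \<in> {0..k}" "x = (p + s *\<^sub>R u) + (q + t *\<^sub>R u)"
      by (auto simp: seg_def elim!: set_plus_elim)
    then have "x = (p + q) + (s + t) *\<^sub>R u" by (simp add: algebra_simps)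
    then show "x \<in> seg (p + q) (l + k) u" using st by (auto simp: seg_def)
  qed
  show "seg (p + q) (l + k) u \<subseteq> seg p l u + seg q k u"
  proof
    fix x assume "x \<in> seg (p + q) (l + k) u"
    then obtain s where s: "s \<in> {0..l + k}" "x = p + q + s *\<^sub>R u" by (auto simp: seg_def)
    \<comment> \<open>Greedy splitting of the parameter: the first segment is used up before the
      second.\<close>
    have "x = (p + min s l *\<^sub>R u) + (q + (s - min s l) *\<^sub>R u)"
      using s by (simp add: algebra_simps)
    moreover have "min s l \<in> {0..l}" "s - min s l \<in> {0..k}" using s assms by auto
    ultimately show "x \<in> seg p l u + seg q k u" unfolding seg_def by blast
  qed
qed

lemma seg_sum:
  assumes "finite I" "\<And>i. i \<in> I \<Longrightarrow> 0 \<le> l i"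
  shows "(\<Sum>i\<in>I. seg (p i) (l i) u) = seg (\<Sum>i\<in>I. p i) (\<Sum>i\<in>I. l i) u"
  using assms by (induction I rule: finite_induct) (simp_all add: seg_0 seg_plus sum_nonneg)

lemma diameter_seg:
  fixes u :: "'a::real_normed_vector"
  assumes "0 \<le> l" shows "diameter (seg p l u) = l * norm u"
proof (rule antisym)
  have n: "norm ((p + s *\<^sub>R u) - (p + t *\<^sub>R u)) = \<bar>s - t\<bar> * norm u" for s t
    by (simp add: scaleR_diff_left[symmetric])
  show "diameter (seg p l u) \<le> l * norm u"
  proof (rule diameter_le)
    fix x y assume "x \<in> seg p l u" "y \<in> seg p l u"
    then obtain s t where st: "x = p + s *\<^sub>R u" "y = p + t *\<^sub>R u" "s \<in> {0..l}" "t \<in> {0..l}"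
      unfolding seg_def by blast
    then have "\<bar>s - t\<bar> \<le> l" by auto
    then show "norm (x - y) \<le> l * norm u" unfolding st n by (simp add: mult_right_mono)
  qed (use assms in \<open>auto simp: seg_def\<close>)
  have "compact (seg p l u)" unfolding seg_def
    by (intro compact_continuous_image continuous_intros) auto
  then have "bounded (seg p l u)" by (rule compact_imp_bounded)
  moreover have "p + l *\<^sub>R u \<in> seg p l u" "p + 0 *\<^sub>R u \<in> seg p l u" using assms unfolding seg_def by (auto intro!: imageI)
  ultimately have "dist (p + l *\<^sub>R u) (p + 0 *\<^sub>R u) \<le> diameter (seg p l u)" by (intro diameter_bounded_bound)
  then show "l * norm u \<le> diameter (seg p l u)" using assms by (simp add: dist_norm)
qed

lemma dilate_singleton: "dilate r {x} = {r *\<^sub>R x}"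
  by (simp add: dilate_def)

lemma dilate_seg: "0 < r \<Longrightarrow> dilate r (seg p l u) = seg (r *\<^sub>R p) (r * l) u"
proof -
  assume r: "0 < r"
  have "dilate r (seg p l u) = (\<lambda>s. r *\<^sub>R p + s *\<^sub>R u) ` ((*) r ` {0..l})"
    by (simp add: dilate_def seg_def image_image scaleR_add_right)
  also have "(*) r ` {0..l} = {0..r * l}" using r by simp
  finally show ?thesis by (simp add: seg_def)
qed

lemma dilate_minus_seg: "dilate (-1) (seg p l u) = seg (- p - l *\<^sub>R u) l u"
proof -
  have "dilate (-1) (seg p l u) = (\<lambda>s. (- p - l *\<^sub>R u) + s *\<^sub>R u) ` ((\<lambda>s. l - s) ` {0..l})"
    unfolding dilate_def seg_def image_image by (intro image_cong) (simp_all add: algebra_simps)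
  also have "(\<lambda>s. l - s) ` {0..l} = {0..l}" by simp
  finally show ?thesis by (simp add: seg_def)
qed

lemma dilate_dilate: "dilate r (dilate s A) = dilate (r * s) A"
  by (simp add: dilate_def image_image)

lemma simplex_on_pair_seg: "i \<noteq> j \<Longrightarrow> simplex_on {i, j} = seg (axis j 1) 1 (axis i 1 - axis j 1)"
  unfolding simplex_on_def by (simp add: insert_commute[of "axis i 1"] convex_hull_insert_segments
      closed_segment_image_interval seg_def algebra_simps segment_convex_hull[symmetric])

text \<open>A reflection of the segment changes only its starting point, whence the absolute
  value.\<close>

lemma dilate_pair_seg:
  assumes "i \<noteq> j" shows "\<exists>p. dilate r (simplex_on {i, j}) = seg p \<bar>r\<bar> (axis i 1 - axis j 1)"
proof -
  consider "r = 0" | "0 < r" | "r < 0" by linarith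
  then show ?thesis
  proof cases
    case 1
    then have "dilate r (simplex_on {i, j}) = {0}"
      using simplex_on_nonempty[of "{i, j}"] by (auto simp: dilate_def)
    then show ?thesis using 1 by (auto simp: seg_0)
  next
    case 2
    then have "dilate r (simplex_on {i, j}) = seg (r *\<^sub>R axis j 1) \<bar>r\<bar> (axis i 1 - axis j 1)"
      by (simp add: simplex_on_pair_seg[OF assms] dilate_seg)
    then show ?thesis ..
  next
    case 3
    have "dilate r (simplex_on {i, j}) = dilate (- r) (dilate (-1) (simplex_on {i, j}))"
      by (simp add: dilate_dilate)
    also have "\<dots> = seg ((- r) *\<^sub>R (- axis j 1 - 1 *\<^sub>R (axis i 1 - axis j 1))) (- r * 1) (axis i 1 - axis j 1)"
      using 3 unfolding simplex_on_pair_seg[OF assms] dilate_minus_seg by (intro dilate_seg) simp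
    finally show ?thesis using 3 by (intro exI) simp
  qed
qed

lemma diameter_translation: "diameter ((+) a ` S) = diameter (S :: 'a::real_normed_vector set)"
proof -
  have "(+) a ` S \<times> (+) a ` S = (\<lambda>(x, y). (a + x, a + y)) ` (S \<times> S)" by (auto simp: image_iff)
  then show ?thesis by (auto simp: diameter_def image_image split_beta intro!: arg_cong[where f = Sup])
qed

lemma translation_class_translation: "translation_class ((+) a ` Q) = translation_class (Q :: 'a::real_vector set)"
proof -
  have 1: "(+) b ` (+) a ` Q = (+) (b + a) ` Q" "(+) b ` Q = (+) (b - a) ` (+) a ` Q" for b
    by (simp_all add: image_image add.assoc)
  show ?thesis unfolding translation_class_def
  proof (intro set_eqI iffI)
    fix X assume "X \<in> {(+) b ` (+) a ` Q | b. True}"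
    then show "X \<in> {(+) b ` Q | b. True}" using 1(1) by auto
  next
    fix X assume "X \<in> {(+) b ` Q | b. True}"
    then show "X \<in> {(+) b ` (+) a ` Q | b. True}" using 1(2) by blast
  qed
qed

lemma lookup_scaleR: "Poly_Mapping.lookup (r *\<^sub>R l) x = r *\<^sub>R Poly_Mapping.lookup (l :: 'b \<Rightarrow>\<^sub>0 real) x"
proof -
  have "finite {i. r *\<^sub>R Poly_Mapping.lookup l i \<noteq> 0}"
    by (rule finite_subset[OF _ finite_keys[of l]]) (auto simp: in_keys_iff)
  then show ?thesis unfolding scaleR_poly_mapping_def by (subst lookup_Abs_poly_mapping) auto
qed

section \<open>Lengths of the faces of weighted sums in wall directions\<close>

context simple_graph
begin

text \<open>Two maximizers in \<open>s\<close> would be tied along an edge, and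
  \<open>{i, j}\<close> is the only tied edge.\<close>

lemma argmax_wall:
  assumes c: "tight E c = {{i, j}}" and s: "s \<in> E \<union> triangles E" and r: "r \<noteq> 0"
  shows "argmax s (r *\<^sub>R c) = {i, j} \<or> (\<exists>x. argmax s (r *\<^sub>R c) = {x})"
proof -
  let ?A = "argmax s (r *\<^sub>R c)"
  have two: "{x, y} = {i, j}" if "x \<in> ?A" "y \<in> ?A" "x \<noteq> y" for x y
  proof -
    have "(r *\<^sub>R c) $ x \<le> (r *\<^sub>R c) $ y" "(r *\<^sub>R c) $ y \<le> (r *\<^sub>R c) $ x" using that by (auto simp: argmax_def)
    then have "c $ x = c $ y" using r by simp
    moreover have "x \<in> s" "y \<in> s" using that by (auto simp: argmax_def)
    then have "{x, y} \<in> E" using that clique_cells[OF s] by (auto simp: clique_def)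
    ultimately show ?thesis using c tight_pair[of x y E c] by auto
  qed
  obtain x where x: "x \<in> ?A" using argmax_nonempty[OF cells_nonempty[OF s]] by blast
  show ?thesis
  proof (cases "?A = {x}")
    case False
    then obtain y where y: "y \<in> ?A" "x \<noteq> y" using x by blast
    then have "{x, y} = {i, j}" using two x by blast
    moreover have "?A \<subseteq> {i, j}" using two x y by (metis insertCI subsetI)
    ultimately show ?thesis using x y by blast
  qed blast
qed

text \<open>For \<open>w s = 0\<close> the argmax is all of \<open>s\<close>, but the value is 0 in
  either case.\<close>

definition cell_length :: "('v set \<Rightarrow> real) \<Rightarrow> 'v \<Rightarrow> 'v \<Rightarrow> real ^ 'v \<Rightarrow> 'v set \<Rightarrow> real" where
  "cell_length w i j c s = (if argmax s (w s *\<^sub>R c) = {i, j} then \<bar>w s\<bar> else 0)"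

lemma diameter_max_face_weighted_sum:
  assumes c: "tight E c = {{i, j}}"
  shows "diameter (max_face (weighted_sum w) c) = sqrt 2 * (\<Sum>s\<in>E \<union> triangles E. cell_length w i j c s)"
proof -
  let ?u = "axis i 1 - axis j 1 :: real ^ 'v" and ?K = "E \<union> triangles E"
  have ij: "i \<noteq> j" using c tight_subset[of E c] edge_neq by blast
  have "\<exists>p. dilate (w s) (simplex_on (argmax s (w s *\<^sub>R c))) = seg p (cell_length w i j c s) ?u" if s: "s \<in> ?K" for s
  proof (cases "w s = 0")
    case True
    have "dilate 0 (simplex_on (argmax s (0::real ^ 'v))) = {0}"
      using simplex_on_nonempty[OF argmax_nonempty[OF cells_nonempty[OF s]], of 0] by (auto simp: dilate_def)
    then show ?thesis using True by (auto simp: cell_length_def seg_0)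
  next
    case False
    consider "argmax s (w s *\<^sub>R c) = {i, j}" | x where "argmax s (w s *\<^sub>R c) = {x}"
      using argmax_wall[OF c s False] by blast
    then show ?thesis
    proof cases
      case 1
      then show ?thesis using dilate_pair_seg[OF ij] by (simp add: cell_length_def)
    next
      case 2
      then have "argmax s (w s *\<^sub>R c) \<noteq> {i, j}" using ij by auto
      then have "cell_length w i j c s = 0" by (simp add: cell_length_def)
      then show ?thesis using 2 by (simp add: seg_0 simplex_on_singleton dilate_singleton)
    qed
  qed
  then obtain p where p: "\<And>s. s \<in> ?K \<Longrightarrow> dilate (w s) (simplex_on (argmax s (w s *\<^sub>R c))) = seg (p s) (cell_length w i j c s) ?u"
    by metis
  have nn: "0 \<le> cell_length w i j c s" for s by (simp add: cell_length_def)
  have "max_face (weighted_sum w) c = seg (\<Sum>s\<in>?K. p s) (\<Sum>s\<in>?K. cell_length w i j c s) ?u"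
    unfolding max_face_weighted_sum using p nn by (simp add: seg_sum[symmetric])
  moreover have "norm ?u = sqrt 2" by (rule norm_edge_dir[OF ij])
  ultimately show ?thesis using nn by (simp add: diameter_seg sum_nonneg)
qed

text \<open>Contributions come from the edge itself and from the triangles over it whose third
  vertex is on the side picked by the sign of the weight. Nonnegativity is needed to drop the
  absolute value at the edge.\<close>

lemma sum_cell_length:
  assumes c: "tight E c = {{i, j}}" and w: "\<forall>e\<in>E. 0 \<le> w e"
  shows "sqrt 2 * (\<Sum>s\<in>E \<union> triangles E. cell_length w i j c s) = edge_length w i j c"
proof -
  have e: "{i, j} \<in> E" "c $ i = c $ j" using c tight_pair[of i j E c] by auto
  then have ij: "i \<noteq> j" using edge_neq by blast
  let ?l = "cell_length w i j c" and ?K = "{k. {i, j, k} \<in> triangles E}"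
  have "(\<Sum>s\<in>E. ?l s) = (\<Sum>s\<in>E. if s = {i, j} then w {i, j} else 0)"
  proof (rule sum.cong)
    fix s assume s: "s \<in> E"
    have "argmax s (w s *\<^sub>R c) = {i, j} \<longrightarrow> s = {i, j}"
      using s e simple by (metis (no_types, lifting) argmax_def card_subset_eq finite mem_Collect_eq subsetI)
    moreover have "argmax {i, j} (w {i, j} *\<^sub>R c) = {i, j}" using e by (simp add: argmax_pair)
    ultimately show "?l s = (if s = {i, j} then w {i, j} else 0)" using w s by (auto simp: cell_length_def)
  qed simp
  then have 1: "(\<Sum>s\<in>E. ?l s) = w {i, j}" using e by simp
  have inj: "inj_on (\<lambda>k. {i, j, k}) ?K"
    by (rule inj_onI) (auto simp: triangles_pairs)
  have "(\<Sum>s\<in>triangles E. ?l s) = (\<Sum>s\<in>(\<lambda>k. {i, j, k}) ` ?K. ?l s)"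
  proof (rule sum.mono_neutral_right)
    show "\<forall>s\<in>triangles E - (\<lambda>k. {i, j, k}) ` ?K. ?l s = 0"
    proof
      fix s assume s: "s \<in> triangles E - (\<lambda>k. {i, j, k}) ` ?K"
      have "argmax s (w s *\<^sub>R c) \<noteq> {i, j}"
      proof
        assume "argmax s (w s *\<^sub>R c) = {i, j}"
        then have sub: "{i, j} \<subseteq> s" by (auto simp: argmax_def)
        have "card s = 3" using s by (simp add: triangles_def)
        then have "card (s - {i, j}) = 1" using sub ij by (simp add: card_Diff_subset)
        then obtain k where "s - {i, j} = {k}" by (auto simp: card_1_singleton_iff)
        then have "s = {i, j, k}" using sub by auto
        then show False using s by auto
      qed
      then show "?l s = 0" by (simp add: cell_length_def)
    qed
  qed auto
  also have "\<dots> = (\<Sum>k\<in>?K. ?l {i, j, k})" by (simp add: sum.reindex[OF inj])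
  also have "\<dots> = (\<Sum>k\<in>?K. if c $ i < c $ k then max 0 (- w {i, j, k}) else max 0 (w {i, j, k}))"
  proof (rule sum.cong)
    fix k assume k: "k \<in> ?K"
    then have kij: "k \<noteq> i" "k \<noteq> j" "{i, k} \<in> E" by (auto simp: triangles_pairs)
    then have "{i, k} \<notin> tight E c" using c by (auto simp: doubleton_eq_iff)
    then have ck: "c $ i \<noteq> c $ k" using kij by (simp add: tight_pair)
    have "argmax {i, j, k} (r *\<^sub>R c) = {i, j} \<longleftrightarrow> r * c $ k < r * c $ i" for r :: real
    proof -
      let ?A = "argmax {i, j, k} (r *\<^sub>R c)"
      have "i \<in> ?A \<longleftrightarrow> r * c $ k \<le> r * c $ i" "j \<in> ?A \<longleftrightarrow> r * c $ k \<le> r * c $ i"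
        "k \<in> ?A \<longleftrightarrow> r * c $ i \<le> r * c $ k"
        using e by (simp_all add: argmax_def)
      moreover have "?A \<subseteq> {i, j, k}" by (auto simp: argmax_def)
      ultimately show ?thesis using kij by (cases "r * c $ k < r * c $ i") auto
    qed
    then show "?l {i, j, k} = (if c $ i < c $ k then max 0 (- w {i, j, k}) else max 0 (w {i, j, k}))"
      using ck by (auto simp: cell_length_def mult_less_cancel_left)
  qed simp
  finally have 2: "(\<Sum>s\<in>triangles E. ?l s) = (\<Sum>k\<in>?K. if c $ i < c $ k then max 0 (- w {i, j, k}) else max 0 (w {i, j, k}))" .
  have "(\<Sum>s\<in>E \<union> triangles E. ?l s) = (\<Sum>s\<in>E. ?l s) + (\<Sum>s\<in>triangles E. ?l s)"
    using edges_triangles_disjoint by (intro sum.union_disjoint) auto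
  then show ?thesis by (simp add: 1 2 edge_length_def)
qed

section \<open>The edge length vector\<close>

lemma finite_zonotope_edges: "finite {e. e edge_of Z}"
  using finite_polytope_faces[OF polytope_zonotope] by (rule rev_finite_subset) (auto simp: edge_of_def)

lemma lookup_edge_lengths_of:
  "Poly_Mapping.lookup (edge_lengths_of Z Q) e =
    (if e edge_of Z then diameter (max_face Q (SOME c. max_face Z c = e)) else 0)"
proof -
  have "finite {e. (if e edge_of Z then diameter (max_face Q (SOME c. max_face Z c = e)) else 0) \<noteq> 0}"
    by (rule finite_subset[OF _ finite_zonotope_edges]) (metis (mono_tags, lifting) mem_Collect_eq subsetI)
  then show ?thesis unfolding edge_lengths_of_def by (subst lookup_Abs_poly_mapping) simp_all
qed

lemma keys_edge_lengths_of: "Poly_Mapping.keys (edge_lengths_of Z Q) \<subseteq> {e. e edge_of Z}"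
  by (metis (mono_tags, lifting) in_keys_iff lookup_edge_lengths_of mem_Collect_eq subsetI)

text \<open>The direction chosen in \<open>edge_lengths_of\<close> lies in the cell of
  \<open>c\<close>, where the maximal face of a deformation does not change.\<close>

lemma lookup_edge_lengths_of_max_face:
  assumes "deformation_of Q Z" "tight E c = {a}"
  shows "Poly_Mapping.lookup (edge_lengths_of Z Q) (max_face Z c) = diameter (max_face Q c)"
proof -
  have "max_face Z (SOME c'. max_face Z c' = max_face Z c) = max_face Z c"
    by (rule someI[of "\<lambda>c'. max_face Z c' = max_face Z c"]) simp
  then have "same_sides E (SOME c'. max_face Z c' = max_face Z c) c"
    by (simp add: max_face_zonotope_eq_iff)
  then have "max_face Q (SOME c'. max_face Z c' = max_face Z c) = max_face Q c"
    using assms(1) by (simp add: deformation_of_zonotope_iff)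
  moreover have "max_face Z c edge_of Z" using assms(2) edge_of_zonotope_iff by blast
  ultimately show ?thesis by (simp add: lookup_edge_lengths_of)
qed

lemma edge_vector_eqI:
  assumes "Poly_Mapping.keys l \<subseteq> {e. e edge_of Z}" "Poly_Mapping.keys l' \<subseteq> {e. e edge_of Z}"
    and "\<And>c i j. tight E c = {{i, j}} \<Longrightarrow>
      Poly_Mapping.lookup l (max_face Z c) = Poly_Mapping.lookup l' (max_face Z c)"
  shows "l = l'"
proof (rule poly_mapping_eqI)
  fix e show "Poly_Mapping.lookup l e = Poly_Mapping.lookup l' e"
  proof (cases "e edge_of Z")
    case True
    then obtain c a where c: "tight E c = {a}" "e = max_face Z c" unfolding edge_of_zonotope_iff by blast
    then have "a \<in> E" using tight_subset by blast
    then obtain i j where "a = {i, j}" by (elim edgeE)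
    then show ?thesis using c assms(3) by simp
  next
    case False
    then have "e \<notin> Poly_Mapping.keys l" "e \<notin> Poly_Mapping.keys l'" using assms by auto
    then show ?thesis by (simp add: in_keys_iff)
  qed
qed

lemma edge_lengths_of_translation: "edge_lengths_of Z ((+) a ` Q) = edge_lengths_of Z Q"
  by (simp add: edge_lengths_of_def max_face_translation diameter_translation cong: if_cong)

lemma edge_lengths_translation_class: "edge_lengths Z (translation_class Q) = edge_lengths_of Z Q"
proof -
  have "edge_lengths_of Z ` translation_class Q = {edge_lengths_of Z Q}"
  proof -
    have "Q = (+) 0 ` Q" by simp
    then have "Q \<in> translation_class Q" unfolding translation_class_def by blast
    then show ?thesis by (auto simp: translation_class_def edge_lengths_of_translation)
  qed
  then show ?thesis by (simp add: edge_lengths_def)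
qed

section \<open>Linear coordinates for length vectors\<close>

definition length_vector :: "('v set \<Rightarrow> real) \<Rightarrow> (real ^ 'v) set \<Rightarrow>\<^sub>0 real" where
  "length_vector w = edge_lengths_of Z (weighted_sum w)"

lemma lookup_length_vector:
  assumes "tight E c = {{i, j}}" "\<forall>e\<in>E. 0 \<le> w e"
  shows "Poly_Mapping.lookup (length_vector w) (max_face Z c) = edge_length w i j c"
  unfolding length_vector_def
  by (simp only: lookup_edge_lengths_of_max_face[OF deformation_weighted_sum assms(1)]
    diameter_max_face_weighted_sum[OF assms(1)] sum_cell_length[OF assms])

definition basis_vector :: "'v set \<Rightarrow> (real ^ 'v) set \<Rightarrow>\<^sub>0 real" where
  "basis_vector s = length_vector (\<lambda>x. if x = s then 1 else 0)"

lemma lookup_basis_vector: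
  assumes c: "tight E c = {{i, j}}" and s: "s \<in> E \<union> triangles E"
  shows "Poly_Mapping.lookup (basis_vector s) (max_face Z c) =
    (if s = {i, j} \<or> (\<exists>k. {i, j, k} \<in> triangles E \<and> s = {i, j, k} \<and> \<not> c $ i < c $ k) then sqrt 2 else 0)"
proof -
  have e: "{i, j} \<in> E" using c tight_subset[of E c] by auto
  let ?w = "\<lambda>x. if x = s then 1 else 0 :: real" and ?K = "{k. {i, j, k} \<in> triangles E}"
  have l: "Poly_Mapping.lookup (basis_vector s) (max_face Z c) = edge_length ?w i j c"
    unfolding basis_vector_def by (rule lookup_length_vector[OF c]) auto
  have neq: "{i, j, k} \<noteq> e'" if "e' \<in> E" "{i, j, k} \<in> triangles E" for k e'
    using that edges_triangles_disjoint by blast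
  show ?thesis
  proof (cases "\<exists>k. {i, j, k} \<in> triangles E \<and> s = {i, j, k}")
    case True
    then obtain k where k: "{i, j, k} \<in> triangles E" "s = {i, j, k}" by blast
    have eqk: "{i, j, k'} = s \<longleftrightarrow> k' = k" if "{i, j, k'} \<in> triangles E" for k'
      using that k by (auto simp: triangles_pairs)
    have "(\<Sum>k'\<in>?K. if c $ i < c $ k' then max 0 (- ?w {i, j, k'}) else max 0 (?w {i, j, k'})) =
        (\<Sum>k'\<in>?K. if k' = k then (if c $ i < c $ k then 0 else 1) else 0)"
    proof (rule sum.cong)
      fix k' assume "k' \<in> ?K"
      then have "{i, j, k'} = s \<longleftrightarrow> k' = k" by (simp add: eqk)
      then show "(if c $ i < c $ k' then max 0 (- ?w {i, j, k'}) else max 0 (?w {i, j, k'})) =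
          (if k' = k then (if c $ i < c $ k then 0 else 1) else 0)" by (cases "k' = k") simp_all
    qed simp
    also have "\<dots> = (if c $ i < c $ k then 0 else 1)" using k by simp
    finally have sum: "(\<Sum>k'\<in>?K. if c $ i < c $ k' then max 0 (- ?w {i, j, k'}) else max 0 (?w {i, j, k'})) =
        (if c $ i < c $ k then 0 else 1)" .
    have "?w {i, j} = 0" using neq[OF e k(1)] k(2) by auto
    then have "edge_length ?w i j c = (if c $ i < c $ k then 0 else sqrt 2)"
      unfolding edge_length_def sum by simp
    moreover have "(\<exists>k'. {i, j, k'} \<in> triangles E \<and> s = {i, j, k'} \<and> \<not> c $ i < c $ k') \<longleftrightarrow> \<not> c $ i < c $ k"
      using k eqk by metis
    ultimately show ?thesis using neq[OF e k(1)] k(2) l by simp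
  next
    case False
    have "(\<Sum>k'\<in>?K. if c $ i < c $ k' then max 0 (- ?w {i, j, k'}) else max 0 (?w {i, j, k'})) = 0"
      using False by (intro sum.neutral) auto
    then have "edge_length ?w i j c = sqrt 2 * ?w {i, j}"
      unfolding edge_length_def by simp
    then show ?thesis using False l by auto
  qed
qed

lemma keys_length_vector: "Poly_Mapping.keys (length_vector w) \<subseteq> {e. e edge_of Z}"
  unfolding length_vector_def by (rule keys_edge_lengths_of)

text \<open>Linear extension from the simplices \<Delta>_s. It gives the length vector of a weighted
  sum if all weights are nonnegative; a negative coefficient here is a formal Minkowski difference,
  not a reflection.\<close>

definition lin :: "('v set \<Rightarrow> real) \<Rightarrow> (real ^ 'v) set \<Rightarrow>\<^sub>0 real" where
  "lin x = (\<Sum>s\<in>E \<union> triangles E. x s *\<^sub>R basis_vector s)"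

lemma keys_lin: "Poly_Mapping.keys (lin x) \<subseteq> {e. e edge_of Z}"
proof
  fix e assume "e \<in> Poly_Mapping.keys (lin x)"
  then have "(\<Sum>s\<in>E \<union> triangles E. x s * Poly_Mapping.lookup (basis_vector s) e) \<noteq> 0"
    by (simp add: in_keys_iff lin_def lookup_sum lookup_scaleR)
  then obtain s where "x s * Poly_Mapping.lookup (basis_vector s) e \<noteq> 0"
    by (rule sum.not_neutral_contains_not_neutral)
  then have "Poly_Mapping.lookup (basis_vector s) e \<noteq> 0" by simp
  then have "e \<in> Poly_Mapping.keys (basis_vector s)" by (simp add: in_keys_iff)
  then show "e \<in> {e. e edge_of Z}" using keys_length_vector unfolding basis_vector_def by blast
qed

lemma lookup_lin:
  assumes c: "tight E c = {{i, j}}"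
  shows "Poly_Mapping.lookup (lin x) (max_face Z c) =
    sqrt 2 * (x {i, j} + (\<Sum>k | {i, j, k} \<in> triangles E. if c $ i < c $ k then 0 else x {i, j, k}))"
proof -
  have e: "{i, j} \<in> E" using c tight_subset[of E c] by auto
  let ?K = "{k. {i, j, k} \<in> triangles E}"
  let ?b = "\<lambda>s. Poly_Mapping.lookup (basis_vector s) (max_face Z c)"
  have inj: "inj_on (\<lambda>k. {i, j, k}) ?K"
    by (rule inj_onI) (auto simp: triangles_pairs)
  have neq: "t \<noteq> e'" if "e' \<in> E" "t \<in> triangles E" for t e'
    using that edges_triangles_disjoint by blast
  have "(\<Sum>s\<in>E. x s * ?b s) = (\<Sum>s\<in>E. if s = {i, j} then sqrt 2 * x {i, j} else 0)"
    by (rule sum.cong) (use neq in \<open>auto simp: lookup_basis_vector[OF c]\<close>)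
  then have 1: "(\<Sum>s\<in>E. x s * ?b s) = sqrt 2 * x {i, j}" using e by simp
  have "(\<Sum>s\<in>triangles E. x s * ?b s) = (\<Sum>s\<in>(\<lambda>k. {i, j, k}) ` ?K. x s * ?b s)"
    by (rule sum.mono_neutral_right) (use neq e in \<open>auto simp: lookup_basis_vector[OF c]\<close>)
  also have "\<dots> = (\<Sum>k\<in>?K. x {i, j, k} * ?b {i, j, k})" by (simp add: sum.reindex[OF inj])
  also have "\<dots> = (\<Sum>k\<in>?K. sqrt 2 * (if c $ i < c $ k then 0 else x {i, j, k}))"
  proof (rule sum.cong)
    fix k assume k: "k \<in> ?K"
    have "{i, j, k'} = {i, j, k} \<longleftrightarrow> k' = k" if "{i, j, k'} \<in> triangles E" for k'
      using that k by (auto simp: triangles_pairs)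
    then have "(\<exists>k'. {i, j, k'} \<in> triangles E \<and> {i, j, k} = {i, j, k'} \<and> \<not> c $ i < c $ k') \<longleftrightarrow> \<not> c $ i < c $ k"
      using k by (metis mem_Collect_eq)
    moreover have "{i, j, k} \<noteq> {i, j}" using neq[OF e] k by blast
    ultimately show "x {i, j, k} * ?b {i, j, k} = sqrt 2 * (if c $ i < c $ k then 0 else x {i, j, k})"
      using k lookup_basis_vector[OF c, of "{i, j, k}"] by simp
  qed simp
  finally have 2: "(\<Sum>s\<in>triangles E. x s * ?b s) = (\<Sum>k\<in>?K. sqrt 2 * (if c $ i < c $ k then 0 else x {i, j, k}))" .
  have "(\<Sum>s\<in>E \<union> triangles E. x s * ?b s) = (\<Sum>s\<in>E. x s * ?b s) + (\<Sum>s\<in>triangles E. x s * ?b s)"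
    using edges_triangles_disjoint by (intro sum.union_disjoint) auto
  then show ?thesis unfolding lin_def lookup_sum lookup_scaleR
    by (simp add: 1 2 distrib_left sum_distrib_left)
qed

text \<open>Over each wall of an edge of \<open>t\<close> exactly one of \<Delta>_t and -\<Delta>_t
  has a segment as its face, so their length vectors add up to that of the three edges of
  \<open>t\<close>. A negative w_t therefore counts as w_t for \<Delta>_t and as -w_t for each of
  these edges.\<close>

definition coord :: "('v set \<Rightarrow> real) \<Rightarrow> 'v set \<Rightarrow> real" where
  "coord w s = (if s \<in> E then w s + (\<Sum>t | t \<in> triangles E \<and> s \<subseteq> t. max 0 (- w t)) else w s)"

lemma sum_triangles_over_edge:
  fixes g :: "'v set \<Rightarrow> real"
  assumes "{i, j} \<in> E"
  shows "(\<Sum>t | t \<in> triangles E \<and> {i, j} \<subseteq> t. g t) = (\<Sum>k | {i, j, k} \<in> triangles E. g {i, j, k})"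
proof -
  have ij: "i \<noteq> j" using assms edge_neq by blast
  have inj: "inj_on (\<lambda>k. {i, j, k}) {k. {i, j, k} \<in> triangles E}"
    by (rule inj_onI) (auto simp: triangles_pairs)
  have "{t. t \<in> triangles E \<and> {i, j} \<subseteq> t} = (\<lambda>k. {i, j, k}) ` {k. {i, j, k} \<in> triangles E}"
  proof (intro set_eqI iffI)
    fix s assume s: "s \<in> {t. t \<in> triangles E \<and> {i, j} \<subseteq> t}"
    have "card s = 3" using s by (simp add: triangles_def)
    then have "card (s - {i, j}) = 1" using s ij by (simp add: card_Diff_subset)
    then obtain k where "s - {i, j} = {k}" by (auto simp: card_1_singleton_iff)
    then have "s = {i, j, k}" using s by auto
    then show "s \<in> (\<lambda>k. {i, j, k}) ` {k. {i, j, k} \<in> triangles E}" using s by auto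
  qed auto
  then show ?thesis by (simp add: sum.reindex[OF inj])
qed

lemma length_vector_eq_lin:
  assumes w: "\<forall>e\<in>E. 0 \<le> w e"
  shows "length_vector w = lin (coord w)"
proof (rule edge_vector_eqI[OF keys_length_vector keys_lin])
  fix c i j assume c: "tight E c = {{i, j}}"
  then have e: "{i, j} \<in> E" using tight_subset[of E c] by auto
  let ?K = "{k. {i, j, k} \<in> triangles E}"
  have t: "coord w {i, j, k} = w {i, j, k}" if "k \<in> ?K" for k
    using that edges_triangles_disjoint by (auto simp: coord_def)
  have "coord w {i, j} + (\<Sum>k\<in>?K. if c $ i < c $ k then 0 else coord w {i, j, k}) =
      w {i, j} + (\<Sum>k\<in>?K. max 0 (- w {i, j, k}) + (if c $ i < c $ k then 0 else w {i, j, k}))"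
  proof -
    have "coord w {i, j} = w {i, j} + (\<Sum>k\<in>?K. max 0 (- w {i, j, k}))"
      using e sum_triangles_over_edge[OF e, of "\<lambda>t. max 0 (- w t)"] by (simp add: coord_def)
    moreover have "(\<Sum>k\<in>?K. if c $ i < c $ k then 0 else coord w {i, j, k}) = (\<Sum>k\<in>?K. if c $ i < c $ k then 0 else w {i, j, k})"
      using t by (intro sum.cong) auto
    ultimately show ?thesis by (simp add: sum.distrib)
  qed
  also have "(\<Sum>k\<in>?K. max 0 (- w {i, j, k}) + (if c $ i < c $ k then 0 else w {i, j, k})) =
      (\<Sum>k\<in>?K. if c $ i < c $ k then max 0 (- w {i, j, k}) else max 0 (w {i, j, k}))"
    by (rule sum.cong) auto
  finally show "Poly_Mapping.lookup (length_vector w) (max_face Z c) = Poly_Mapping.lookup (lin (coord w)) (max_face Z c)"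
    using lookup_length_vector[OF c w] lookup_lin[OF c, of "coord w"] by (simp add: edge_length_def)
qed

lemma lin_add: "lin (\<lambda>s. x s + y s) = lin x + lin y"
  by (simp add: lin_def scaleR_add_left sum.distrib)

lemma lin_scaleR: "lin (\<lambda>s. r * x s) = r *\<^sub>R lin x"
  by (simp add: lin_def scaleR_sum_right)

text \<open>On a wall with all other vertices above, only the coefficient of the edge is seen;
  lowering a single vertex \<open>k\<close> then isolates one triangle.\<close>

lemma lin_eq_0D:
  assumes "lin x = 0" "s \<in> E \<union> triangles E"
  shows "x s = 0"
proof -
  have z: "x {i, j} + (\<Sum>k | {i, j, k} \<in> triangles E. if c $ i < c $ k then 0 else x {i, j, k}) = 0"
    if "tight E c = {{i, j}}" for c i j
    using lookup_lin[OF that, of x] assms(1) by simp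
  have edge: "x {i, j} = 0" if e: "{i, j} \<in> E" for i j
  proof -
    obtain c where c: "tight E c = {{i, j}}" "\<And>k. k \<noteq> i \<Longrightarrow> k \<noteq> j \<Longrightarrow> c $ i < c $ k \<longleftrightarrow> k \<in> UNIV"
      using wall_exists[OF e, of UNIV] by blast
    have "(\<Sum>k | {i, j, k} \<in> triangles E. if c $ i < c $ k then 0 else x {i, j, k}) = 0"
      by (rule sum.neutral) (use c(2) in \<open>auto simp: triangles_pairs\<close>)
    then show ?thesis using z[OF c(1)] by simp
  qed
  show ?thesis
  proof (cases "s \<in> E")
    case True
    then obtain i j where "s = {i, j}" by (elim edgeE)
    then show ?thesis using edge True by simp
  next
    case False
    then have "s \<in> triangles E" using assms(2) by blast
    then obtain i j k where t: "s = {i, j, k}" "{i, j} \<in> E" "{i, j, k} \<in> triangles E" "k \<noteq> i" "k \<noteq> j"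
      by (elim triangleE) (auto simp: triangles_pairs)
    obtain c where c: "tight E c = {{i, j}}" "\<And>k'. k' \<noteq> i \<Longrightarrow> k' \<noteq> j \<Longrightarrow> c $ i < c $ k' \<longleftrightarrow> k' \<in> - {k}"
      using wall_exists[OF t(2), of "- {k}"] by blast
    have "(\<Sum>k' | {i, j, k'} \<in> triangles E. if c $ i < c $ k' then 0 else x {i, j, k'}) =
        (\<Sum>k' | {i, j, k'} \<in> triangles E. if k' = k then x {i, j, k} else 0)"
      by (rule sum.cong) (use c(2) in \<open>auto simp: triangles_pairs\<close>)
    also have "\<dots> = x {i, j, k}" using t by simp
    finally show ?thesis using z[OF c(1)] edge[OF t(2)] t by simp
  qed
qed

lemma lin_eqD:
  assumes "lin x = lin y" "s \<in> E \<union> triangles E" shows "x s = y s"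
proof -
  have "lin (\<lambda>s. x s + (-1) * y s) = lin x + (-1) *\<^sub>R lin y" by (simp only: lin_add lin_scaleR)
  then have "x s + (-1) * y s = 0" using assms lin_eq_0D[of "\<lambda>s. x s + (-1) * y s"] by simp
  then show ?thesis by simp
qed

lemma lin_cong: "(\<And>s. s \<in> E \<union> triangles E \<Longrightarrow> x s = y s) \<Longrightarrow> lin x = lin y"
  unfolding lin_def by (intro sum.cong) auto

end

section \<open>Two-dimensional faces of the graphical zonotope\<close>

lemma inner_edge_dir: "(axis i 1 - axis j 1) \<bullet> x = x $ i - x $ (j :: 'v::finite)"
  by (simp add: inner_diff_left inner_axis')

lemma argmax_singleton: "argmax {i} c = {i}"
  by (auto simp: argmax_def)

lemma combination_nth_diff:
  assumes "x *\<^sub>R p + (y *\<^sub>R q + z *\<^sub>R r) = (0 :: real ^ 'v::finite)"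
  shows "x * (p $ i - p $ k) + (y * (q $ i - q $ k) + z * (r $ i - r $ k)) = 0"
proof -
  have "(x *\<^sub>R p + (y *\<^sub>R q + z *\<^sub>R r)) $ i - (x *\<^sub>R p + (y *\<^sub>R q + z *\<^sub>R r)) $ k = 0"
    unfolding assms by simp
  then show ?thesis by (simp add: algebra_simps)
qed

text \<open>The unit vector orthogonal to e_i - e_j in the plane of the differences of e_i, e_j,
  e_k, with \<open>k\<close> as its lowest vertex; the squared norm before scaling is 1 + 1 +
  4.\<close>

definition hex_normal :: "'v \<Rightarrow> 'v \<Rightarrow> 'v \<Rightarrow> real ^ 'v::finite" where
  "hex_normal i j k = (1 / sqrt 6) *\<^sub>R (axis i 1 + axis j 1 - 2 *\<^sub>R axis k 1)"

lemma hex_normal_nth: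
  assumes "i \<noteq> j" "i \<noteq> k" "j \<noteq> k"
  shows "hex_normal i j k $ i = 1 / sqrt 6" "hex_normal i j k $ j = 1 / sqrt 6" "hex_normal i j k $ k = - 2 / sqrt 6"
  using assms by (simp_all add: hex_normal_def axis_def)

lemma hex_normal_less:
  assumes "i \<noteq> j" "i \<noteq> k" "j \<noteq> k"
  shows "hex_normal i j k $ i = hex_normal i j k $ j" "hex_normal i j k $ k < hex_normal i j k $ i"
proof -
  have "- 2 / sqrt 6 < (1 :: real) / sqrt 6" by (rule divide_strict_right_mono) auto
  then show "hex_normal i j k $ i = hex_normal i j k $ j" "hex_normal i j k $ k < hex_normal i j k $ i"
    unfolding hex_normal_nth[OF assms] by auto
qed

text \<open>Three normals at angles of 120 degrees; this relation closes the hexagon for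
  \<Delta>_t.\<close>

lemma hex_normal_sum: "hex_normal i j k + hex_normal i k j + hex_normal j k i = 0"
  unfolding hex_normal_def scaleR_add_right[symmetric] by (simp add: scaleR_2 algebra_simps)

section \<open>Edge normals within a two-dimensional face\<close>

context simple_graph
begin

lemma orthogonal_edge_dirs_eq_0:
  assumes d: "dim (dirs m) = 2" and t: "{i, j} \<in> tight E m" "{k, l} \<in> tight E m" "{i, j} \<noteq> {k, l}"
    and x: "x \<in> span (dirs m)" "x $ i = x $ j" "x $ k = x $ l"
  shows "x = 0"
proof -
  let ?u = "axis i 1 - axis j 1 :: real ^ 'v" and ?v = "axis k 1 - axis l 1 :: real ^ 'v"
  have E: "{i, j} \<in> E" "{k, l} \<in> E" using t by (auto simp: tight_pair)
  have "dirs m \<subseteq> span {?u, ?v}"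
  proof (rule card_ge_dim_independent)
    show "{?u, ?v} \<subseteq> dirs m" using t by (auto simp: dirs_def)
    show "independent {?u, ?v}" by (rule independent_edge_dirs[OF E t(3)])
    show "dim (dirs m) \<le> card {?u, ?v}" using d independent_edge_dirs(1)[OF E t(3)] by simp
  qed
  then have "x \<in> span {?u, ?v}" using x(1) span_minimal[OF _ subspace_span] by blast
  then have "orthogonal x x"
    by (rule orthogonal_to_span) (use x in \<open>auto simp: orthogonal_def inner_commute[of x] inner_edge_dir\<close>)
  then show ?thesis by (simp add: orthogonal_def)
qed

lemma other_tight_edge:
  assumes "dim (dirs m) = 2" "{i, j} \<in> tight E m"
  obtains k l where "{k, l} \<in> tight E m" "{k, l} \<noteq> {i, j}"
proof -
  have "tight E m \<noteq> {{i, j}}" using assms dim_dirs_single by fastforce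
  then obtain b where b: "b \<in> tight E m" "b \<noteq> {i, j}" using assms by blast
  then have "b \<in> E" using tight_subset by blast
  then obtain k l where "b = {k, l}" by (elim edgeE)
  then show ?thesis using that b by blast
qed

text \<open>Equal coordinates on \<open>a\<close> mean orthogonality to its edge direction. On a
  two-dimensional face these are the outer normals of its two edges parallel to
  \<open>a\<close>.\<close>

definition wall_normal :: "real ^ 'v \<Rightarrow> 'v set \<Rightarrow> real ^ 'v \<Rightarrow> bool" where
  "wall_normal m a n \<longleftrightarrow> n \<in> span (dirs m) \<and> norm n = 1 \<and> (\<forall>i\<in>a. \<forall>j\<in>a. n $ i = n $ j)"

lemma wall_normal_pair: "wall_normal m {i, j} n \<longleftrightarrow> n \<in> span (dirs m) \<and> norm n = 1 \<and> n $ i = n $ j"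
  by (auto simp: wall_normal_def)

lemma wall_normal_uminus: "wall_normal m a n \<Longrightarrow> wall_normal m a (- n)"
  unfolding wall_normal_def using span_neg by (metis norm_minus_cancel vector_uminus_component)

lemma wall_normal_neq:
  assumes "dim (dirs m) = 2" "{i, j} \<in> tight E m" "{k, l} \<in> tight E m" "{k, l} \<noteq> {i, j}" "wall_normal m {i, j} n"
  shows "n $ k \<noteq> n $ l"
proof
  assume eq: "n $ k = n $ l"
  have "n \<in> span (dirs m)" "n $ i = n $ j" "norm n = 1" using assms(5) by (simp_all add: wall_normal_pair)
  then show False using orthogonal_edge_dirs_eq_0[OF assms(1-3) assms(4)[symmetric] _ _ eq] by simp
qed

lemma wall_normal_exists:
  assumes d: "dim (dirs m) = 2" and a: "a \<in> tight E m"
  shows "\<exists>n. wall_normal m a n"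
proof -
  have "a \<in> E" using a tight_subset by blast
  then obtain i j where ij: "a = {i, j}" "i \<noteq> j" by (elim edgeE)
  obtain k l where kl: "{k, l} \<in> tight E m" "{k, l} \<noteq> {i, j}" using other_tight_edge d a ij by metis
  let ?u = "axis i 1 - axis j 1 :: real ^ 'v" and ?v = "axis k 1 - axis l 1 :: real ^ 'v"
  \<comment> \<open>Gram-Schmidt; the denominator is the squared norm of \<open>?u\<close>.\<close>
  define y where "y = ?v - ((?v \<bullet> ?u) / 2) *\<^sub>R ?u"
  have "?u \<in> dirs m" "?v \<in> dirs m" using a ij kl by (auto simp: dirs_def)
  then have yS: "y \<in> span (dirs m)" unfolding y_def by (intro span_diff span_scale span_base)
  have "?u \<bullet> ?u = 2" unfolding inner_edge_dir using ij by (simp add: axis_def)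
  then have "?u \<bullet> y = 0" by (simp add: y_def inner_diff_right inner_commute)
  then have yij: "y $ i = y $ j" by (simp add: inner_edge_dir)
  have "y \<noteq> 0"
  proof
    assume "y = 0"
    then have "(- (?v \<bullet> ?u) / 2) *\<^sub>R ?u + 1 *\<^sub>R ?v = 0" by (simp add: y_def)
    moreover have "{i, j} \<in> E" "{k, l} \<in> E" using a kl ij by (auto simp: tight_pair)
    ultimately show False using edge_dirs_independent[OF _ _ kl(2)[symmetric]] by fastforce
  qed
  then have "wall_normal m {i, j} ((1 / norm y) *\<^sub>R y)"
    using yS yij by (simp add: wall_normal_pair span_scale)
  then show ?thesis using ij by blast
qed

lemma wall_normal_unique:
  assumes d: "dim (dirs m) = 2" and ij: "{i, j} \<in> tight E m"
    and n: "wall_normal m {i, j} n" and n': "wall_normal m {i, j} n'"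
  shows "n' = n \<or> n' = - n"
proof -
  obtain k l where kl: "{k, l} \<in> tight E m" "{k, l} \<noteq> {i, j}" using other_tight_edge d ij by metis
  define \<beta> \<beta>' where "\<beta> = n $ k - n $ l" and "\<beta>' = n' $ k - n' $ l"
  have "\<beta> \<noteq> 0" using wall_normal_neq[OF d ij kl n] by (simp add: \<beta>_def)
  \<comment> \<open>A combination chosen to vanish also on \<open>{k, l}\<close> is orthogonal to
    both edge directions.\<close>
  have "\<beta>' *\<^sub>R n - \<beta> *\<^sub>R n' = 0"
  proof (rule orthogonal_edge_dirs_eq_0[OF d ij kl(1)])
    show "\<beta>' *\<^sub>R n - \<beta> *\<^sub>R n' \<in> span (dirs m)"
      using n n' by (intro span_diff span_scale) (auto simp: wall_normal_pair)
  qed (use n n' kl(2) in \<open>auto simp: wall_normal_pair \<beta>_def \<beta>'_def algebra_simps\<close>)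
  then have eq: "\<beta> *\<^sub>R n' = \<beta>' *\<^sub>R n" by simp
  then have "\<bar>\<beta>\<bar> * norm n' = \<bar>\<beta>'\<bar> * norm n" by (metis norm_scaleR)
  then have "\<bar>\<beta>\<bar> = \<bar>\<beta>'\<bar>" using n n' by (simp add: wall_normal_pair)
  then have "\<beta>' = \<beta> \<or> \<beta>' = - \<beta>" by linarith
  then have "\<beta> *\<^sub>R n' = \<beta> *\<^sub>R n \<or> \<beta> *\<^sub>R n' = \<beta> *\<^sub>R (- n)" using eq by auto
  then show ?thesis using \<open>\<beta> \<noteq> 0\<close> scaleR_left_imp_eq by blast
qed

lemma tight_push_wall_normal:
  assumes "dim (dirs m) = 2" "{i, j} \<in> tight E m" "wall_normal m {i, j} n"
  shows "tight E (push E m n) = {{i, j}}"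
proof (rule tight_pushI)
  fix k l assume kl: "{k, l} \<in> tight E m"
  show "n $ k = n $ l \<longleftrightarrow> {k, l} \<in> {{i, j}}"
    using wall_normal_neq[OF assms(1,2) kl _ assms(3)] assms(3) by (auto simp: wall_normal_pair doubleton_eq_iff)
qed (use assms in auto)

text \<open>A face of a face is a face in a slightly tilted direction.\<close>

lemma max_face_push: "max_face (max_face Z m) d = max_face Z (push E m d)"
proof -
  have "argmax (argmax e m) d = argmax e (push E m d)" if e: "e \<in> E" for e
  proof -
    obtain i j where ij: "e = {i, j}" "i \<noteq> j" using e by (elim edgeE)
    have E: "{i, j} \<in> E" "{j, i} \<in> E" using e ij by (simp_all add: insert_commute)
    show ?thesis
    proof (cases rule: linorder_cases[of "m $ i" "m $ j"])
      case less
      then show ?thesis using nearD[OF near_push[of E m d] E(1)] ij by (simp add: argmax_pair argmax_singleton)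
    next
      case equal
      then show ?thesis using ij by (simp add: argmax_pair push_less_iff)
    next
      case greater
      then show ?thesis using nearD[OF near_push[of E m d] E(2)] ij by (simp add: argmax_pair argmax_singleton)
    qed
  qed
  then show ?thesis
    unfolding max_face_zonotope by (simp add: max_face_sum max_face_simplex_on)
qed

definition normals :: "real ^ 'v \<Rightarrow> (real ^ 'v) set" where
  "normals m = {n. \<exists>a\<in>tight E m. wall_normal m a n}"

lemma normalsE:
  assumes "n \<in> normals m"
  obtains i j where "{i, j} \<in> tight E m" "wall_normal m {i, j} n"
proof -
  obtain a where a: "a \<in> tight E m" "wall_normal m a n" using assms by (auto simp: normals_def)
  then have "a \<in> E" using tight_subset by blast
  then obtain i j where "a = {i, j}" by (elim edgeE)
  then show ?thesis using that a by blast
qed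

text \<open>The uniqueness behind the definite description in \<open>edge_normal\<close>. Its
  competitor is any unit vector in the plane: exposing the same edge makes it normal to the same
  direction, and the side of a second tied edge fixes its sign.\<close>

lemma max_face_normals_inj:
  assumes d: "dim (dirs m) = 2" and n: "n \<in> normals m"
    and n': "n' \<in> span (dirs m)" "norm n' = 1"
    and eq: "max_face Z (push E m n) = max_face Z (push E m n')"
  shows "n = n'"
proof -
  obtain i j where ij: "{i, j} \<in> tight E m" "wall_normal m {i, j} n" using n by (rule normalsE)
  have ss: "same_sides E (push E m n) (push E m n')" using eq by (simp add: max_face_zonotope_eq_iff)
  have "n $ i = n $ j" using ij by (simp add: wall_normal_pair)
  then have "{i, j} \<in> tight E (push E m n')" using ij tight_same_sides[OF ss] tight_push_iff by metis
  then have w: "wall_normal m {i, j} n'" using n' by (simp add: wall_normal_pair tight_push_iff)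
  obtain k l where kl: "{k, l} \<in> tight E m" "{k, l} \<noteq> {i, j}" using other_tight_edge d ij by metis
  have "n $ k < n $ l \<longleftrightarrow> n' $ k < n' $ l"
    using same_sidesD[OF ss, of k l] kl by (simp add: tight_pair push_less_iff)
  moreover have "n $ k \<noteq> n $ l" by (rule wall_normal_neq[OF d ij(1) kl ij(2)])
  ultimately have "n' \<noteq> - n" by auto
  then show ?thesis using wall_normal_unique[OF d ij w] by auto
qed

lemma edge_normal_max_face:
  assumes d: "dim (dirs m) = 2" and n: "n \<in> normals m"
  shows "edge_normal (max_face Z m) (max_face Z (push E m n)) = n"
  unfolding edge_normal_def span_max_face_zonotope max_face_push
proof (rule the_equality)
  show "norm n = 1 \<and> n \<in> span (dirs m) \<and> max_face Z (push E m n) = max_face Z (push E m n)"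
    using n by (auto simp: normals_def wall_normal_def)
  fix n' assume "norm n' = 1 \<and> n' \<in> span (dirs m) \<and> max_face Z (push E m n') = max_face Z (push E m n)"
  then show "n' = n" using max_face_normals_inj[OF d n, of n'] by simp
qed

lemma edges_of_two_face:
  assumes d: "dim (dirs m) = 2"
  shows "{e. e edge_of max_face Z m} = (\<lambda>n. max_face Z (push E m n)) ` normals m"
proof (intro set_eqI iffI)
  let ?F = "max_face Z m"
  have face: "?F face_of Z" using max_face_face_of polytope_imp_convex polytope_zonotope by blast
  have F: "polytope ?F" using face_of_polytope_polytope[OF polytope_zonotope face] .
  {
    fix e assume "e \<in> {e. e edge_of ?F}"
    then have e: "e face_of ?F" "aff_dim e = 1" by (auto simp: edge_of_def)
    then have "e \<noteq> {}" by auto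
    then obtain c where c: "e = max_face ?F c" using face_of_eq_max_face[OF F e(1)] by blast
    \<comment> \<open>The component \<open>z\<close> is constant on the face, so only the component
      \<open>y\<close> in its plane matters; normalized, it is the edge normal.\<close>
    obtain y z where yz: "y \<in> span (dirs m)" "\<And>w. w \<in> span (dirs m) \<Longrightarrow> orthogonal z w" "c = y + z"
      using orthogonal_subspace_decomp_exists[of "dirs m" c] by blast
    have z: "x \<bullet> z = x' \<bullet> z" if "x \<in> ?F" "x' \<in> ?F" for x x'
    proof -
      have "x - x' \<in> span (dirs m)"
        unfolding span_max_face_zonotope[symmetric] using that by (intro span_base) blast
      then have "z \<bullet> (x - x') = 0" using yz(2) by (simp add: orthogonal_def)
      then show ?thesis by (simp add: inner_diff_right inner_commute)
    qed
    have ey: "e = max_face ?F y"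
    proof (rule set_eqI)
      fix x
      have "x' \<bullet> c \<le> x \<bullet> c \<longleftrightarrow> x' \<bullet> y \<le> x \<bullet> y" if "x \<in> ?F" "x' \<in> ?F" for x'
        using z[OF that] by (simp add: yz(3) inner_add_right)
      then show "x \<in> e \<longleftrightarrow> x \<in> max_face ?F y" unfolding c max_face_def[of ?F] by blast
    qed
    have "y \<noteq> 0"
    proof
      assume "y = 0"
      then have "e = ?F" using ey by (simp add: max_face_0)
      then show False using e(2) d aff_dim_max_face_zonotope[of m] by simp
    qed
    define n where "n = (1 / norm y) *\<^sub>R y"
    have n: "n \<in> span (dirs m)" "norm n = 1" using yz(1) \<open>y \<noteq> 0\<close> by (auto simp: n_def span_scale)
    have en: "e = max_face Z (push E m n)"
      using ey \<open>y \<noteq> 0\<close> max_face_scaleR[of "1 / norm y" ?F y] by (simp add: n_def max_face_push)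
    then have "dim (dirs (push E m n)) = 1" using e(2) aff_dim_max_face_zonotope by simp
    then obtain a where a: "tight E (push E m n) = {a}" using dim_dirs_1_iff by blast
    then have "a \<in> E" using tight_subset by blast
    then obtain i j where ij: "a = {i, j}" by (elim edgeE)
    have "{i, j} \<in> tight E m" "n $ i = n $ j" using a ij tight_push_iff[of i j m n] by auto
    moreover have "wall_normal m {i, j} n" using n calculation(2) by (simp add: wall_normal_pair)
    ultimately have "n \<in> normals m" unfolding normals_def by blast
    then show "e \<in> (\<lambda>n. max_face Z (push E m n)) ` normals m" using en by blast
  next
    fix e assume "e \<in> (\<lambda>n. max_face Z (push E m n)) ` normals m"
    then obtain n where n: "n \<in> normals m" "e = max_face Z (push E m n)" by blast
    obtain i j where ij: "{i, j} \<in> tight E m" "wall_normal m {i, j} n" using n(1) by (rule normalsE)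
    have "aff_dim e = 1"
      using dim_dirs_single[OF tight_push_wall_normal[OF d ij]] n by (simp add: aff_dim_max_face_zonotope)
    moreover have "e face_of ?F"
      unfolding n(2) max_face_push[symmetric] using F by (intro max_face_face_of polytope_imp_convex)
    ultimately show "e \<in> {e. e edge_of ?F}" by (simp add: edge_of_def)
  }
qed

lemma two_face_sum:
  assumes d: "dim (dirs m) = 2"
  shows "(\<Sum>e | e edge_of max_face Z m. f e *\<^sub>R edge_normal (max_face Z m) e) =
    (\<Sum>n\<in>normals m. f (max_face Z (push E m n)) *\<^sub>R n)"
proof -
  have "inj_on (\<lambda>n. max_face Z (push E m n)) (normals m)"
  proof (rule inj_onI)
    fix n n' assume n: "n \<in> normals m" "n' \<in> normals m" "max_face Z (push E m n) = max_face Z (push E m n')"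
    then have "n' \<in> span (dirs m)" "norm n' = 1" by (auto simp: normals_def wall_normal_def)
    then show "n = n'" using max_face_normals_inj[OF d n(1)] n(3) by blast
  qed
  then show ?thesis
    unfolding edges_of_two_face[OF d]
    by (subst sum.reindex) (auto simp: edge_normal_max_face[OF d] intro!: sum.cong)
qed

text \<open>The edges of a two-dimensional face come in opposite pairs, one for each tied edge of
  the graph; \<open>\<nu>\<close> selects one normal of each pair.\<close>

lemma normals_sum:
  fixes g :: "real ^ 'v \<Rightarrow> 'b::comm_monoid_add"
  assumes d: "dim (dirs m) = 2" and \<nu>: "\<And>a. a \<in> tight E m \<Longrightarrow> wall_normal m a (\<nu> a)"
  shows "(\<Sum>n\<in>normals m. g n) = (\<Sum>a\<in>tight E m. g (\<nu> a) + g (- \<nu> a))"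
proof -
  have pair: "\<exists>i j. a = {i, j}" if "a \<in> tight E m" for a
    using that tight_subset[of E m] by (meson edgeE subsetD)
  have "normals m = (\<Union>a\<in>tight E m. {\<nu> a, - \<nu> a})"
  proof (intro set_eqI iffI)
    fix n assume "n \<in> normals m"
    then obtain i j where ij: "{i, j} \<in> tight E m" "wall_normal m {i, j} n" by (rule normalsE)
    then have "n = \<nu> {i, j} \<or> n = - \<nu> {i, j}" using wall_normal_unique[OF d ij(1) \<nu>[OF ij(1)] ij(2)] by blast
    then show "n \<in> (\<Union>a\<in>tight E m. {\<nu> a, - \<nu> a})" using ij by blast
  next
    fix n assume "n \<in> (\<Union>a\<in>tight E m. {\<nu> a, - \<nu> a})"
    then obtain a where "a \<in> tight E m" "n = \<nu> a \<or> n = - \<nu> a" by blast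
    then show "n \<in> normals m" using \<nu>[of a] wall_normal_uminus[of m a "\<nu> a"] unfolding normals_def by blast
  qed
  also have "(\<Sum>n\<in>(\<Union>a\<in>tight E m. {\<nu> a, - \<nu> a}). g n) = (\<Sum>a\<in>tight E m. \<Sum>n\<in>{\<nu> a, - \<nu> a}. g n)"
  proof (rule sum.UNION_disjoint)
    show "\<forall>a\<in>tight E m. \<forall>b\<in>tight E m. a \<noteq> b \<longrightarrow> {\<nu> a, - \<nu> a} \<inter> {\<nu> b, - \<nu> b} = {}"
    proof (intro ballI impI)
      fix a b assume ab: "a \<in> tight E m" "b \<in> tight E m" "a \<noteq> b"
      obtain i j k l where ij: "a = {i, j}" "b = {k, l}" using pair ab by metis
      show "{\<nu> a, - \<nu> a} \<inter> {\<nu> b, - \<nu> b} = {}"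
      proof (rule ccontr)
        assume "{\<nu> a, - \<nu> a} \<inter> {\<nu> b, - \<nu> b} \<noteq> {}"
        then obtain n where "n \<in> {\<nu> a, - \<nu> a}" "n \<in> {\<nu> b, - \<nu> b}" by blast
        then have "wall_normal m a n" "wall_normal m b n" using \<nu> ab wall_normal_uminus by auto
        then show False using wall_normal_neq[of m i j k l n] d ab ij by (auto simp: wall_normal_pair)
      qed
    qed
  qed auto
  also have "\<dots> = (\<Sum>a\<in>tight E m. g (\<nu> a) + g (- \<nu> a))"
  proof (rule sum.cong)
    fix a assume "a \<in> tight E m"
    then have "norm (\<nu> a) = 1" using \<nu> by (simp add: wall_normal_def)
    moreover have "\<nu> a = 0" if "\<nu> a = - \<nu> a"
    proof -
      have "\<nu> a + \<nu> a = 0" by (subst (2) that) simp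
      then have "2 *\<^sub>R \<nu> a = 0" by (simp add: scaleR_2)
      then show ?thesis by simp
    qed
    ultimately have "\<nu> a \<noteq> - \<nu> a" by force
    then show "(\<Sum>n\<in>{\<nu> a, - \<nu> a}. g n) = g (\<nu> a) + g (- \<nu> a)" by simp
  qed simp
  finally show ?thesis .
qed

section \<open>The closing conditions of the two-dimensional faces\<close>

lemma edge_length_cone_iff:
  "l \<in> edge_length_cone Z \<longleftrightarrow> Poly_Mapping.keys l \<subseteq> {e. e edge_of Z} \<and>
    (\<forall>c a. tight E c = {a} \<longrightarrow> 0 \<le> Poly_Mapping.lookup l (max_face Z c)) \<and>
    (\<forall>m. dim (dirs m) = 2 \<longrightarrow> (\<Sum>n\<in>normals m. Poly_Mapping.lookup l (max_face Z (push E m n)) *\<^sub>R n) = 0)"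
proof -
  have "(\<forall>e. e edge_of Z \<longrightarrow> 0 \<le> Poly_Mapping.lookup l e) \<longleftrightarrow>
      (\<forall>c a. tight E c = {a} \<longrightarrow> 0 \<le> Poly_Mapping.lookup l (max_face Z c))"
    unfolding edge_of_zonotope_iff by blast
  moreover have "(\<forall>F. F face_of Z \<and> aff_dim F = 2 \<longrightarrow>
        (\<Sum>e | e edge_of F. Poly_Mapping.lookup l e *\<^sub>R edge_normal F e) = 0) \<longleftrightarrow>
      (\<forall>m. dim (dirs m) = 2 \<longrightarrow> (\<Sum>n\<in>normals m. Poly_Mapping.lookup l (max_face Z (push E m n)) *\<^sub>R n) = 0)"
    (is "?A \<longleftrightarrow> ?B")
  proof
    assume A: ?A
    show ?B
    proof (intro allI impI)
      fix m assume d: "dim (dirs m) = 2"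
      have "max_face Z m face_of Z" using max_face_face_of polytope_imp_convex polytope_zonotope by blast
      moreover have "aff_dim (max_face Z m) = 2" using d by (simp add: aff_dim_max_face_zonotope)
      ultimately show "(\<Sum>n\<in>normals m. Poly_Mapping.lookup l (max_face Z (push E m n)) *\<^sub>R n) = 0"
        using A unfolding two_face_sum[OF d, symmetric] by blast
    qed
  next
    assume B: ?B
    show ?A
    proof (intro allI impI)
      fix F assume F: "F face_of Z \<and> aff_dim F = 2"
      then have "F \<noteq> {}" by auto
      then obtain m where m: "F = max_face Z m" using F face_of_eq_max_face polytope_zonotope by metis
      then have d: "dim (dirs m) = 2" using F by (simp add: aff_dim_max_face_zonotope)
      show "(\<Sum>e | e edge_of F. Poly_Mapping.lookup l e *\<^sub>R edge_normal F e) = 0"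
        unfolding m two_face_sum[OF d] using B d by blast
    qed
  qed
  ultimately show ?thesis unfolding edge_length_cone_def by simp
qed

lemma dim_dirs_eq_2:
  assumes ab: "{i, j} \<in> tight E m" "{k, l} \<in> tight E m" "{i, j} \<noteq> {k, l}"
    and sub: "dirs m \<subseteq> span {axis i 1 - axis j 1, axis k 1 - axis l 1}"
  shows "dim (dirs m) = 2"
proof -
  let ?B = "{axis i 1 - axis j 1, axis k 1 - axis l 1 :: real ^ 'v}"
  have "dim (dirs m) \<le> card ?B" using sub by (intro dim_le_card) auto
  also have "\<dots> \<le> 2" by (simp add: card_insert_if)
  finally show ?thesis using dim_dirs_ge_2[OF ab] by simp
qed

lemma wall_normal_hex_normal:
  assumes ne: "i \<noteq> j" "i \<noteq> k" "j \<noteq> k" and t: "{i, k} \<in> tight E m" "{j, k} \<in> tight E m"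
  shows "wall_normal m {i, j} (hex_normal i j k)"
proof -
  have eq: "axis i 1 + axis j 1 - 2 *\<^sub>R axis k 1 = (axis i 1 - axis k 1) + (axis j 1 - axis k 1 :: real ^ 'v)"
    by (simp add: scaleR_2)
  have "axis i 1 - axis k 1 \<in> dirs m" "axis j 1 - axis k 1 \<in> dirs m" using t by (auto simp: dirs_def)
  then have "hex_normal i j k \<in> span (dirs m)"
    unfolding hex_normal_def eq by (intro span_scale span_add span_base)
  moreover have "(axis i 1 + axis j 1 - 2 *\<^sub>R axis k 1) \<bullet> (axis i 1 + axis j 1 - 2 *\<^sub>R axis k 1 :: real ^ 'v) = 6"
    using ne by (simp add: inner_diff_left inner_diff_right inner_add_left inner_add_right inner_axis_axis)
  then have "norm (axis i 1 + axis j 1 - 2 *\<^sub>R axis k 1 :: real ^ 'v) = sqrt 6" by (simp add: norm_eq_sqrt_inner)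
  then have "norm (hex_normal i j k) = 1" by (simp add: hex_normal_def)
  ultimately show ?thesis using hex_normal_nth[OF ne] by (simp add: wall_normal_pair)
qed

lemma length_system_edge_length_cone:
  assumes K4: "\<not> (\<exists>K. card K = 4 \<and> clique E K)" and l: "l \<in> edge_length_cone Z"
  shows "length_system E (\<lambda>c. Poly_Mapping.lookup l (max_face Z c))"
proof unfold_locales
  let ?L = "\<lambda>c. Poly_Mapping.lookup l (max_face Z c)"
  have cong: "?L c = ?L c'" if "same_sides E c c'" for c c'
    using that max_face_zonotope_eq_iff by metis
  have closed: "(\<Sum>n\<in>normals m. ?L (push E m n) *\<^sub>R n) = 0" if "dim (dirs m) = 2" for m
    using l that edge_length_cone_iff by blast
  show "\<not> (\<exists>K. card K = 4 \<and> clique E K)" by fact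
  show "?L c = ?L c'" if "same_sides E c c'" for c c' by (rule cong[OF that])
  show "0 \<le> ?L c" if "tight E c = {a}" for c a
    using l that edge_length_cone_iff by blast
  show "?L c = ?L c'"
    if ab: "a \<noteq> b" and m: "tight E m = {a, b}" and c: "near E m c" "near E m c'" "tight E c = {a}" "tight E c' = {a}"
    for a b m c c'
  proof -
    have E: "a \<in> E" "b \<in> E" using m tight_subset[of E m] by auto
    obtain i j where ij: "a = {i, j}" using E(1) by (elim edgeE)
    obtain k l where kl: "b = {k, l}" using E(2) by (elim edgeE)
    let ?u = "axis i 1 - axis j 1 :: real ^ 'v" and ?v = "axis k 1 - axis l 1 :: real ^ 'v"
    have tm: "{i, j} \<in> tight E m" "{k, l} \<in> tight E m" "{i, j} \<noteq> {k, l}" using m ij kl ab by auto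
    have "d \<in> {?u, - ?u, ?v, - ?v}" if "d \<in> dirs m" for d
      using that m ij kl by (auto simp: dirs_def doubleton_eq_iff)
    then have "dirs m \<subseteq> {?u, - ?u, ?v, - ?v}" by blast
    also have "\<dots> \<subseteq> span {?u, ?v}" by (intro insert_subsetI empty_subsetI span_neg span_base insertI1 insertI2)
    finally have d: "dim (dirs m) = 2" by (rule dim_dirs_eq_2[OF tm])
    obtain n where n: "wall_normal m a n" using wall_normal_exists[OF d, of a] m by blast
    obtain n' where n': "wall_normal m b n'" using wall_normal_exists[OF d, of b] m by blast
    define \<nu> where "\<nu> x = (if x = a then n else n')" for x
    have \<nu>: "wall_normal m x (\<nu> x)" if "x \<in> tight E m" for x
      using that m n n' by (auto simp: \<nu>_def)
    have "(?L (push E m n) - ?L (push E m (- n))) *\<^sub>R n + (?L (push E m n') - ?L (push E m (- n'))) *\<^sub>R n' = 0"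
    proof -
      have "(\<Sum>x\<in>tight E m. ?L (push E m (\<nu> x)) *\<^sub>R \<nu> x + ?L (push E m (- \<nu> x)) *\<^sub>R - \<nu> x) = 0"
        using normals_sum[where m = m and \<nu> = \<nu> and g = "\<lambda>n. ?L (push E m n) *\<^sub>R n", OF d] \<nu> closed[OF d] by simp
      then show ?thesis unfolding m using ab by (simp add: \<nu>_def scaleR_diff_left)
    qed
    \<comment> \<open>Pairing with e_k - e_l, which is orthogonal to n', isolates the pair of edges
      with normals n and - n.\<close>
    then have "((?L (push E m n) - ?L (push E m (- n))) *\<^sub>R n + (?L (push E m n') - ?L (push E m (- n'))) *\<^sub>R n') $ k -
        ((?L (push E m n) - ?L (push E m (- n))) *\<^sub>R n + (?L (push E m n') - ?L (push E m (- n'))) *\<^sub>R n') $ l = 0"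
      by simp
    moreover have "n' $ k = n' $ l" using n' kl by (simp add: wall_normal_pair)
    ultimately have "(?L (push E m n) - ?L (push E m (- n))) * (n $ k - n $ l) = 0" by (simp add: algebra_simps)
    moreover have nkl: "n $ k \<noteq> n $ l"
      using wall_normal_neq[OF d tm(1,2)] tm(3) n ij by blast
    ultimately have eq: "?L (push E m n) = ?L (push E m (- n))" by simp
    have nij: "n $ i = n $ j" using n ij by (simp add: wall_normal_pair)
    have mt: "{x, y} \<in> tight E m \<longleftrightarrow> {x, y} = {i, j} \<or> {x, y} = {k, l}" for x y using m ij kl by auto
    have "?L c = ?L (push E m n)" if c: "near E m c" "tight E c = {a}" for c
    proof -
      have cij: "c $ i = c $ j" using c ij tight_pair[of i j E c] by auto
      have ckl: "c $ k \<noteq> c $ l" using c kl ab E tight_pair[of k l E c] by auto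
      consider "c $ k < c $ l \<longleftrightarrow> n $ k < n $ l" | "c $ k < c $ l \<longleftrightarrow> n $ l < n $ k" using nkl by linarith
      then show ?thesis
      proof cases
        case 1
        have "same_sides E (push E m n) c"
          by (rule same_sides_push[OF c(1)]) (use 1 cij nij ckl nkl in \<open>auto simp: mt doubleton_eq_iff\<close>)
        then show ?thesis using cong by simp
      next
        case 2
        have "same_sides E (push E m (- n)) c"
          by (rule same_sides_push[OF c(1)]) (use 2 cij nij ckl nkl in \<open>auto simp: mt doubleton_eq_iff\<close>)
        then show ?thesis using cong eq by simp
      qed
    qed
    then show ?thesis using c by simp
  qed
  show "?L c - ?L c' = ?L d - ?L d'"
    if t: "{i, j, k} \<in> triangles E" and m: "tight E m = {{i, j}, {i, k}, {j, k}}"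
      and n: "near E m c" "near E m c'" "near E m d" "near E m d'"
      and c: "c $ i = c $ j" "c $ i < c $ k" "c' $ i = c' $ j" "c' $ k < c' $ i"
      and d: "d $ j = d $ k" "d $ j < d $ i" "d' $ j = d' $ k" "d' $ i < d' $ j"
    for i j k m c c' d d'
  proof -
    have ne: "i \<noteq> j" "i \<noteq> k" "j \<noteq> k" using t by (auto simp: triangles_pairs)
    have tm: "{i, j} \<in> tight E m" "{i, k} \<in> tight E m" "{j, k} \<in> tight E m" using m by auto
    have nij: "{i, j} \<noteq> {i, k}" "{i, j} \<noteq> {j, k}" "{i, k} \<noteq> {j, k}" using ne by (auto simp: doubleton_eq_iff)
    let ?u = "axis i 1 - axis j 1 :: real ^ 'v" and ?v = "axis i 1 - axis k 1 :: real ^ 'v"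
    have "d \<in> {?u, - ?u, ?v, - ?v, ?v - ?u, ?u - ?v}" if "d \<in> dirs m" for d
      using that m by (auto simp: dirs_def doubleton_eq_iff)
    then have "dirs m \<subseteq> {?u, - ?u, ?v, - ?v, ?v - ?u, ?u - ?v}" by blast
    also have "\<dots> \<subseteq> span {?u, ?v}"
    proof -
      have uv: "?u \<in> span {?u, ?v}" "?v \<in> span {?u, ?v}" by (auto intro: span_base)
      show ?thesis
        using uv span_neg[OF uv(1)] span_neg[OF uv(2)] span_diff[OF uv] span_diff[OF uv(2,1)]
        by (simp only: insert_subset empty_subsetI simp_thms)
    qed
    finally have dd: "dim (dirs m) = 2" by (rule dim_dirs_eq_2[OF tm(1,2) nij(1)])
    define \<nu> where "\<nu> x = (if x = {i, j} then hex_normal i j k else if x = {i, k} then hex_normal i k j else hex_normal j k i)" for x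
    have sw: "{k, j} \<in> tight E m" "{j, i} \<in> tight E m" "{k, i} \<in> tight E m" using tm by (simp_all add: insert_commute)
    have W: "wall_normal m {i, j} (hex_normal i j k)" "wall_normal m {i, k} (hex_normal i k j)" "wall_normal m {j, k} (hex_normal j k i)"
      using wall_normal_hex_normal[of i j k m] wall_normal_hex_normal[of i k j m] wall_normal_hex_normal[of j k i m] ne tm sw by auto
    have \<nu>: "wall_normal m x (\<nu> x)" if "x \<in> tight E m" for x
      using that m W nij by (auto simp: \<nu>_def)
    let ?f = "\<lambda>n. ?L (push E m n)"
    have "(?f (hex_normal i j k) - ?f (- hex_normal i j k)) *\<^sub>R hex_normal i j k +
      ((?f (hex_normal i k j) - ?f (- hex_normal i k j)) *\<^sub>R hex_normal i k j +
      (?f (hex_normal j k i) - ?f (- hex_normal j k i)) *\<^sub>R hex_normal j k i) = 0"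
    proof -
      have "(\<Sum>x\<in>tight E m. ?L (push E m (\<nu> x)) *\<^sub>R \<nu> x + ?L (push E m (- \<nu> x)) *\<^sub>R - \<nu> x) = 0"
        using normals_sum[where m = m and \<nu> = \<nu> and g = "\<lambda>n. ?L (push E m n) *\<^sub>R n", OF dd] \<nu> closed[OF dd] by simp
      then show ?thesis unfolding m using nij by (simp add: \<nu>_def scaleR_diff_left)
    qed
    \<comment> \<open>Pairing with e_i - e_k removes the normal of \<open>{i, k}\<close> and takes
      the values 3 / sqrt 6 and - 3 / sqrt 6 on the normals of \<open>{i, j}\<close> and
      \<open>{j, k}\<close>.\<close>
    then have "(?f (hex_normal i j k) - ?f (- hex_normal i j k)) * (hex_normal i j k $ i - hex_normal i j k $ k) +
      ((?f (hex_normal i k j) - ?f (- hex_normal i k j)) * (hex_normal i k j $ i - hex_normal i k j $ k) +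
      (?f (hex_normal j k i) - ?f (- hex_normal j k i)) * (hex_normal j k i $ i - hex_normal j k i $ k)) = 0"
      by (rule combination_nth_diff)
    then have "(?f (hex_normal i j k) - ?f (- hex_normal i j k)) * (3 / sqrt 6) -
       (?f (hex_normal j k i) - ?f (- hex_normal j k i)) * (3 / sqrt 6) = 0"
      using hex_normal_nth[of i j k] hex_normal_nth[of i k j] hex_normal_nth[of j k i] ne by (simp add: field_simps)
    then have "(?f (hex_normal i j k) - ?f (- hex_normal i j k) - (?f (hex_normal j k i) - ?f (- hex_normal j k i))) * (3 / sqrt 6) = 0"
      by (simp only: left_diff_distrib)
    then have eq: "?f (hex_normal i j k) - ?f (- hex_normal i j k) = ?f (hex_normal j k i) - ?f (- hex_normal j k i)"
      by simp
    have mt: "{x, y} \<in> tight E m \<longleftrightarrow> {x, y} = {i, j} \<or> {x, y} = {i, k} \<or> {x, y} = {j, k}" for x y using m by auto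
    have h: "hex_normal i j k $ i = hex_normal i j k $ j" "hex_normal i j k $ k < hex_normal i j k $ i"
       "hex_normal j k i $ j = hex_normal j k i $ k" "hex_normal j k i $ i < hex_normal j k i $ j"
      using hex_normal_less[of i j k] hex_normal_less[of j k i] ne by auto
    \<comment> \<open>\<open>k\<close> is lowest in \<open>hex_normal i j k\<close>, so the wall
      with \<open>k\<close> above is reached by the opposite normal.\<close>
    have s1: "same_sides E (push E m (- hex_normal i j k)) c"
      by (rule same_sides_push[OF n(1)]) (use c h in \<open>auto simp: mt doubleton_eq_iff\<close>)
    have s2: "same_sides E (push E m (hex_normal i j k)) c'"
      by (rule same_sides_push[OF n(2)]) (use c h in \<open>auto simp: mt doubleton_eq_iff\<close>)
    have s3: "same_sides E (push E m (- hex_normal j k i)) d"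
      by (rule same_sides_push[OF n(3)]) (use d h in \<open>auto simp: mt doubleton_eq_iff\<close>)
    have s4: "same_sides E (push E m (hex_normal j k i)) d'"
      by (rule same_sides_push[OF n(4)]) (use d h in \<open>auto simp: mt doubleton_eq_iff\<close>)
    show ?thesis using eq cong[OF s1] cong[OF s2] cong[OF s3] cong[OF s4] by linarith
  qed
qed

text \<open>Opposite edges have equal lengths in \<Delta>_s unless \<open>s\<close> is a triangle
  whose vertices are all tied at \<open>m\<close>. In that case the three differences equal
  \<open>sqrt 2\<close> and the normals cancel.\<close>

lemma basis_vector_closed:
  assumes s: "s \<in> E \<union> triangles E" and d: "dim (dirs m) = 2"
  shows "(\<Sum>n\<in>normals m. Poly_Mapping.lookup (basis_vector s) (max_face Z (push E m n)) *\<^sub>R n) = 0"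
proof -
  define f where "f n = Poly_Mapping.lookup (basis_vector s) (max_face Z (push E m n))" for n
  obtain \<nu>0 where \<nu>0: "\<And>a. a \<in> tight E m \<Longrightarrow> wall_normal m a (\<nu>0 a)"
    using wall_normal_exists[OF d] by metis
  have f: "f n = (if s = {i, j} \<or> (\<exists>k. {i, j, k} \<in> triangles E \<and> s = {i, j, k} \<and> \<not> push E m n $ i < push E m n $ k) then sqrt 2 else 0)"
    if "{i, j} \<in> tight E m" "wall_normal m {i, j} n" for i j n
    unfolding f_def by (rule lookup_basis_vector[OF tight_push_wall_normal[OF d that] s])
  have sum: "(\<Sum>n\<in>normals m. f n *\<^sub>R n) = (\<Sum>a\<in>tight E m. (f (\<nu> a) - f (- \<nu> a)) *\<^sub>R \<nu> a)"
    if "\<And>a. a \<in> tight E m \<Longrightarrow> wall_normal m a (\<nu> a)" for \<nu>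
    using normals_sum[where m = m and \<nu> = \<nu> and g = "\<lambda>n. f n *\<^sub>R n", OF d] that by (simp add: scaleR_diff_left)
  \<comment> \<open>If the third vertex of \<open>s\<close> is not tied with \<open>i\<close>, its
    side is already decided by \<open>m\<close> and is the same for \<open>n\<close> and
    \<open>- n\<close>.\<close>
  have zero: "f n = f (- n)"
    if ij: "{i, j} \<in> tight E m" and n: "wall_normal m {i, j} n"
      and k: "\<And>k. {i, j, k} \<in> triangles E \<Longrightarrow> s = {i, j, k} \<Longrightarrow> m $ i \<noteq> m $ k" for i j n
  proof -
    have "push E m n $ i < push E m n $ k \<longleftrightarrow> push E m (- n) $ i < push E m (- n) $ k"
      if t: "{i, j, k} \<in> triangles E" "s = {i, j, k}" for k
    proof -
      have "{i, k} \<in> E" "{k, i} \<in> E" using t by (simp_all add: triangles_pairs insert_commute)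
      then show ?thesis
        using k[OF t] nearD[OF near_push, of i k E m n] nearD[OF near_push, of k i E m n]
          nearD[OF near_push, of i k E m "- n"] nearD[OF near_push, of k i E m "- n"]
        by (cases rule: linorder_cases[of "m $ i" "m $ k"]) auto
    qed
    then have "(\<exists>k. {i, j, k} \<in> triangles E \<and> s = {i, j, k} \<and> \<not> push E m n $ i < push E m n $ k) \<longleftrightarrow>
      (\<exists>k. {i, j, k} \<in> triangles E \<and> s = {i, j, k} \<and> \<not> push E m (- n) $ i < push E m (- n) $ k)" by blast
    then show ?thesis unfolding f[OF ij n] f[OF ij wall_normal_uminus[OF n]] by simp
  qed
  have pair: "\<exists>i j. a = {i, j}" if "a \<in> tight E m" for a
    using that tight_subset[of E m] by (meson edgeE subsetD)
  have "(\<Sum>n\<in>normals m. f n *\<^sub>R n) = 0"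
  proof (cases "s \<in> triangles E \<and> (\<forall>x\<in>s. \<forall>y\<in>s. m $ x = m $ y)")
    case False
    have "f (\<nu>0 a) = f (- \<nu>0 a)" if a: "a \<in> tight E m" for a
    proof -
      obtain i j where ij: "a = {i, j}" using pair a by blast
      have "m $ i = m $ j" using a ij by (simp add: tight_pair)
      then have "m $ i \<noteq> m $ k" if "{i, j, k} \<in> triangles E" "s = {i, j, k}" for k
        using False that by auto
      then show ?thesis using zero[of i j "\<nu>0 a"] a ij \<nu>0[of a] by blast
    qed
    then have "(\<Sum>a\<in>tight E m. (f (\<nu>0 a) - f (- \<nu>0 a)) *\<^sub>R \<nu>0 a) = 0" by (intro sum.neutral) simp
    then show ?thesis using sum[of \<nu>0] \<nu>0 by simp
  next
    case True
    then have "s \<in> triangles E" by blast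
    then obtain i j k where t: "s = {i, j, k}" "i \<noteq> j" "i \<noteq> k" "j \<noteq> k" "{i, j} \<in> E" "{i, k} \<in> E" "{j, k} \<in> E"
      by (rule triangleE)
    have T: "{i, j, k} \<in> triangles E" "{i, k, j} \<in> triangles E" "{j, k, i} \<in> triangles E"
      using t by (simp_all add: triangles_pairs insert_commute)
    have "i \<in> s" "j \<in> s" "k \<in> s" using t(1) by simp_all
    then have mk: "m $ i = m $ j" "m $ i = m $ k" using True by blast+
    then have tm: "{i, j} \<in> tight E m" "{i, k} \<in> tight E m" "{j, k} \<in> tight E m"
      "{k, j} \<in> tight E m" "{j, i} \<in> tight E m" "{k, i} \<in> tight E m"
      using t by (simp_all add: tight_pair insert_commute)
    have ne: "{i, j} \<noteq> {i, k}" "{i, j} \<noteq> {j, k}" "{i, k} \<noteq> {j, k}" using t by (auto simp: doubleton_eq_iff)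
    have W: "wall_normal m {i, j} (hex_normal i j k)" "wall_normal m {i, k} (hex_normal i k j)" "wall_normal m {j, k} (hex_normal j k i)"
      using wall_normal_hex_normal[of i j k m] wall_normal_hex_normal[of i k j m] wall_normal_hex_normal[of j k i m] t tm by auto
    define \<nu> where "\<nu> x = (if x = {i, j} then hex_normal i j k else if x = {i, k} then hex_normal i k j
      else if x = {j, k} then hex_normal j k i else \<nu>0 x)" for x
    have \<nu>: "wall_normal m x (\<nu> x)" if "x \<in> tight E m" for x
      using that W \<nu>0 by (auto simp: \<nu>_def)
    have val: "f (hex_normal p q r) - f (- hex_normal p q r) = sqrt 2"
      if t: "{p, q, r} \<in> triangles E" "s = {p, q, r}" and m: "m $ p = m $ q" "m $ p = m $ r" for p q r
    proof -
      have ne: "p \<noteq> q" "p \<noteq> r" "q \<noteq> r" "{p, q} \<in> E" "{p, r} \<in> E" "{q, r} \<in> E" using t by (auto simp: triangles_pairs)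
      have tm: "{p, q} \<in> tight E m" "{p, r} \<in> tight E m" "{q, r} \<in> tight E m" using ne m by (simp_all add: tight_pair)
      have w: "wall_normal m {p, q} (hex_normal p q r)" using wall_normal_hex_normal ne tm by blast
      have h: "hex_normal p q r $ r < hex_normal p q r $ p" using hex_normal_less[OF ne(1-3)] by blast
      have up: "\<not> push E m (hex_normal p q r) $ p < push E m (hex_normal p q r) $ r"
        "push E m (- hex_normal p q r) $ p < push E m (- hex_normal p q r) $ r"
        using h m(2) by (simp_all add: push_less_iff)
      have r: "r' = r" if "{p, q, r'} \<in> triangles E" "s = {p, q, r'}" for r'
        using that t by (auto simp: triangles_pairs)
      have "s \<noteq> {p, q}" using t ne by auto
      have "\<exists>k. {p, q, k} \<in> triangles E \<and> s = {p, q, k} \<and> \<not> push E m (hex_normal p q r) $ p < push E m (hex_normal p q r) $ k"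
        using t up by blast
      moreover have "\<not> (\<exists>k. {p, q, k} \<in> triangles E \<and> s = {p, q, k} \<and> \<not> push E m (- hex_normal p q r) $ p < push E m (- hex_normal p q r) $ k)"
        using r up by blast
      ultimately show ?thesis
        unfolding f[OF tm(1) w] f[OF tm(1) wall_normal_uminus[OF w]] using \<open>s \<noteq> {p, q}\<close> by simp
    qed
    \<comment> \<open>Any further tied edge is not contained in \<open>s\<close> and contributes
      nothing by \<open>zero\<close>.\<close>
    have "(\<Sum>a\<in>tight E m. (f (\<nu> a) - f (- \<nu> a)) *\<^sub>R \<nu> a) =
        (\<Sum>a\<in>{{i, j}, {i, k}, {j, k}}. (f (\<nu> a) - f (- \<nu> a)) *\<^sub>R \<nu> a)"
    proof (rule sum.mono_neutral_right)
      show "\<forall>a\<in>tight E m - {{i, j}, {i, k}, {j, k}}. (f (\<nu> a) - f (- \<nu> a)) *\<^sub>R \<nu> a = 0"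
      proof
        fix a assume a: "a \<in> tight E m - {{i, j}, {i, k}, {j, k}}"
        then obtain x y where xy: "a = {x, y}" using pair by blast
        have "{x, y} \<in> E" using a xy by (simp add: tight_pair)
        then have "x \<noteq> y" using edge_neq by blast
        have "\<not> {x, y} \<subseteq> s"
        proof
          assume "{x, y} \<subseteq> s"
          then have "x \<in> {i, j, k}" "y \<in> {i, j, k}" using t by auto
          then show False using a xy \<open>x \<noteq> y\<close> by (auto simp: insert_commute)
        qed
        then have "f (\<nu> a) = f (- \<nu> a)"
          using zero[of x y "\<nu> a"] a xy \<nu>[of a] by blast
        then show "(f (\<nu> a) - f (- \<nu> a)) *\<^sub>R \<nu> a = 0" by simp
      qed
    qed (use tm in auto)
    also have "\<dots> = sqrt 2 *\<^sub>R hex_normal i j k + (sqrt 2 *\<^sub>R hex_normal i k j + sqrt 2 *\<^sub>R hex_normal j k i)"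
    proof -
      have "\<nu> {i, j} = hex_normal i j k" "\<nu> {i, k} = hex_normal i k j" "\<nu> {j, k} = hex_normal j k i"
        using ne by (simp_all add: \<nu>_def)
      moreover have "s = {i, k, j}" "s = {j, k, i}" using t(1) by (simp_all add: insert_commute)
      then have "f (hex_normal i j k) - f (- hex_normal i j k) = sqrt 2"
        "f (hex_normal i k j) - f (- hex_normal i k j) = sqrt 2"
        "f (hex_normal j k i) - f (- hex_normal j k i) = sqrt 2"
        using T t(1) mk by (intro val; simp)+
      ultimately show ?thesis using ne by simp
    qed
    also have "\<dots> = sqrt 2 *\<^sub>R (hex_normal i j k + hex_normal i k j + hex_normal j k i)"
      by (simp add: scaleR_add_right)
    finally have "(\<Sum>a\<in>tight E m. (f (\<nu> a) - f (- \<nu> a)) *\<^sub>R \<nu> a) = 0" unfolding hex_normal_sum by simp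
    then show ?thesis using sum[of \<nu>] \<nu> by simp
  qed
  then show ?thesis by (simp add: f_def)
qed

lemma length_vector_in_cone:
  assumes w: "\<forall>e\<in>E. 0 \<le> w e"
  shows "length_vector w \<in> edge_length_cone Z"
  unfolding edge_length_cone_iff
proof (intro conjI allI impI)
  show "Poly_Mapping.keys (length_vector w) \<subseteq> {e. e edge_of Z}" by (rule keys_length_vector)
  show "0 \<le> Poly_Mapping.lookup (length_vector w) (max_face Z c)" if "tight E c = {a}" for c a
    unfolding length_vector_def lookup_edge_lengths_of_max_face[OF deformation_weighted_sum that]
    using bounded_subset[OF polytope_imp_bounded[OF polytope_weighted_sum] max_face_subset]
    by (intro diameter_ge_0)
  show "(\<Sum>n\<in>normals m. Poly_Mapping.lookup (length_vector w) (max_face Z (push E m n)) *\<^sub>R n) = 0"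
    if d: "dim (dirs m) = 2" for m
  proof -
    let ?b = "\<lambda>s n. Poly_Mapping.lookup (basis_vector s) (max_face Z (push E m n))"
    have "(\<Sum>n\<in>normals m. Poly_Mapping.lookup (length_vector w) (max_face Z (push E m n)) *\<^sub>R n) =
        (\<Sum>n\<in>normals m. \<Sum>s\<in>E \<union> triangles E. coord w s *\<^sub>R (?b s n *\<^sub>R n))"
      unfolding length_vector_eq_lin[OF w] lin_def lookup_sum lookup_scaleR by (simp add: scaleR_sum_left)
    also have "\<dots> = (\<Sum>s\<in>E \<union> triangles E. coord w s *\<^sub>R (\<Sum>n\<in>normals m. ?b s n *\<^sub>R n))"
      by (subst sum.swap) (simp add: scaleR_sum_right)
    also have "\<dots> = 0" by (rule sum.neutral) (use basis_vector_closed[OF _ d] in simp)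
    finally show ?thesis .
  qed
qed

text \<open>This includes surjectivity of the edge length map: an abstract vector of the cone is
  already that of a weighted sum, so no polytope has to be rebuilt from its edges.\<close>

lemma edge_length_cone_eq:
  assumes K4: "\<not> (\<exists>K. card K = 4 \<and> clique E K)"
  shows "edge_length_cone Z = length_vector ` {w. \<forall>e\<in>E. 0 \<le> w e}"
proof (intro subset_antisym subsetI)
  fix l assume l: "l \<in> edge_length_cone Z"
  interpret length_system E "\<lambda>c. Poly_Mapping.lookup l (max_face Z c)"
    by (rule length_system_edge_length_cone[OF K4 l])
  obtain w where w: "\<forall>e\<in>E. 0 \<le> w e"
    "\<And>i j c. tight E c = {{i, j}} \<Longrightarrow> Poly_Mapping.lookup l (max_face Z c) = edge_length w i j c"
    by (rule length_system_eq_edge_length) blast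
  have "l = length_vector w"
  proof (rule edge_vector_eqI[OF _ keys_length_vector])
    show "Poly_Mapping.keys l \<subseteq> {e. e edge_of Z}" using l edge_length_cone_iff by blast
    show "Poly_Mapping.lookup l (max_face Z c) = Poly_Mapping.lookup (length_vector w) (max_face Z c)"
      if "tight E c = {{i, j}}" for c i j
      using w lookup_length_vector that by simp
  qed
  then show "l \<in> length_vector ` {w. \<forall>e\<in>E. 0 \<le> w e}" using w by blast
qed (use length_vector_in_cone in blast)

end

section \<open>Linear coordinates on a simplicial cone\<close>

definition unit_weight :: "'k \<Rightarrow> real \<Rightarrow> 'k \<Rightarrow> real" where
  "unit_weight s r = (\<lambda>x. if x = s then r else 0)"

lemma unit_weight_scale: "(\<lambda>x. r * unit_weight s q x) = unit_weight s (r * q)"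
  by (auto simp: unit_weight_def)

lemma convex_combination_neg_part:
  fixes a b u :: real
  assumes "0 < u" "u < 1"
  shows "max 0 (- ((1 - u) * a + u * b)) \<le> (1 - u) * max 0 (- a) + u * max 0 (- b)"
proof -
  have "(1 - u) * - a \<le> (1 - u) * max 0 (- a)" "u * - b \<le> u * max 0 (- b)"
    using assms by (intro mult_left_mono; simp)+
  moreover have "0 \<le> (1 - u) * max 0 (- a)" "0 \<le> u * max 0 (- b)" using assms by auto
  ultimately show ?thesis by auto
qed

text \<open>Weights are functions on the whole type of which only the values on \<open>K\<close>
  count; up to this, \<open>\<Phi>\<close> is linear and injective. The instances are
  \<open>lin\<close> and \<open>signed_lin\<close> for each sign pattern.\<close>

locale linear_coordinates =
  fixes K :: "'k set" and \<Phi> :: "('k \<Rightarrow> real) \<Rightarrow> 'x::real_vector"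
  assumes finite_K: "finite K"
    and \<Phi>_add: "\<Phi> (\<lambda>s. x s + y s) = \<Phi> x + \<Phi> y"
    and \<Phi>_scale: "\<Phi> (\<lambda>s. r * x s) = r *\<^sub>R \<Phi> x"
    and \<Phi>_eq_0: "\<Phi> x = 0 \<longleftrightarrow> (\<forall>s\<in>K. x s = 0)"
begin

lemma \<Phi>_eq_iff: "\<Phi> x = \<Phi> y \<longleftrightarrow> (\<forall>s\<in>K. x s = y s)"
proof -
  have "\<Phi> (\<lambda>s. x s + (-1) * y s) = \<Phi> x + (-1) *\<^sub>R \<Phi> y" by (simp only: \<Phi>_add \<Phi>_scale)
  then have "\<Phi> x = \<Phi> y \<longleftrightarrow> \<Phi> (\<lambda>s. x s + (-1) * y s) = 0" by simp
  then show ?thesis by (simp add: \<Phi>_eq_0)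
qed

lemma \<Phi>_expand: "\<Phi> x = (\<Sum>s\<in>K. x s *\<^sub>R \<Phi> (unit_weight s 1))"
proof -
  have "\<Phi> (\<lambda>s. if s \<in> J then x s else 0) = (\<Sum>s\<in>J. x s *\<^sub>R \<Phi> (unit_weight s 1))" if "J \<subseteq> K" for J
    using finite_subset[OF that finite_K] that
  proof (induction J rule: finite_induct)
    case empty
    then show ?case by (simp add: \<Phi>_eq_0)
  next
    case (insert j J)
    have "(\<lambda>s. if s \<in> insert j J then x s else 0) = (\<lambda>s. x j * unit_weight j 1 s + (if s \<in> J then x s else 0))"
      using insert.hyps by (auto simp: unit_weight_def)
    then show ?case using insert by (simp add: \<Phi>_add \<Phi>_scale)
  qed
  moreover have "\<Phi> x = \<Phi> (\<lambda>s. if s \<in> K then x s else 0)" by (simp add: \<Phi>_eq_iff)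
  ultimately show ?thesis by simp
qed

lemma inj_on_units: "inj_on (\<lambda>s. \<Phi> (unit_weight s 1)) K"
proof (rule inj_onI)
  fix s t assume "s \<in> K" "t \<in> K" "\<Phi> (unit_weight s 1) = \<Phi> (unit_weight t 1)"
  then have "unit_weight s 1 s = unit_weight t 1 s" by (simp add: \<Phi>_eq_iff)
  then show "s = t" by (simp add: unit_weight_def split: if_splits)
qed

lemma independent_units: "independent ((\<lambda>s. \<Phi> (unit_weight s 1)) ` K)"
proof -
  let ?b = "\<lambda>s. \<Phi> (unit_weight s 1)"
  have "u v = 0" if u: "(\<Sum>v\<in>?b ` K. u v *\<^sub>R v) = 0" and v: "v \<in> ?b ` K" for u v
  proof -
    have "\<Phi> (\<lambda>s. u (?b s)) = 0"
      using u by (subst \<Phi>_expand) (simp add: sum.reindex[OF inj_on_units])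
    then show ?thesis using v by (auto simp: \<Phi>_eq_0)
  qed
  then show ?thesis using finite_K by (auto simp: dependent_finite)
qed

lemma \<Phi>_in_span: "\<Phi> x \<in> span ((\<lambda>s. \<Phi> (unit_weight s 1)) ` K)"
  by (subst \<Phi>_expand) (intro span_sum span_scale span_base, blast)

lemma dim_eqI:
  assumes "(\<lambda>s. \<Phi> (unit_weight s 1)) ` K \<subseteq> C" "C \<subseteq> range \<Phi>"
  shows "dim C = card K"
proof -
  have "span ((\<lambda>s. \<Phi> (unit_weight s 1)) ` K) = span C"
    using assms \<Phi>_in_span by (intro span_eq[THEN iffD2] conjI) (auto intro: span_base)
  then have "dim C = card ((\<lambda>s. \<Phi> (unit_weight s 1)) ` K)"
    by (rule dim_eq_card) (rule independent_units)
  then show ?thesis by (simp add: card_image[OF inj_on_units])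
qed

abbreviation "orthant \<equiv> {x. \<forall>s\<in>K. 0 \<le> x s}"

lemma simplicial_orthant: "simplicial_cone (card K) (\<Phi> ` orthant)"
proof -
  let ?B = "(\<lambda>s. \<Phi> (unit_weight s 1)) ` K"
  have "\<Phi> ` orthant = convex_cone hull ?B"
  proof (rule hull_unique[symmetric])
    show "?B \<subseteq> \<Phi> ` orthant" by (auto simp: unit_weight_def intro!: imageI)
    show "convex_cone (\<Phi> ` orthant)"
      unfolding convex_cone_iff
    proof (intro conjI ballI allI impI)
      have "\<Phi> (\<lambda>_. 0) = 0" by (simp add: \<Phi>_eq_0)
      then show "0 \<in> \<Phi> ` orthant" by (intro image_eqI[of _ _ "\<lambda>_. 0"]) auto
      fix a b assume "a \<in> \<Phi> ` orthant" "b \<in> \<Phi> ` orthant"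
      then obtain x y where "a = \<Phi> x" "b = \<Phi> y" "x \<in> orthant" "y \<in> orthant" by blast
      then show "a + b \<in> \<Phi> ` orthant" by (intro image_eqI[of _ _ "\<lambda>s. x s + y s"]) (auto simp: \<Phi>_add)
    next
      fix a and r :: real assume "a \<in> \<Phi> ` orthant" "0 \<le> r"
      then obtain x where "a = \<Phi> x" "x \<in> orthant" by blast
      then show "r *\<^sub>R a \<in> \<Phi> ` orthant" using \<open>0 \<le> r\<close>
        by (intro image_eqI[of _ _ "\<lambda>s. r * x s"]) (auto simp: \<Phi>_scale)
    qed
    fix D assume D: "?B \<subseteq> D" "convex_cone D"
    show "\<Phi> ` orthant \<subseteq> D"
    proof
      fix a assume "a \<in> \<Phi> ` orthant"
      then obtain x where x: "a = \<Phi> x" "\<forall>s\<in>K. 0 \<le> x s" by blast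
      have "(\<Sum>s\<in>J. x s *\<^sub>R \<Phi> (unit_weight s 1)) \<in> D" if "J \<subseteq> K" for J
        using finite_subset[OF that finite_K] that
      proof (induction J rule: finite_induct)
        case empty
        then show ?case using convex_cone_contains_0[OF D(2)] by simp
      next
        case (insert j J)
        then have "x j *\<^sub>R \<Phi> (unit_weight j 1) \<in> D" using x D by (intro convex_cone_scaleR) auto
        then show ?case using insert D by (simp add: convex_cone_add)
      qed
      then show "a \<in> D" using x(1) \<Phi>_expand[of x] by auto
    qed
  qed
  then show ?thesis
    unfolding simplicial_cone_def using independent_units card_image[OF inj_on_units] finite_K by blast
qed

text \<open>A combination of nonnegative numbers with positive coefficients is 0 only if both
  numbers are, so vanishing coordinates cut out a face.\<close>

lemma orthant_face:
  "\<Phi> ` {x. (\<forall>s\<in>K. 0 \<le> x s) \<and> (\<forall>s\<in>K \<inter> J. x s = 0)} face_of \<Phi> ` orthant"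
  unfolding face_of_def
proof (intro conjI ballI impI)
  let ?F = "{x. (\<forall>s\<in>K. 0 \<le> x s) \<and> (\<forall>s\<in>K \<inter> J. x s = 0)}"
  show "\<Phi> ` ?F \<subseteq> \<Phi> ` orthant" by auto
  show "convex (\<Phi> ` ?F)"
    unfolding convex_def
  proof (intro ballI allI impI)
    fix a b and u v :: real assume "a \<in> \<Phi> ` ?F" "b \<in> \<Phi> ` ?F" and uv: "0 \<le> u" "0 \<le> v" "u + v = 1"
    then obtain x y where xy: "a = \<Phi> x" "b = \<Phi> y" "x \<in> ?F" "y \<in> ?F" by blast
    then have "u *\<^sub>R a + v *\<^sub>R b = \<Phi> (\<lambda>s. u * x s + v * y s)" by (simp only: \<Phi>_add \<Phi>_scale)
    moreover have "(\<lambda>s. u * x s + v * y s) \<in> ?F" using xy uv by auto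
    ultimately show "u *\<^sub>R a + v *\<^sub>R b \<in> \<Phi> ` ?F" by blast
  qed
  fix a b x assume "a \<in> \<Phi> ` orthant" "b \<in> \<Phi> ` orthant" "x \<in> \<Phi> ` ?F" and seg: "x \<in> open_segment a b"
  then obtain p q z where p: "a = \<Phi> p" "b = \<Phi> q" "x = \<Phi> z" "p \<in> orthant" "q \<in> orthant" "z \<in> ?F" by blast
  obtain u where u: "0 < u" "u < 1" "x = (1 - u) *\<^sub>R a + u *\<^sub>R b" using seg by (auto simp: in_segment)
  have "\<Phi> z = \<Phi> (\<lambda>s. (1 - u) * p s + u * q s)" using p u by (simp only: \<Phi>_add \<Phi>_scale)
  then have eq: "z s = (1 - u) * p s + u * q s" if "s \<in> K" for s
    using that by (simp only: \<Phi>_eq_iff)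
  have "p s = 0 \<and> q s = 0" if s: "s \<in> K \<inter> J" for s
  proof -
    have "0 \<le> p s" "0 \<le> q s" "z s = 0" using p s by auto
    moreover have "0 \<le> (1 - u) * p s" "0 \<le> u * q s" using u calculation by auto
    ultimately show ?thesis using eq[of s] s u by (simp add: add_nonneg_eq_0_iff)
  qed
  then have "p \<in> ?F" "q \<in> ?F" using p by auto
  then show "a \<in> \<Phi> ` ?F" "b \<in> \<Phi> ` ?F" using p by auto
qed

end

section \<open>The deformation cone\<close>

context simple_graph
begin

abbreviation "cells \<equiv> E \<union> triangles E"

definition admissible :: "('v set \<Rightarrow> real) \<Rightarrow> bool" where
  "admissible w \<longleftrightarrow> (\<forall>e\<in>E. 0 \<le> w e)"

lemma admissibleD: "admissible w \<Longrightarrow> \<forall>e\<in>E. 0 \<le> w e"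
  by (simp add: admissible_def)

lemma triangle_not_edge: "t \<in> triangles E \<Longrightarrow> t \<notin> E"
  using edges_triangles_disjoint by blast

lemma coord_edge: "e \<in> E \<Longrightarrow> coord w e = w e + (\<Sum>t | t \<in> triangles E \<and> e \<subseteq> t. max 0 (- w t))"
  by (simp add: coord_def)

lemma coord_triangle: "t \<in> triangles E \<Longrightarrow> coord w t = w t"
  by (simp add: coord_def triangle_not_edge)

lemma weighted_sum_cong: "(\<And>s. s \<in> cells \<Longrightarrow> w s = w' s) \<Longrightarrow> weighted_sum w = weighted_sum w'"
  unfolding weighted_sum_def by (intro sum.cong) auto

text \<open>The change of coordinates is triangular: the triangle weights are kept and determine the
  correction at the edges.\<close>

lemma coord_inj:
  assumes "\<And>s. s \<in> cells \<Longrightarrow> coord w s = coord w' s" "s \<in> cells"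
  shows "w s = w' s"
proof -
  have t: "w t = w' t" if "t \<in> triangles E" for t using assms(1)[of t] that by (simp add: coord_triangle)
  show ?thesis
  proof (cases "s \<in> E")
    case True
    have "(\<Sum>t | t \<in> triangles E \<and> s \<subseteq> t. max 0 (- w t)) = (\<Sum>t | t \<in> triangles E \<and> s \<subseteq> t. max 0 (- w' t))"
      by (rule sum.cong) (auto simp: t)
    then show ?thesis using assms(1)[of s] True by (simp add: coord_edge)
  qed (use assms(2) t in auto)
qed

lemma length_vector_inj:
  assumes "admissible w" "admissible w'" "length_vector w = length_vector w'" "s \<in> cells"
  shows "w s = w' s"
proof (rule coord_inj[OF _ assms(4)])
  have "lin (coord w) = lin (coord w')"
    using assms(1-3) length_vector_eq_lin by (simp add: admissible_def)
  then show "coord w s = coord w' s" if "s \<in> cells" for s using lin_eqD that by blast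
qed

abbreviation "class_of w \<equiv> translation_class (weighted_sum w)"

lemma edge_lengths_class: "edge_lengths Z (class_of w) = length_vector w"
  by (simp add: edge_lengths_translation_class length_vector_def)

lemma class_of_eq_iff:
  assumes "admissible w" "admissible w'"
  shows "class_of w = class_of w' \<longleftrightarrow> (\<forall>s\<in>cells. w s = w' s)"
proof
  assume "class_of w = class_of w'"
  then have "length_vector w = length_vector w'" using edge_lengths_class by metis
  then show "\<forall>s\<in>cells. w s = w' s" using length_vector_inj assms by blast
next
  assume "\<forall>s\<in>cells. w s = w' s"
  then show "class_of w = class_of w'" using weighted_sum_cong by metis
qed

text \<open>The length system of \<open>Q\<close> yields the weights; a weighted sum with the same
  edge lengths is a translate of \<open>Q\<close>.\<close>

lemma deformation_cone_eq:
  assumes K4: "\<not> (\<exists>K. card K = 4 \<and> clique E K)"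
  shows "deformation_cone Z = class_of ` Collect admissible"
proof (intro subset_antisym subsetI)
  fix D assume "D \<in> deformation_cone Z"
  then obtain Q where Q: "D = translation_class Q" "deformation_of Q Z" by (auto simp: deformation_cone_def)
  interpret Q: zonotope_deformation E Q by unfold_locales (rule Q(2))
  interpret L: length_system E "\<lambda>c. diameter (max_face Q c)" by (rule Q.length_system_Q[OF K4])
  obtain w where w: "\<forall>e\<in>E. 0 \<le> w e"
    "\<And>i j c. tight E c = {{i, j}} \<Longrightarrow> diameter (max_face Q c) = edge_length w i j c"
    by (rule L.length_system_eq_edge_length) blast
  have "\<exists>t. Q = (+) t ` weighted_sum w"
  proof (rule deformation_eq_translate[OF Q(2) deformation_weighted_sum])
    fix c a assume c: "tight E c = {a}"
    then have "a \<in> E" using tight_subset by blast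
    then obtain i j where "a = {i, j}" by (elim edgeE)
    then have ij: "tight E c = {{i, j}}" using c by simp
    show "diameter (max_face Q c) = diameter (max_face (weighted_sum w) c)"
      unfolding w(2)[OF ij] diameter_max_face_weighted_sum[OF ij] sum_cell_length[OF ij w(1)] ..
  qed
  then have "D = class_of w" using Q(1) translation_class_translation by auto
  then show "D \<in> class_of ` Collect admissible" using w(1) by (auto simp: admissible_def)
next
  fix D assume "D \<in> class_of ` Collect admissible"
  then show "D \<in> deformation_cone Z"
    using deformation_weighted_sum by (auto simp: deformation_cone_def)
qed

section \<open>Sign patterns and their simplicial cones\<close>

definition signed :: "('v set \<Rightarrow> real) \<Rightarrow> ('v set \<Rightarrow> real) \<Rightarrow> 'v set \<Rightarrow> real" where
  "signed \<epsilon> \<mu> s = (if s \<in> E then \<mu> s else \<mu> s * \<epsilon> s)"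

lemma sign_sum_eq: "sign_sum E \<epsilon> \<mu> = weighted_sum (signed \<epsilon> \<mu>)"
proof -
  have "weighted_sum (signed \<epsilon> \<mu>) = (\<Sum>s\<in>E. dilate (signed \<epsilon> \<mu> s) (simplex_on s)) +
      (\<Sum>s\<in>triangles E. dilate (signed \<epsilon> \<mu> s) (simplex_on s))"
    unfolding weighted_sum_def using edges_triangles_disjoint by (intro sum.union_disjoint) auto
  then show ?thesis
    unfolding sign_sum_def by (simp add: signed_def dilate_dilate triangle_not_edge)
qed

lemma sign_vectorsD: "\<epsilon> \<in> sign_vectors E \<Longrightarrow> t \<in> triangles E \<Longrightarrow> \<epsilon> t = 1 \<or> \<epsilon> t = -1"
  by (auto simp: sign_vectors_def)

abbreviation "nonneg \<mu> \<equiv> \<forall>s\<in>cells. 0 \<le> (\<mu> s :: real)"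

lemma admissible_signed: "nonneg \<mu> \<Longrightarrow> admissible (signed \<epsilon> \<mu>)"
  by (simp add: admissible_def signed_def)

lemma sign_cone_eq: "sign_cone E \<epsilon> = (\<lambda>\<mu>. class_of (signed \<epsilon> \<mu>)) ` {\<mu>. nonneg \<mu>}"
  unfolding sign_cone_def sign_sum_eq by blast

text \<open>Weight 0 gets the sign 1. The restriction to triangles is demanded by the extensional
  function space \<open>sign_vectors E\<close>.\<close>

definition adapted :: "('v set \<Rightarrow> real) \<Rightarrow> 'v set \<Rightarrow> real" where
  "adapted w = (\<lambda>t\<in>triangles E. if w t < 0 then -1 else 1)"

lemma adapted_sign_vector: "adapted w \<in> sign_vectors E"
  by (auto simp: adapted_def sign_vectors_def)

lemma signed_adapted:
  assumes "admissible w" "s \<in> cells"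
  shows "signed (adapted w) (\<lambda>s. \<bar>w s\<bar>) s = w s"
  using assms by (auto simp: signed_def adapted_def admissible_def)

text \<open>On the weights of a fixed sign pattern the edge lengths are linear.\<close>

definition signed_lin :: "('v set \<Rightarrow> real) \<Rightarrow> ('v set \<Rightarrow> real) \<Rightarrow> (real ^ 'v) set \<Rightarrow>\<^sub>0 real" where
  "signed_lin \<epsilon> \<mu> = lin (\<lambda>s. if s \<in> E then \<mu> s + (\<Sum>t | t \<in> triangles E \<and> s \<subseteq> t. \<mu> t * max 0 (- \<epsilon> t)) else \<mu> s * \<epsilon> s)"

text \<open>For \<open>\<mu> t \<ge> 0\<close> the negative part of
  \<open>\<mu> t * \<epsilon> t\<close> is \<open>\<mu> t\<close> times that of
  \<open>\<epsilon> t\<close>, which makes the piecewise linear \<open>coord\<close> linear in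
  \<open>\<mu>\<close>.\<close>

lemma length_vector_signed:
  assumes "nonneg \<mu>"
  shows "length_vector (signed \<epsilon> \<mu>) = signed_lin \<epsilon> \<mu>"
proof -
  have "length_vector (signed \<epsilon> \<mu>) = lin (coord (signed \<epsilon> \<mu>))"
    using admissible_signed[OF assms] by (intro length_vector_eq_lin admissibleD)
  also have "\<dots> = signed_lin \<epsilon> \<mu>"
    unfolding signed_lin_def
  proof (rule lin_cong)
    fix s assume s: "s \<in> cells"
    have "max 0 (- signed \<epsilon> \<mu> t) = \<mu> t * max 0 (- \<epsilon> t)" if "t \<in> triangles E" for t
    proof -
      have "0 \<le> \<mu> t" using assms that by blast
      then show ?thesis using that
        by (cases "\<epsilon> t \<le> 0") (auto simp: signed_def triangle_not_edge max_def mult_le_0_iff zero_le_mult_iff)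
    qed
    then have "(\<Sum>t | t \<in> triangles E \<and> s \<subseteq> t. max 0 (- signed \<epsilon> \<mu> t)) = (\<Sum>t | t \<in> triangles E \<and> s \<subseteq> t. \<mu> t * max 0 (- \<epsilon> t))"
      by (intro sum.cong) auto
    then show "coord (signed \<epsilon> \<mu>) s = (if s \<in> E then \<mu> s + (\<Sum>t | t \<in> triangles E \<and> s \<subseteq> t. \<mu> t * max 0 (- \<epsilon> t)) else \<mu> s * \<epsilon> s)"
      by (simp add: coord_def) (simp add: signed_def)
  qed
  finally show ?thesis .
qed

lemma lin_coordinates: "linear_coordinates cells lin"
proof
  show "lin x = 0 \<longleftrightarrow> (\<forall>s\<in>cells. x s = 0)" for x
    using lin_eq_0D[of x] by (auto simp: lin_def)
qed (simp_all add: lin_add lin_scaleR)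

lemma signed_lin_coordinates:
  assumes \<epsilon>: "\<epsilon> \<in> sign_vectors E"
  shows "linear_coordinates cells (signed_lin \<epsilon>)"
proof
  fix x y :: "'v set \<Rightarrow> real" and r :: real
  show "signed_lin \<epsilon> (\<lambda>s. x s + y s) = signed_lin \<epsilon> x + signed_lin \<epsilon> y"
    unfolding signed_lin_def lin_add[symmetric]
    by (intro arg_cong[where f = lin] ext) (simp add: algebra_simps sum.distrib)
  show "signed_lin \<epsilon> (\<lambda>s. r * x s) = r *\<^sub>R signed_lin \<epsilon> x"
    unfolding signed_lin_def lin_scaleR[symmetric]
    by (intro arg_cong[where f = lin] ext) (simp add: algebra_simps sum_distrib_left)
  show "signed_lin \<epsilon> x = 0 \<longleftrightarrow> (\<forall>s\<in>cells. x s = 0)"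
  proof
    assume z: "signed_lin \<epsilon> x = 0"
    have t: "x t = 0" if "t \<in> triangles E" for t
      using lin_eq_0D[OF z[unfolded signed_lin_def], of t] that sign_vectorsD[OF \<epsilon> that]
      by (auto simp: triangle_not_edge)
    have "x e = 0" if e: "e \<in> E" for e
    proof -
      have "(\<Sum>t | t \<in> triangles E \<and> e \<subseteq> t. x t * max 0 (- \<epsilon> t)) = 0" by (rule sum.neutral) (simp add: t)
      then show ?thesis using lin_eq_0D[OF z[unfolded signed_lin_def], of e] e by simp
    qed
    then show "\<forall>s\<in>cells. x s = 0" using t by blast
  next
    assume "\<forall>s\<in>cells. x s = 0"
    then show "signed_lin \<epsilon> x = 0" unfolding signed_lin_def lin_def by (intro sum.neutral) auto
  qed
qed simp

lemma edge_lengths_sign_cone: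
  "edge_lengths Z ` sign_cone E \<epsilon> = signed_lin \<epsilon> ` {\<mu>. nonneg \<mu>}"
  unfolding sign_cone_eq image_image edge_lengths_class
  by (intro image_cong refl) (simp add: length_vector_signed)

text \<open>Nonnegative numbers with opposite signs attached agree only at 0. The number of cones,
  their disjoint interiors and their common faces all follow from this.\<close>

lemma class_signed_eq_iff:
  assumes \<epsilon>: "\<epsilon> \<in> sign_vectors E" "\<epsilon>' \<in> sign_vectors E" and "nonneg \<mu>" "nonneg \<mu>'"
  shows "class_of (signed \<epsilon> \<mu>) = class_of (signed \<epsilon>' \<mu>') \<longleftrightarrow>
    (\<forall>s\<in>cells. \<mu> s = \<mu>' s) \<and> (\<forall>t\<in>triangles E. \<epsilon> t \<noteq> \<epsilon>' t \<longrightarrow> \<mu> t = 0)"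
proof -
  have t: "\<mu> t * \<epsilon> t = \<mu>' t * \<epsilon>' t \<longleftrightarrow> \<mu> t = \<mu>' t \<and> (\<epsilon> t \<noteq> \<epsilon>' t \<longrightarrow> \<mu> t = 0)" if "t \<in> triangles E" for t
  proof -
    have "0 \<le> \<mu> t" "0 \<le> \<mu>' t" using assms that by auto
    then show ?thesis using sign_vectorsD[OF \<epsilon>(1) that] sign_vectorsD[OF \<epsilon>(2) that] by auto
  qed
  have "class_of (signed \<epsilon> \<mu>) = class_of (signed \<epsilon>' \<mu>') \<longleftrightarrow> (\<forall>s\<in>cells. signed \<epsilon> \<mu> s = signed \<epsilon>' \<mu>' s)"
    using assms by (intro class_of_eq_iff admissible_signed)
  also have "\<dots> \<longleftrightarrow> (\<forall>e\<in>E. \<mu> e = \<mu>' e) \<and> (\<forall>t\<in>triangles E. \<mu> t * \<epsilon> t = \<mu>' t * \<epsilon>' t)"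
    using triangle_not_edge by (auto simp: signed_def)
  finally show ?thesis using t by auto
qed

lemma sign_vectors_eqI:
  assumes "\<epsilon> \<in> sign_vectors E" "\<epsilon>' \<in> sign_vectors E" "\<And>t. t \<in> triangles E \<Longrightarrow> \<epsilon> t = \<epsilon>' t"
  shows "\<epsilon> = \<epsilon>'"
  using assms unfolding sign_vectors_def by (intro PiE_ext) auto

lemma card_sign_cones: "card (sign_cone E ` sign_vectors E) = 2 ^ card (triangles E)"
proof -
  have "inj_on (sign_cone E) (sign_vectors E)"
  proof (rule inj_onI)
    fix \<epsilon> \<epsilon>' assume \<epsilon>: "\<epsilon> \<in> sign_vectors E" "\<epsilon>' \<in> sign_vectors E" and eq: "sign_cone E \<epsilon> = sign_cone E \<epsilon>'"
    \<comment> \<open>The interior point with all coefficients 1 tells the sign patterns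
      apart.\<close>
    have "class_of (signed \<epsilon> (\<lambda>_. 1)) \<in> sign_cone E \<epsilon>" unfolding sign_cone_eq by (intro imageI) simp
    then have "class_of (signed \<epsilon> (\<lambda>_. 1)) \<in> sign_cone E \<epsilon>'" using eq by simp
    then obtain \<mu> where "class_of (signed \<epsilon> (\<lambda>_. 1)) = class_of (signed \<epsilon>' \<mu>)" "\<mu> \<in> {\<mu>. nonneg \<mu>}"
      unfolding sign_cone_eq by (rule imageE)
    then have \<mu>: "nonneg \<mu>" "class_of (signed \<epsilon> (\<lambda>_. 1)) = class_of (signed \<epsilon>' \<mu>)" by simp_all
    have "\<forall>t\<in>triangles E. \<epsilon> t = \<epsilon>' t"
      using class_signed_eq_iff[OF \<epsilon> _ \<mu>(1), of "\<lambda>_. 1"] \<mu>(2) by simp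
    then have "\<epsilon> t = \<epsilon>' t" if "t \<in> triangles E" for t using that by blast
    then show "\<epsilon> = \<epsilon>'" by (rule sign_vectors_eqI[OF \<epsilon>])
  qed
  then have "card (sign_cone E ` sign_vectors E) = card (sign_vectors E)" by (rule card_image)
  also have "\<dots> = 2 ^ card (triangles E)" unfolding sign_vectors_def by (simp add: card_PiE numeral_2_eq_2)
  finally show ?thesis .
qed

lemma deformation_cone_Union:
  assumes K4: "\<not> (\<exists>K. card K = 4 \<and> clique E K)"
  shows "deformation_cone Z = (\<Union>\<epsilon>\<in>sign_vectors E. sign_cone E \<epsilon>)"
proof (intro subset_antisym subsetI)
  fix D assume "D \<in> deformation_cone Z"
  then obtain w where w: "admissible w" "D = class_of w" unfolding deformation_cone_eq[OF K4] by blast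
  have "D = class_of (signed (adapted w) (\<lambda>s. \<bar>w s\<bar>))"
    unfolding w(2) using signed_adapted[OF w(1)] by (intro arg_cong[where f = translation_class] weighted_sum_cong) simp
  then have "D \<in> sign_cone E (adapted w)" unfolding sign_cone_eq by (intro image_eqI) auto
  then show "D \<in> (\<Union>\<epsilon>\<in>sign_vectors E. sign_cone E \<epsilon>)" using adapted_sign_vector by blast
next
  fix D assume "D \<in> (\<Union>\<epsilon>\<in>sign_vectors E. sign_cone E \<epsilon>)"
  then show "D \<in> deformation_cone Z"
    unfolding deformation_cone_eq[OF K4] sign_cone_eq using admissible_signed by blast
qed

lemma sign_cone_interiors_disjoint:
  assumes \<epsilon>: "\<epsilon> \<in> sign_vectors E" "\<epsilon>' \<in> sign_vectors E" "\<epsilon> \<noteq> \<epsilon>'"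
  shows "sign_cone_interior E \<epsilon> \<inter> sign_cone_interior E \<epsilon>' = {}"
proof (rule ccontr)
  assume "sign_cone_interior E \<epsilon> \<inter> sign_cone_interior E \<epsilon>' \<noteq> {}"
  then obtain \<mu> \<mu>' where m: "\<forall>s\<in>cells. 0 < \<mu> s" "\<forall>s\<in>cells. 0 < \<mu>' s"
    "class_of (signed \<epsilon> \<mu>) = class_of (signed \<epsilon>' \<mu>')"
    unfolding sign_cone_interior_def sign_sum_eq by blast
  have "nonneg \<mu>" "nonneg \<mu>'" using m by (auto simp: less_imp_le)
  then have "\<forall>t\<in>triangles E. \<epsilon> t \<noteq> \<epsilon>' t \<longrightarrow> \<mu> t = 0" using class_signed_eq_iff[OF \<epsilon>(1,2)] m(3) by blast
  then have "\<epsilon> t = \<epsilon>' t" if "t \<in> triangles E" for t using m(1) that by force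
  then show False using sign_vectors_eqI[OF \<epsilon>(1,2)] \<epsilon>(3) by blast
qed

text \<open>The common points are those whose coefficients vanish wherever the signs differ: a
  coordinate face of the orthant.\<close>

lemma sign_cone_Int_face:
  assumes \<epsilon>: "\<epsilon> \<in> sign_vectors E" "\<epsilon>' \<in> sign_vectors E"
  shows "edge_lengths Z ` (sign_cone E \<epsilon> \<inter> sign_cone E \<epsilon>') face_of edge_lengths Z ` sign_cone E \<epsilon>"
proof -
  interpret linear_coordinates cells "signed_lin \<epsilon>" by (rule signed_lin_coordinates[OF \<epsilon>(1)])
  define J where "J = {t \<in> triangles E. \<epsilon> t \<noteq> \<epsilon>' t}"
  let ?F = "{\<mu>. nonneg \<mu> \<and> (\<forall>s\<in>cells \<inter> J. \<mu> s = 0)}"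
  have "sign_cone E \<epsilon> \<inter> sign_cone E \<epsilon>' = (\<lambda>\<mu>. class_of (signed \<epsilon> \<mu>)) ` ?F"
  proof (intro set_eqI iffI)
    fix D assume "D \<in> sign_cone E \<epsilon> \<inter> sign_cone E \<epsilon>'"
    then obtain \<mu> \<mu>' where m: "nonneg \<mu>" "nonneg \<mu>'" "D = class_of (signed \<epsilon> \<mu>)" "D = class_of (signed \<epsilon>' \<mu>')"
      unfolding sign_cone_eq by blast
    then have "\<mu> \<in> ?F" using class_signed_eq_iff[OF \<epsilon> m(1,2)] by (auto simp: J_def)
    then show "D \<in> (\<lambda>\<mu>. class_of (signed \<epsilon> \<mu>)) ` ?F" using m(3) by blast
  next
    fix D assume "D \<in> (\<lambda>\<mu>. class_of (signed \<epsilon> \<mu>)) ` ?F"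
    then obtain \<mu> where m: "D = class_of (signed \<epsilon> \<mu>)" "\<mu> \<in> ?F" by blast
    then have "class_of (signed \<epsilon> \<mu>) = class_of (signed \<epsilon>' \<mu>)"
      using class_signed_eq_iff[OF \<epsilon>, of \<mu> \<mu>] by (auto simp: J_def)
    then show "D \<in> sign_cone E \<epsilon> \<inter> sign_cone E \<epsilon>'" unfolding sign_cone_eq using m by blast
  qed
  then have "edge_lengths Z ` (sign_cone E \<epsilon> \<inter> sign_cone E \<epsilon>') = signed_lin \<epsilon> ` ?F"
    by (simp only: image_image edge_lengths_class) (intro image_cong refl, simp add: length_vector_signed)
  then show ?thesis using orthant_face[of J] by (simp add: edge_lengths_sign_cone)
qed

section \<open>The dimension of the deformation cone\<close>

lemma admissible_unit_weight:
  assumes "s \<in> E \<Longrightarrow> 0 \<le> r" shows "admissible (unit_weight s r)"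
  using assms by (auto simp: admissible_def unit_weight_def)

lemma deformation_cone_dim_eq:
  assumes K4: "\<not> (\<exists>K. card K = 4 \<and> clique E K)"
  shows "deformation_cone_dim Z = card E + card (triangles E)"
proof -
  interpret linear_coordinates cells lin by (rule lin_coordinates)
  have "dim (edge_length_cone Z) = card cells"
  proof (rule dim_eqI)
    show "(\<lambda>s. lin (unit_weight s 1)) ` cells \<subseteq> edge_length_cone Z"
    proof clarify
      fix s assume "s \<in> cells"
      \<comment> \<open>The weight 1 has no negative part, so \<open>coord\<close> changes
        nothing.\<close>
      have "coord (unit_weight s 1) x = unit_weight s 1 x" for x
      proof -
        have "max 0 (- unit_weight s 1 t) = 0" for t by (simp add: unit_weight_def)
        then show ?thesis by (simp add: coord_def)
      qed
      then have "lin (unit_weight s 1) = lin (coord (unit_weight s 1))" by (intro lin_cong) simp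
      also have "\<dots> = length_vector (unit_weight s 1)"
        by (rule length_vector_eq_lin[symmetric]) (simp add: unit_weight_def)
      finally show "lin (unit_weight s 1) \<in> edge_length_cone Z"
        using length_vector_in_cone[of "unit_weight s 1"] by (simp add: unit_weight_def)
    qed
    show "edge_length_cone Z \<subseteq> range lin"
      unfolding edge_length_cone_eq[OF K4] using length_vector_eq_lin by auto
  qed
  also have "\<dots> = card E + card (triangles E)"
    using edges_triangles_disjoint by (intro card_Un_disjoint) auto
  finally show ?thesis by (simp add: deformation_cone_dim_def)
qed

section \<open>The rays of the deformation cone\<close>

text \<open>The pair \<open>(s, \<sigma>)\<close> stands for \<sigma>\<Delta>_s. A segment and its
  reflection are translates, so edges occur with sign 1 only.\<close>

definition ray_index :: "('v set \<times> real) set" where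
  "ray_index = E \<times> {1} \<union> triangles E \<times> {1, -1}"

definition length_ray :: "'v set \<times> real \<Rightarrow> ((real ^ 'v) set \<Rightarrow>\<^sub>0 real) set" where
  "length_ray = (\<lambda>(s, \<sigma>). {length_vector (unit_weight s (r * \<sigma>)) | r. 0 \<le> r})"

lemma ray_indexD:
  assumes "(s, \<sigma>) \<in> ray_index"
  shows "s \<in> cells" "s \<in> E \<Longrightarrow> \<sigma> = 1" "\<sigma> = 1 \<or> \<sigma> = -1"
  using assms triangle_not_edge by (auto simp: ray_index_def)

lemma admissible_ray: "(s, \<sigma>) \<in> ray_index \<Longrightarrow> 0 \<le> r \<Longrightarrow> admissible (unit_weight s (r * \<sigma>))"
  using ray_indexD(2) by (intro admissible_unit_weight) auto

lemma length_vector_ray: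
  assumes "(s, \<sigma>) \<in> ray_index" "0 \<le> r"
  shows "length_vector (unit_weight s (r * \<sigma>)) = r *\<^sub>R length_vector (unit_weight s \<sigma>)"
proof -
  \<comment> \<open>The weight sits on the single cell \<open>s\<close>, so a pattern with sign
    \<open>\<sigma>\<close> on all triangles will do.\<close>
  define \<epsilon> where "\<epsilon> = (\<lambda>t\<in>triangles E. \<sigma>)"
  have *: "length_vector (unit_weight s (q * \<sigma>)) = signed_lin \<epsilon> (unit_weight s q)" if q: "0 \<le> q" for q
  proof -
    have "length_vector (unit_weight s (q * \<sigma>)) = length_vector (signed \<epsilon> (unit_weight s q))"
      unfolding length_vector_def
      using ray_indexD[OF assms(1)] triangle_not_edge
      by (intro arg_cong[where f = "edge_lengths_of Z"] weighted_sum_cong)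
        (auto simp: signed_def unit_weight_def \<epsilon>_def)
    also have "\<dots> = signed_lin \<epsilon> (unit_weight s q)"
      using q by (intro length_vector_signed) (auto simp: unit_weight_def)
    finally show ?thesis .
  qed
  have "signed_lin \<epsilon> (unit_weight s r) = r *\<^sub>R signed_lin \<epsilon> (unit_weight s 1)"
  proof -
    have "signed_lin \<epsilon> (\<lambda>x. r * unit_weight s 1 x) = r *\<^sub>R signed_lin \<epsilon> (unit_weight s 1)"
      unfolding signed_lin_def lin_scaleR[symmetric]
      by (intro arg_cong[where f = lin] ext) (simp add: algebra_simps sum_distrib_left)
    then show ?thesis by (simp add: unit_weight_scale)
  qed
  then show ?thesis using *[OF assms(2)] *[of 1] by simp
qed

lemma length_ray_eq:
  assumes "(s, \<sigma>) \<in> ray_index"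
  shows "length_ray (s, \<sigma>) = {r *\<^sub>R length_vector (unit_weight s \<sigma>) | r. 0 \<le> r}"
proof -
  have "length_vector (unit_weight s (r * \<sigma>)) = x \<longleftrightarrow> r *\<^sub>R length_vector (unit_weight s \<sigma>) = x" if "0 \<le> r" for r x
    using length_vector_ray[OF assms that] by simp
  then show ?thesis unfolding length_ray_def by (auto simp: eq_commute)
qed

lemma length_vector_unit_neq_0:
  assumes "(s, \<sigma>) \<in> ray_index"
  shows "length_vector (unit_weight s \<sigma>) \<noteq> 0"
proof
  assume z: "length_vector (unit_weight s \<sigma>) = 0"
  have "length_vector (unit_weight s \<sigma>) = length_vector (unit_weight s (0 * \<sigma>))"
    using z length_vector_ray[OF assms, of 0] by simp
  then have "unit_weight s \<sigma> s = unit_weight s (0 * \<sigma>) s"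
    using admissible_ray[OF assms, of 1] admissible_ray[OF assms, of 0] ray_indexD(1)[OF assms]
    by (intro length_vector_inj) auto
  then show False using ray_indexD(3)[OF assms] by (auto simp: unit_weight_def)
qed

lemma dim_length_ray:
  assumes "(s, \<sigma>) \<in> ray_index"
  shows "dim (length_ray (s, \<sigma>)) = 1"
proof -
  let ?v = "length_vector (unit_weight s \<sigma>)"
  have "?v \<in> length_ray (s, \<sigma>)" unfolding length_ray_eq[OF assms] by (intro CollectI exI[of _ 1]) simp
  then have "span {?v} = span (length_ray (s, \<sigma>))"
    unfolding span_eq by (auto simp: length_ray_eq[OF assms] intro: span_base span_scale)
  moreover have "independent {?v}" using length_vector_unit_neq_0[OF assms] by simp
  ultimately show ?thesis using dim_eq_card[of "{?v}"] by simp
qed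

text \<open>
  In the coordinates \<open>w\<close> a convex combination of edge length vectors is linear on triangles, while
  on edges it exceeds the linear combination as soon as two triangle weights of opposite sign cancel.
\<close>

lemma convex_combination_weights:
  assumes w: "admissible wa" "admissible wb" "admissible wx" and u: "0 < u" "u < 1"
    and x: "length_vector wx = (1 - u) *\<^sub>R length_vector wa + u *\<^sub>R length_vector wb"
  shows "t \<in> triangles E \<Longrightarrow> wx t = (1 - u) * wa t + u * wb t"
    and "e \<in> E \<Longrightarrow> wx e = 0 \<Longrightarrow> wa e = 0 \<and> wb e = 0"
    and "e \<in> E \<Longrightarrow> wx e = 0 \<Longrightarrow> t \<in> triangles E \<Longrightarrow> e \<subseteq> t \<Longrightarrow>
      max 0 (- wx t) = (1 - u) * max 0 (- wa t) + u * max 0 (- wb t)"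
proof -
  have "lin (coord wx) = lin (\<lambda>s. (1 - u) * coord wa s + u * coord wb s)"
    using x by (simp only: lin_add lin_scaleR length_vector_eq_lin[OF admissibleD[OF w(1)]]
      length_vector_eq_lin[OF admissibleD[OF w(2)]] length_vector_eq_lin[OF admissibleD[OF w(3)]])
  then have c: "coord wx s = (1 - u) * coord wa s + u * coord wb s" if "s \<in> cells" for s
    using lin_eqD that by blast
  show tri: "wx t = (1 - u) * wa t + u * wb t" if "t \<in> triangles E" for t
    using c[of t] that by (simp add: coord_triangle)
  \<comment> \<open>The slack in the convexity of the negative part at \<open>t\<close>. At an edge
    of weight 0, the scaled edge weights of both ends and the slacks of all triangles over it are
    nonnegative with sum 0.\<close>
  let ?g = "\<lambda>t. (1 - u) * max 0 (- wa t) + u * max 0 (- wb t) - max 0 (- wx t)"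
  have gap: "0 \<le> ?g t" if "t \<in> triangles E" for t
    using convex_combination_neg_part[OF u, of "wa t" "wb t"] tri[OF that] by simp
  have key: "(1 - u) * wa e = 0 \<and> u * wb e = 0 \<and> (\<Sum>t | t \<in> triangles E \<and> e \<subseteq> t. ?g t) = 0"
    if e: "e \<in> E" "wx e = 0" for e
  proof -
    have "wx e = (1 - u) * wa e + u * wb e + (\<Sum>t | t \<in> triangles E \<and> e \<subseteq> t. ?g t)"
      using c[of e] e by (simp add: coord_edge sum.distrib sum_subtractf sum_distrib_left algebra_simps)
    moreover have "0 \<le> (\<Sum>t | t \<in> triangles E \<and> e \<subseteq> t. ?g t)" using gap by (intro sum_nonneg) auto
    moreover have "0 \<le> wa e" "0 \<le> wb e" using w e by (auto simp: admissible_def)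
    then have "0 \<le> (1 - u) * wa e" "0 \<le> u * wb e" using u by auto
    ultimately show ?thesis using e(2) by linarith
  qed
  show "wa e = 0 \<and> wb e = 0" if "e \<in> E" "wx e = 0" for e
    using key[OF that] u by simp
  show "max 0 (- wx t) = (1 - u) * max 0 (- wa t) + u * max 0 (- wb t)"
    if "e \<in> E" "wx e = 0" "t \<in> triangles E" "e \<subseteq> t" for e t
  proof -
    have "\<forall>t\<in>{t. t \<in> triangles E \<and> e \<subseteq> t}. ?g t = 0"
      using key[OF that(1,2)] gap by (subst (asm) sum_nonneg_eq_0_iff) auto
    then show ?thesis using that by auto
  qed
qed

text \<open>Supplies an edge on which a weight concentrated on \<open>s\<close> vanishes, so that
  negative parts can be compared at \<open>t\<close>.\<close>

lemma triangle_edge_avoiding: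
  assumes "t \<in> triangles E" "s \<noteq> t"
  obtains e where "e \<in> E" "e \<subseteq> t" "e \<noteq> s"
proof -
  obtain i j k where t: "t = {i, j, k}" "i \<noteq> j" "i \<noteq> k" "j \<noteq> k" "{i, j} \<in> E" "{i, k} \<in> E"
    using assms(1) by (rule triangleE)
  have "{i, j} \<noteq> {i, k}" using t by (auto simp: doubleton_eq_iff)
  then have "{i, j} \<noteq> s \<or> {i, k} \<noteq> s" by auto
  then show ?thesis using that t by blast
qed

text \<open>The ends of a segment meeting the ray inside must have weights concentrated on
  \<open>s\<close>. At any other triangle an edge of weight 0 forces equality for the negative
  parts, so both weights are nonnegative, and their combination is 0. The same equality at a
  triangle \<open>s\<close> fixes the signs there.\<close>

lemma length_ray_face:
  assumes K4: "\<not> (\<exists>K. card K = 4 \<and> clique E K)" and r: "(s, \<sigma>) \<in> ray_index"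
  shows "length_ray (s, \<sigma>) face_of edge_length_cone Z"
  unfolding face_of_def
proof (intro conjI ballI impI)
  let ?v = "length_vector (unit_weight s \<sigma>)"
  show "length_ray (s, \<sigma>) \<subseteq> edge_length_cone Z"
    unfolding length_ray_def using length_vector_in_cone admissibleD[OF admissible_ray[OF r]] by auto
  show "convex (length_ray (s, \<sigma>))"
    unfolding convex_def
  proof (intro ballI allI impI)
    fix a b and p q :: real assume "a \<in> length_ray (s, \<sigma>)" "b \<in> length_ray (s, \<sigma>)" and pq: "0 \<le> p" "0 \<le> q"
    then obtain x y where "a = x *\<^sub>R ?v" "b = y *\<^sub>R ?v" "0 \<le> x" "0 \<le> y" unfolding length_ray_eq[OF r] by blast
    then show "p *\<^sub>R a + q *\<^sub>R b \<in> length_ray (s, \<sigma>)" unfolding length_ray_eq[OF r]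
      using pq by (intro CollectI exI[of _ "p * x + q * y"]) (simp add: scaleR_add_left)
  qed
  fix a b x assume "a \<in> edge_length_cone Z" "b \<in> edge_length_cone Z" "x \<in> length_ray (s, \<sigma>)"
    and seg: "x \<in> open_segment a b"
  then obtain wa wb c where w: "admissible wa" "admissible wb" "a = length_vector wa" "b = length_vector wb"
    and c: "0 \<le> c" "x = length_vector (unit_weight s (c * \<sigma>))"
    unfolding edge_length_cone_eq[OF K4] length_ray_def admissible_def by blast
  obtain u where u: "0 < u" "u < 1" "x = (1 - u) *\<^sub>R a + u *\<^sub>R b" using seg by (auto simp: in_segment)
  let ?wx = "unit_weight s (c * \<sigma>)"
  note comb = convex_combination_weights[OF w(1,2) admissible_ray[OF r c(1)] u(1,2)]
  have x: "length_vector ?wx = (1 - u) *\<^sub>R length_vector wa + u *\<^sub>R length_vector wb" using u(3) w c by simp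
  have off: "?wx y = 0" if "y \<noteq> s" for y using that by (simp add: unit_weight_def)
  have zero: "wa y = 0 \<and> wb y = 0" if y: "y \<in> cells" "y \<noteq> s" for y
  proof (cases "y \<in> E")
    case True
    then show ?thesis using comb(2)[OF x True off[OF y(2)]] by blast
  next
    case False
    then have t: "y \<in> triangles E" using y by blast
    obtain e where e: "e \<in> E" "e \<subseteq> y" "e \<noteq> s" using triangle_edge_avoiding[OF t y(2)[symmetric]] by blast
    have "(1 - u) * max 0 (- wa y) + u * max 0 (- wb y) = 0"
      using comb(3)[OF x e(1) off[OF e(3)] t e(2)] off[OF y(2)] by simp
    moreover have "0 \<le> (1 - u) * max 0 (- wa y)" "0 \<le> u * max 0 (- wb y)" using u by auto
    ultimately have "(1 - u) * max 0 (- wa y) = 0" "u * max 0 (- wb y) = 0" by (simp_all only: add_nonneg_eq_0_iff)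
    then have nn: "0 \<le> wa y" "0 \<le> wb y" using u by auto
    moreover have "(1 - u) * wa y + u * wb y = 0" using comb(1)[OF x t] off[OF y(2)] by simp
    moreover have "0 \<le> (1 - u) * wa y" "0 \<le> u * wb y" using nn u by auto
    ultimately have "(1 - u) * wa y = 0" "u * wb y = 0" by (simp_all only: add_nonneg_eq_0_iff)
    then show ?thesis using u by simp
  qed
  have sign: "0 \<le> wa s * \<sigma> \<and> 0 \<le> wb s * \<sigma>"
  proof (cases "s \<in> E")
    case True
    then show ?thesis using w ray_indexD(2)[OF r] by (simp add: admissible_def)
  next
    case False
    then have t: "s \<in> triangles E" using ray_indexD(1)[OF r] by blast
    obtain i j k where ijk: "s = {i, j, k}" "i \<noteq> j" "i \<noteq> k" "j \<noteq> k" "{i, j} \<in> E" using t by (rule triangleE)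
    have e: "{i, j} \<in> E" "{i, j} \<subseteq> s" "{i, j} \<noteq> s" using ijk False by auto
    have gap: "max 0 (- ?wx s) = (1 - u) * max 0 (- wa s) + u * max 0 (- wb s)"
      by (rule comb(3)[OF x e(1) off[OF e(3)] t e(2)])
    have lin: "?wx s = (1 - u) * wa s + u * wb s" by (rule comb(1)[OF x t])
    have ws: "?wx s = c * \<sigma>" by (simp add: unit_weight_def)
    consider "\<sigma> = 1" | "\<sigma> = -1" using ray_indexD(3)[OF r] by blast
    then show ?thesis
    proof cases
      case 1
      then have "(1 - u) * max 0 (- wa s) + u * max 0 (- wb s) = 0" using gap ws c by simp
      moreover have "0 \<le> (1 - u) * max 0 (- wa s)" "0 \<le> u * max 0 (- wb s)" using u by auto
      ultimately have "(1 - u) * max 0 (- wa s) = 0" "u * max 0 (- wb s) = 0" by (simp_all only: add_nonneg_eq_0_iff)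
      then show ?thesis using u 1 by auto
    next
      case 2
      \<comment> \<open>max 0 (-x) + x is the positive part of x; it vanishes because the weight at
        \<open>s\<close> is at most 0.\<close>
      have "max 0 (- ?wx s) + ?wx s = 0" using ws c 2 by simp
      then have "(1 - u) * (max 0 (- wa s) + wa s) + u * (max 0 (- wb s) + wb s) = 0"
        using gap lin by (simp add: algebra_simps)
      moreover have "0 \<le> (1 - u) * (max 0 (- wa s) + wa s)" "0 \<le> u * (max 0 (- wb s) + wb s)" using u by auto
      ultimately have "(1 - u) * (max 0 (- wa s) + wa s) = 0" "u * (max 0 (- wb s) + wb s) = 0" by (simp_all only: add_nonneg_eq_0_iff)
      then show ?thesis using u 2 by auto
    qed
  qed
  have ray: "length_vector w \<in> length_ray (s, \<sigma>)" if "0 \<le> w s * \<sigma>" "\<And>y. y \<in> cells \<Longrightarrow> y \<noteq> s \<Longrightarrow> w y = 0" for w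
  proof -
    have "w s * \<sigma> * \<sigma> = w s" using ray_indexD(3)[OF r] by auto
    then have "length_vector w = length_vector (unit_weight s (w s * \<sigma> * \<sigma>))"
      unfolding length_vector_def using that(2)
      by (intro arg_cong[where f = "edge_lengths_of Z"] weighted_sum_cong) (simp add: unit_weight_def)
    then show ?thesis unfolding length_ray_def using that(1) by auto
  qed
  show "a \<in> length_ray (s, \<sigma>)" "b \<in> length_ray (s, \<sigma>)"
    unfolding w using ray sign zero by auto
qed

lemma edge_length_cone_pointed:
  assumes "a \<in> edge_length_cone Z" "b \<in> edge_length_cone Z" "a + b = 0"
  shows "a = 0"
proof (rule poly_mapping_eqI)
  fix e
  have nn: "0 \<le> Poly_Mapping.lookup l e" if "l \<in> edge_length_cone Z" for l
    using that unfolding edge_length_cone_def by (cases "e edge_of Z") (auto simp: in_keys_iff, metis in_keys_iff mem_Collect_eq order_refl subsetD)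
  have "Poly_Mapping.lookup a e + Poly_Mapping.lookup b e = 0"
    using assms(3) by (simp add: lookup_add[symmetric])
  then show "Poly_Mapping.lookup a e = Poly_Mapping.lookup 0 e"
    using nn[OF assms(1)] nn[OF assms(2)] by simp
qed

lemma edge_length_cone_scaleR:
  assumes K4: "\<not> (\<exists>K. card K = 4 \<and> clique E K)" and "l \<in> edge_length_cone Z" "0 \<le> r"
  shows "r *\<^sub>R l \<in> edge_length_cone Z"
proof -
  obtain w where w: "admissible w" "l = length_vector w"
    using assms(2) unfolding edge_length_cone_eq[OF K4] admissible_def by blast
  interpret linear_coordinates cells "signed_lin (adapted w)"
    by (rule signed_lin_coordinates[OF adapted_sign_vector])
  have "l = length_vector (signed (adapted w) (\<lambda>s. \<bar>w s\<bar>))"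
    unfolding w(2) length_vector_def using signed_adapted[OF w(1)]
    by (intro arg_cong[where f = "edge_lengths_of Z"] weighted_sum_cong) simp
  then have "l = signed_lin (adapted w) (\<lambda>s. \<bar>w s\<bar>)" by (simp add: length_vector_signed)
  then have "r *\<^sub>R l = signed_lin (adapted w) (\<lambda>s. r * \<bar>w s\<bar>)" by (simp add: \<Phi>_scale)
  also have "\<dots> = length_vector (signed (adapted w) (\<lambda>s. r * \<bar>w s\<bar>))"
    using assms(3) by (intro length_vector_signed[symmetric]) simp
  finally show ?thesis
    using length_vector_in_cone[OF admissibleD[OF admissible_signed]] assms(3) by simp
qed

text \<open>A nonzero point of \<open>R\<close> lies in the cone of some sign pattern. Splitting off
  one positive coefficient makes it the midpoint of two points of the edge length cone, one of them
  on a known ray; the face property puts this point into \<open>R\<close>, and dimension 1 leaves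
  room for nothing else.\<close>

lemma one_dim_face_length_ray:
  assumes K4: "\<not> (\<exists>K. card K = 4 \<and> clique E K)" and R: "R face_of edge_length_cone Z" and d: "dim R = 1"
  shows "\<exists>i\<in>ray_index. R = length_ray i"
proof -
  obtain B where B: "B \<subseteq> R" "independent B" "R \<subseteq> span B" "card B = 1" using basis_exists[of R] d by metis
  then obtain x where Bx: "B = {x}" by (auto simp: card_1_singleton_iff)
  then have x: "x \<in> R" "x \<noteq> 0" "R \<subseteq> span {x}" using B by auto
  have RC: "R \<subseteq> edge_length_cone Z" using R face_of_imp_subset by blast
  obtain w where w: "admissible w" "x = length_vector w"
    using x RC unfolding edge_length_cone_eq[OF K4] admissible_def by blast
  define \<epsilon> \<mu> where "\<epsilon> = adapted w" and "\<mu> = (\<lambda>s. \<bar>w s\<bar>)"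
  have \<epsilon>: "\<epsilon> \<in> sign_vectors E" by (simp add: \<epsilon>_def adapted_sign_vector)
  interpret linear_coordinates cells "signed_lin \<epsilon>" by (rule signed_lin_coordinates[OF \<epsilon>])
  have "x = length_vector (signed \<epsilon> \<mu>)"
    unfolding w(2) length_vector_def using signed_adapted[OF w(1)]
    by (intro arg_cong[where f = "edge_lengths_of Z"] weighted_sum_cong) (simp add: \<epsilon>_def \<mu>_def)
  then have x\<mu>: "x = signed_lin \<epsilon> \<mu>" by (simp add: length_vector_signed \<mu>_def)
  then obtain s where s: "s \<in> cells" "\<mu> s \<noteq> 0" using x(2) \<Phi>_eq_0 by blast
  then have \<mu>s: "0 < \<mu> s" by (simp add: \<mu>_def)
  have inC: "signed_lin \<epsilon> \<nu> \<in> edge_length_cone Z" if "nonneg \<nu>" for \<nu>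
    using length_vector_in_cone[OF admissibleD[OF admissible_signed[OF that]]] length_vector_signed[OF that] by simp
  define \<sigma> where "\<sigma> = (if s \<in> E then 1 else \<epsilon> s)"
  have r: "(s, \<sigma>) \<in> ray_index"
    using s sign_vectorsD[OF \<epsilon>, of s] by (auto simp: ray_index_def \<sigma>_def)
  let ?v = "length_vector (unit_weight s \<sigma>)"
  have v: "?v = signed_lin \<epsilon> (unit_weight s 1)"
  proof -
    have "?v = length_vector (signed \<epsilon> (unit_weight s 1))"
      unfolding length_vector_def
      by (intro arg_cong[where f = "edge_lengths_of Z"] weighted_sum_cong) (simp add: signed_def unit_weight_def \<sigma>_def)
    also have "\<dots> = signed_lin \<epsilon> (unit_weight s 1)" by (rule length_vector_signed) (simp add: unit_weight_def)
    finally show ?thesis .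
  qed
  \<comment> \<open>The factors 2 make \<open>x\<close> the midpoint of \<open>y\<close> and
    \<open>z\<close>.\<close>
  define y where "y = (2 * \<mu> s) *\<^sub>R ?v"
  define z where "z = signed_lin \<epsilon> (\<lambda>q. 2 * (if q = s then 0 else \<mu> q))"
  have yC: "y \<in> edge_length_cone Z" "z \<in> edge_length_cone Z"
  proof -
    have "y = signed_lin \<epsilon> (unit_weight s (2 * \<mu> s))"
      unfolding y_def v \<Phi>_scale[symmetric] unit_weight_scale by simp
    then show "y \<in> edge_length_cone Z" using inC \<mu>s by (simp add: unit_weight_def)
    show "z \<in> edge_length_cone Z" unfolding z_def by (rule inC) (simp add: \<mu>_def)
  qed
  have "2 *\<^sub>R x = y + z"
  proof -
    have "y + z = signed_lin \<epsilon> (\<lambda>q. (2 * \<mu> s) * unit_weight s 1 q + 2 * (if q = s then 0 else \<mu> q))"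
      unfolding y_def z_def v by (simp only: \<Phi>_add \<Phi>_scale)
    also have "(\<lambda>q. (2 * \<mu> s) * unit_weight s 1 q + 2 * (if q = s then 0 else \<mu> q)) = (\<lambda>q. 2 * \<mu> q)"
      by (auto simp: unit_weight_def)
    finally show ?thesis unfolding x\<mu> by (simp add: \<Phi>_scale)
  qed
  then have "(1/2) *\<^sub>R (2 *\<^sub>R x) = (1/2) *\<^sub>R (y + z)" by simp
  then have xyz: "x = (1 - 1/2) *\<^sub>R y + (1/2) *\<^sub>R z" by (simp add: scaleR_add_right)
  have yR: "y \<in> R"
  proof (cases "y = z")
    case True
    then have "x = y" using xyz by (simp add: scaleR_add_left[symmetric])
    then show ?thesis using x by simp
  next
    case False
    then have "x \<in> open_segment y z" using xyz unfolding in_segment by (intro conjI exI[of _ "1/2"]) auto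
    then show ?thesis using R yC x(1) unfolding face_of_def by blast
  qed
  have y0: "y \<noteq> 0" using length_vector_unit_neq_0[OF r] \<mu>s by (simp add: y_def)
  \<comment> \<open>For q \<ge> 0 the point \<open>y\<close> lies strictly between 0 and (q + 2)y,
    so both ends belong to \<open>R\<close>, and with them the point qy by convexity.\<close>
  have ray: "q *\<^sub>R y \<in> R" if q: "0 \<le> q" for q
  proof -
    have C: "0 *\<^sub>R y \<in> edge_length_cone Z" "(q + 2) *\<^sub>R y \<in> edge_length_cone Z"
      using edge_length_cone_scaleR[OF K4 yC(1)] q by (simp_all del: scaleR_zero_left)
    have "y \<in> open_segment (0 *\<^sub>R y) ((q + 2) *\<^sub>R y)"
      unfolding in_segment using q y0 by (intro conjI exI[of _ "1 / (q + 2)"]) auto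
    then have ends: "0 *\<^sub>R y \<in> R" "(q + 2) *\<^sub>R y \<in> R"
      using R C yR unfolding face_of_def by blast+
    have "convex R" using R face_of_imp_convex by blast
    then have "(1 - q / (q + 2)) *\<^sub>R (0 *\<^sub>R y) + (q / (q + 2)) *\<^sub>R ((q + 2) *\<^sub>R y) \<in> R"
      using q ends by (intro convexD_alt) auto
    then show ?thesis using q by simp
  qed
  have "R = length_ray (s, \<sigma>)"
  proof (intro subset_antisym subsetI)
    fix p assume p: "p \<in> R"
    have "p \<in> range (\<lambda>k. k *\<^sub>R x)" "y \<in> range (\<lambda>k. k *\<^sub>R x)"
      using x(3) p yR unfolding span_singleton by blast+
    then obtain a b where ab: "p = a *\<^sub>R x" "y = b *\<^sub>R x" by blast
    then have "b \<noteq> 0" using y0 by auto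
    then have py: "p = (a / b) *\<^sub>R y" using ab by simp
    \<comment> \<open>A negative multiple of \<open>y\<close> would be the negative of a point of
      the cone, which is pointed.\<close>
    have "0 \<le> a / b"
    proof (rule ccontr)
      assume neg: "\<not> 0 \<le> a / b"
      have "p + (- (a / b)) *\<^sub>R y = 0" using py by (simp add: scaleR_add_left[symmetric])
      moreover have "(- (a / b)) *\<^sub>R y \<in> edge_length_cone Z"
        using neg by (intro edge_length_cone_scaleR[OF K4 yC(1)]) simp
      ultimately have "p = 0" using edge_length_cone_pointed p RC by blast
      then show False using py y0 neg by auto
    qed
    then have "0 \<le> a / b * (2 * \<mu> s)" using \<mu>s by (intro mult_nonneg_nonneg) auto
    moreover have "p = (a / b * (2 * \<mu> s)) *\<^sub>R ?v" unfolding py y_def by simp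
    ultimately show "p \<in> length_ray (s, \<sigma>)" unfolding length_ray_eq[OF r] by blast
  next
    fix p assume "p \<in> length_ray (s, \<sigma>)"
    then obtain q where q: "0 \<le> q" "p = q *\<^sub>R ?v" unfolding length_ray_eq[OF r] by blast
    then have "p = (q / (2 * \<mu> s)) *\<^sub>R y" using \<mu>s by (simp add: y_def)
    then show "p \<in> R" using ray[of "q / (2 * \<mu> s)"] q \<mu>s by simp
  qed
  then show ?thesis using r by blast
qed

section \<open>From rays of length vectors to rays of translation classes\<close>

definition class_ray :: "'v set \<times> real \<Rightarrow> (real ^ 'v) set set set" where
  "class_ray = (\<lambda>(s, \<sigma>). spanned_ray (dilate \<sigma> (simplex_on s)))"

lemma weighted_sum_unit:
  assumes "s \<in> cells"
  shows "weighted_sum (unit_weight s r) = dilate r (simplex_on s)"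
proof -
  have z: "dilate 0 (simplex_on t) = {0}" if "t \<in> cells" for t
    using simplex_on_nonempty[OF cells_nonempty[OF that]] by (auto simp: dilate_def)
  have "weighted_sum (unit_weight s r) = (\<Sum>t\<in>cells. if t = s then dilate r (simplex_on s) else 0)"
    unfolding weighted_sum_def by (rule sum.cong) (auto simp: unit_weight_def z)
  also have "\<dots> = dilate r (simplex_on s)" using assms by simp
  finally show ?thesis .
qed

lemma class_ray_eq:
  assumes "(s, \<sigma>) \<in> ray_index"
  shows "class_ray (s, \<sigma>) = {class_of (unit_weight s (r * \<sigma>)) | r. 0 \<le> r}"
  unfolding class_ray_def spanned_ray_def
  by (simp add: dilate_dilate weighted_sum_unit[OF ray_indexD(1)[OF assms]])

lemma class_ray_preimage:
  assumes K4: "\<not> (\<exists>K. card K = 4 \<and> clique E K)" and r: "(s, \<sigma>) \<in> ray_index"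
  shows "{D \<in> deformation_cone Z. edge_lengths Z D \<in> length_ray (s, \<sigma>)} = class_ray (s, \<sigma>)"
proof (intro set_eqI iffI)
  fix D assume "D \<in> {D \<in> deformation_cone Z. edge_lengths Z D \<in> length_ray (s, \<sigma>)}"
  then obtain w q where w: "admissible w" "D = class_of w" "0 \<le> q"
    "edge_lengths Z D = length_vector (unit_weight s (q * \<sigma>))"
    unfolding deformation_cone_eq[OF K4] length_ray_def by blast
  then have "length_vector w = length_vector (unit_weight s (q * \<sigma>))" using edge_lengths_class by simp
  then have "\<forall>y\<in>cells. w y = unit_weight s (q * \<sigma>) y"
    using length_vector_inj[OF w(1) admissible_ray[OF r w(3)]] by blast
  then have "D = class_of (unit_weight s (q * \<sigma>))"
    using class_of_eq_iff[OF w(1) admissible_ray[OF r w(3)]] w(2) by blast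
  then show "D \<in> class_ray (s, \<sigma>)" unfolding class_ray_eq[OF r] using w(3) by blast
next
  fix D assume "D \<in> class_ray (s, \<sigma>)"
  then obtain q where q: "0 \<le> q" "D = class_of (unit_weight s (q * \<sigma>))" unfolding class_ray_eq[OF r] by blast
  then show "D \<in> {D \<in> deformation_cone Z. edge_lengths Z D \<in> length_ray (s, \<sigma>)}"
    unfolding deformation_cone_eq[OF K4] length_ray_def using admissible_ray[OF r q(1)] edge_lengths_class by auto
qed

lemma deformation_cone_rays_eq:
  assumes K4: "\<not> (\<exists>K. card K = 4 \<and> clique E K)"
  shows "deformation_cone_rays Z = class_ray ` ray_index"
proof (intro set_eqI iffI)
  fix X assume "X \<in> deformation_cone_rays Z"
  then obtain R where R: "X = {D \<in> deformation_cone Z. edge_lengths Z D \<in> R}"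
    "R face_of edge_length_cone Z" "dim R = 1" unfolding deformation_cone_rays_def by blast
  then obtain s \<sigma> where "(s, \<sigma>) \<in> ray_index" "R = length_ray (s, \<sigma>)"
    using one_dim_face_length_ray[OF K4] by (metis surj_pair)
  then show "X \<in> class_ray ` ray_index" using R(1) class_ray_preimage[OF K4] by blast
next
  fix X assume "X \<in> class_ray ` ray_index"
  then obtain s \<sigma> where r: "(s, \<sigma>) \<in> ray_index" "X = class_ray (s, \<sigma>)" by auto
  then show "X \<in> deformation_cone_rays Z"
    unfolding deformation_cone_rays_def
    using class_ray_preimage[OF K4 r(1)] length_ray_face[OF K4 r(1)] dim_length_ray[OF r(1)] by blast
qed

lemma card_class_rays: "card (class_ray ` ray_index) = card E + 2 * card (triangles E)"
proof -
  have "inj_on class_ray ray_index"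
  proof (rule inj_onI, clarify)
    fix s s' and \<sigma> \<sigma>' :: real
    assume r: "(s, \<sigma>) \<in> ray_index" and r': "(s', \<sigma>') \<in> ray_index" and eq: "class_ray (s, \<sigma>) = class_ray (s', \<sigma>')"
    have "class_of (unit_weight s (1 * \<sigma>)) \<in> class_ray (s, \<sigma>)"
      unfolding class_ray_eq[OF r] by (intro CollectI exI[of _ 1]) simp
    then obtain q where q: "0 \<le> q" "class_of (unit_weight s (1 * \<sigma>)) = class_of (unit_weight s' (q * \<sigma>'))"
      unfolding eq class_ray_eq[OF r'] by blast
    have "\<forall>y\<in>cells. unit_weight s (1 * \<sigma>) y = unit_weight s' (q * \<sigma>') y"
      using class_of_eq_iff[OF admissible_ray[OF r, of 1] admissible_ray[OF r' q(1)]] q(2) by simp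
    then have "unit_weight s \<sigma> s = unit_weight s' (q * \<sigma>') s" using ray_indexD(1)[OF r] by simp
    \<comment> \<open>Since \<open>\<sigma>\<close> is not 0, the cells agree; two signs that differ
      by a nonnegative factor are equal.\<close>
    then have e: "\<sigma> = (if s = s' then q * \<sigma>' else 0)" by (simp add: unit_weight_def)
    then show "s = s' \<and> \<sigma> = \<sigma>'" using ray_indexD(3)[OF r] ray_indexD(3)[OF r'] q(1) by (auto split: if_splits)
  qed
  then have "card (class_ray ` ray_index) = card ray_index" by (rule card_image)
  also have "\<dots> = card (E \<times> {1 :: real}) + card (triangles E \<times> {1, -1 :: real})"
    unfolding ray_index_def using edges_triangles_disjoint by (intro card_Un_disjoint) auto
  also have "\<dots> = card E + 2 * card (triangles E)" by (simp add: card_cartesian_product)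
  finally show ?thesis .
qed

lemma class_ray_image:
  "class_ray ` ray_index = (\<lambda>e. spanned_ray (simplex_on e)) ` E \<union>
    (\<lambda>t. spanned_ray (simplex_on t)) ` triangles E \<union>
    (\<lambda>t. spanned_ray (dilate (-1) (simplex_on t))) ` triangles E"
proof -
  have "dilate 1 A = A" for A :: "(real ^ 'v) set" by (simp add: dilate_def)
  then show ?thesis unfolding class_ray_def ray_index_def by (auto simp: image_Un image_iff)
qed

end

text \<open>A triangulation asks for more than covering and disjoint interiors: the cones have to be
  simplicial and any two have to meet in a common face. These two clauses are stated for the images
  under \<open>edge_lengths\<close>, where the cone structure is available.\<close>

theorem theorem3p3:
  fixes E :: "'v::finite set set"
  assumes simple: "\<forall>e\<in>E. card e = 2"
    and K4_free: "\<not> (\<exists>K. card K = 4 \<and> clique E K)"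
  shows "let T = triangles E; Z = graphical_zonotope E in
    deformation_cone_dim Z = card E + card T \<and>
    card (sign_cone E ` sign_vectors E) = 2 ^ card T \<and>
    (\<forall>\<epsilon>\<in>sign_vectors E.
      simplicial_cone (card E + card T) (edge_lengths Z ` sign_cone E \<epsilon>)) \<and>
    deformation_cone Z = (\<Union>\<epsilon>\<in>sign_vectors E. sign_cone E \<epsilon>) \<and>
    (\<forall>\<epsilon>\<in>sign_vectors E. \<forall>\<epsilon>'\<in>sign_vectors E. \<epsilon> \<noteq> \<epsilon>' \<longrightarrow>
      sign_cone_interior E \<epsilon> \<inter> sign_cone_interior E \<epsilon>' = {}) \<and>
    (\<forall>\<epsilon>\<in>sign_vectors E. \<forall>\<epsilon>'\<in>sign_vectors E.
      edge_lengths Z ` (sign_cone E \<epsilon> \<inter> sign_cone E \<epsilon>')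
        face_of edge_lengths Z ` sign_cone E \<epsilon>) \<and>
    deformation_cone_rays Z =
      (\<lambda>e. spanned_ray (simplex_on e)) ` E \<union>
      (\<lambda>t. spanned_ray (simplex_on t)) ` T \<union>
      (\<lambda>t. spanned_ray (dilate (-1) (simplex_on t))) ` T \<and>
    card (deformation_cone_rays Z) = card E + 2 * card T"
proof -
  interpret simple_graph E by unfold_locales (rule simple)
  have card_cells: "card cells = card E + card (triangles E)"
    using edges_triangles_disjoint by (intro card_Un_disjoint) auto
  have "simplicial_cone (card E + card (triangles E)) (edge_lengths Z ` sign_cone E \<epsilon>)" if "\<epsilon> \<in> sign_vectors E" for \<epsilon>
    using linear_coordinates.simplicial_orthant[OF signed_lin_coordinates[OF that]]
    by (simp add: edge_lengths_sign_cone card_cells)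
  moreover have "deformation_cone_rays Z = class_ray ` ray_index" by (rule deformation_cone_rays_eq[OF K4_free])
  ultimately show ?thesis
    unfolding Let_def
    using deformation_cone_dim_eq[OF K4_free] card_sign_cones deformation_cone_Union[OF K4_free]
      sign_cone_interiors_disjoint sign_cone_Int_face class_ray_image card_class_rays
    by auto
qed

end
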